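(* Let $d\ge 1$ and let $0<\beta\le\alpha<2$. Then: (i) $\mathcal M^\alpha$ endowed with the distance $\mathrm{dis}_{\alpha,\beta}$ is a complete metric space. (ii) If $\beta,\beta'\in(0,\alpha]$, the distances $\mathrm{dis}_{\alpha,\beta}$ and $\mathrm{dis}_{\alpha,\beta'}$ are equivalent in the following sense: for every $\varphi_0\in\mathcal M^\alpha$ and every $\varepsilon>0$ there exists $\delta>0$ such that for all $\varphi\in\mathcal M^\alpha$, $\mathrm{dis}_{\alpha,\beta}(\varphi,\varphi_0)<\delta$ implies $\mathrm{dis}_{\alpha,\beta'}(\varphi,\varphi_0)<\varepsilon$. (iii) For all $\alpha\in(0,2)$ and all $\beta>\alpha$, $\mathcal K^\beta\subset\mathcal M^\alpha$. (iv) For all $\alpha\in(0,2)$, $\mathcal M^\alpha\subset\mathcal F(P_\alpha(\mathbb R^d))\subsetneq\mathcal K^\alpha$. (v) For all $\alpha\in(0,2)$ with $\alpha\neq1$, $\mathcal M^\alpha=\mathcal F(P_\alpha(\mathbb R^d))$. (vi) Let $0<\beta\le\alpha<2$, let $\varphi_n,\varphi\in\mathcal M^\alpha$, and let $F_n=\mathcal F^{-1}(\varphi_n)$, $F=\mathcal F^{-1}(\varphi)$, which belong to $P_\alpha(\mathbb R^d)$. If $\lim_{n\to\infty}\mathrm{dis}_{\alpha,\beta}(\varphi_n,\varphi)=0$, then $$\lim_{n\to\infty}\int\psi(v)\,dF_n(v)=\int\psi(v)\,dF(v)$$ for every $\psi\in C(\mathbb R^d)$ satisfying the growth condition $|\psi(v)|\le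 C\langle v\rangle^\alpha$ for all $v\in\mathbb R^d$, for some constant $C$.
   Context: $\langle v\rangle=(1+|v|^2)^{1/2}$. For $0\le\alpha\le2$, $P_\alpha(\mathbb R^d)$ is the set of probability measures $F$ on $\mathbb R^d$ with $\int|v|^\alpha dF(v)<\infty$ and, when $\alpha\ge1$, also $\int v_j\,dF(v)=0$ for $j=1,\dots,d$. In particular $P_0(\mathbb R^d)$ is the set of all probability measures. The Fourier transform (characteristic function) of $F\in P_0(\mathbb R^d)$ is $\mathcal F(F)(\xi)=\int_{\mathbb R^d}e^{-iv\cdot\xi}dF(v)$; put $\mathcal K=\mathcal F(P_0(\mathbb R^d))$, and for $\varphi\in\mathcal K$ let $\mathcal F^{-1}(\varphi)$ be the probability measure with characteristic function $\varphi$. For $\alpha\geq 0$ and functions $\varphi,\tilde\varphi\in\mathcal K$ put $\|\varphi-\tilde\varphi\|_\alpha=\sup_{\xi\in\mathbb R^d\setminus\{0\}}\frac{|\varphi(\xi)-\tilde\varphi(\xi)|}{|\xi|^\alpha}$, and $\mathcal K^\alpha=\{\varphi\in\mathcal K:\|\varphi-1\|_\alpha<\infty\}$. For $\alpha\in(0,2)$ put $\|\varphi-\tilde\varphi\|_{\mathcal M^\alpha}=\int_{\mathbb R^d}\frac{|\varphi(\xi)-\tilde\varphi(\xi)|}{|\xi|^{d+\alpha}}d\xi$, and $\mathcal M^\alpha=\{\varphi\in\mathcal K:\|\varphi-1\|_{\mathcal M^\alpha}<\infty\}$. For $\beta\in(0,\alpha]$ and $\varphi,\tilde\varphi\in\mathcal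 M^\alpha$ put $\mathrm{dis}_{\alpha,\beta}(\varphi,\tilde\varphi)=\|\varphi-\tilde\varphi\|_{\mathcal M^\alpha}+\|\varphi-\tilde\varphi\|_\beta$. *)

theory Defs
  imports "HOL-Probability.Probability"
begin

text \<open>
  The space \<open>\<real>\<^sup>d\<close> with arbitrary \<open>d \<ge> 1\<close> is an arbitrary type \<open>'a\<close> of class
  \<^class>\<open>euclidean_space\<close>, with \<open>d = DIM('a)\<close>.
\<close>

definition bracket :: "'a::euclidean_space \<Rightarrow> real"
  where "bracket v = (1 + (norm v)\<^sup>2) powr (1/2)"

text \<open>
  Integrability of \<open>|v|\<^sup>\<alpha>\<close> makes the first moments below converge when \<open>\<alpha> \<ge> 1\<close>.
  For \<open>\<alpha> = 0\<close> the integrand is \<open>1\<close> off the origin and, by the convention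
  \<open>0 powr 0 = 0\<close>, it is \<open>0\<close> at the origin; it is bounded, so \<open>P_space 0\<close> consists of all
  Borel probability measures.
\<close>

definition P_space :: "real \<Rightarrow> 'a::euclidean_space measure set"
  where "P_space \<alpha> = {F. prob_space F \<and> sets F = sets borel \<and>
     integrable F (\<lambda>v. norm v powr \<alpha>) \<and>
     (\<alpha> \<ge> 1 \<longrightarrow> (\<forall>j\<in>Basis. (\<integral>v. v \<bullet> j \<partial>F) = 0))}"

definition fourier :: "'a::euclidean_space measure \<Rightarrow> 'a \<Rightarrow> complex"
  where "fourier F \<xi> = (\<integral>v. exp (- (\<i> * complex_of_real (v \<bullet> \<xi>))) \<partial>F)"

definition char_funs :: "('a::euclidean_space \<Rightarrow> complex) set"
  where "char_funs = fourier ` P_space 0"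

definition fourier_inv :: "('a::euclidean_space \<Rightarrow> complex) \<Rightarrow> 'a measure"
  where "fourier_inv \<phi> = (THE F. F \<in> P_space 0 \<and> fourier F = \<phi>)"

text \<open>
  The two distances on characteristic functions may be infinite, so they take values in
  \<^typ>\<open>ennreal\<close>.
\<close>

definition dist_K :: "real \<Rightarrow> ('a::euclidean_space \<Rightarrow> complex) \<Rightarrow> ('a \<Rightarrow> complex) \<Rightarrow> ennreal"
  where "dist_K \<alpha> \<phi> \<psi> = (SUP \<xi>\<in>UNIV - {0}. ennreal (cmod (\<phi> \<xi> - \<psi> \<xi>) / norm \<xi> powr \<alpha>))"

definition K_space :: "real \<Rightarrow> ('a::euclidean_space \<Rightarrow> complex) set"
  where "K_space \<alpha> = {\<phi> \<in> char_funs. dist_K \<alpha> \<phi> (\<lambda>_. 1) < \<infinity>}"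

definition dist_M :: "real \<Rightarrow> ('a::euclidean_space \<Rightarrow> complex) \<Rightarrow> ('a \<Rightarrow> complex) \<Rightarrow> ennreal"
  where "dist_M \<alpha> \<phi> \<psi> =
    (\<integral>\<^sup>+\<xi>. ennreal (cmod (\<phi> \<xi> - \<psi> \<xi>) / norm \<xi> powr (real DIM('a) + \<alpha>)) \<partial>lborel)"

definition M_space :: "real \<Rightarrow> ('a::euclidean_space \<Rightarrow> complex) set"
  where "M_space \<alpha> = {\<phi> \<in> char_funs. dist_M \<alpha> \<phi> (\<lambda>_. 1) < \<infinity>}"

definition dis :: "real \<Rightarrow> real \<Rightarrow> ('a::euclidean_space \<Rightarrow> complex) \<Rightarrow> ('a \<Rightarrow> complex) \<Rightarrow> ennreal"
  where "dis \<alpha> \<beta> \<phi> \<psi> = dist_M \<alpha> \<phi> \<psi> + dist_K \<beta> \<phi> \<psi>"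

end

theory Submission
  imports Defs
begin

text \<open>
  Everything follows from one inequality that compares a characteristic function \<open>\<phi>\<close> near the origin
  with the tails of its measure \<open>F\<close>. As \<open>Re (1 - \<phi> \<xi>)\<close> is the \<open>F\<close>-integral of \<open>1 - cos (v \<bullet> \<xi>)\<close>, Tonelli's
  theorem turns an integral of \<open>|\<phi> - 1| / |\<xi>|\<^bsup>d+\<alpha>\<^esup>\<close> over a ball of radius \<open>2 / R\<close> into an upper bound for
  the integral of \<open>|v|\<^sup>\<alpha>\<close> over \<open>|v| > R\<close> (\<open>tail_moment_le_low_freq\<close>): each such \<open>v\<close> has, inside
  that ball, a small ball around \<open>v / |v|\<^sup>2\<close> on which \<open>1 - cos (v \<bullet> \<xi>)\<close> is bounded below.
  
  With \<open>R = 1\<close> this gives the moment of order \<open>\<alpha>\<close> for every \<open>\<phi>\<close> in \<open>M_space \<alpha>\<close>. For \<open>\<alpha> \<ge> 1\<close> the mean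
  must vanish, because \<open>\<phi> \<xi> - 1\<close> would otherwise be of exact order \<open>|\<xi>|\<close> in most directions, and
  \<open>|\<xi>|\<^bsup>1-d-\<alpha>\<^esup>\<close> is not integrable at the origin. In the other direction, for \<open>F\<close> in \<open>P_space \<alpha>\<close> the function
  \<open>|\<phi> \<xi> - 1|\<close> is at most twice the \<open>F\<close>-integral of the Taylor bound
  \<open>min (x\<^sup>b) (x\<^bsup>b+1\<^esup>)\<close>, \<open>x = |v| |\<xi>|\<close>, where \<open>b\<close> is the integer part of \<open>\<alpha>\<close>. It is at most \<open>x\<^sup>\<alpha>\<close>, which gives
  \<open>K_space \<alpha>\<close>, and by scaling its integral against \<open>|\<xi>|\<^bsup>-d-\<alpha>\<^esup>\<close> is a multiple of \<open>|v|\<^sup>\<alpha>\<close> as soon as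
  \<open>b < \<alpha> < b + 1\<close>, which gives \<open>M_space \<alpha>\<close> for \<open>\<alpha> \<noteq> 1\<close>. The symmetric density proportional to
  \<open>|v|\<^bsup>-d-\<alpha>\<^esup>\<close> on \<open>|v| \<ge> 1\<close> shows that \<open>K_space \<alpha>\<close> is strictly larger.
  
  The integral over a ball around the origin changes by at most the distance \<open>dist_M\<close> when \<open>\<phi>\<close> is
  perturbed, so the tails of order \<open>\<alpha>\<close> are small uniformly on a ball of \<open>dist_M\<close>
  (\<open>tail_moment_uniformly_small\<close>). This uniformity is the common source of the three topological
  statements. It makes \<open>|\<phi> \<xi> - 1| / |\<xi>|\<^sup>\<alpha>\<close> uniformly small near the origin, so that the exponent \<open>\<beta>\<close>
  does not matter (\<open>dis_equivalent\<close>); it makes Cauchy sequences tight, so that their pointwise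
  limits are characteristic functions and Fatou's lemma finishes the proof of completeness
  (\<open>mcomplete_M_space\<close>); and it allows test functions of growth \<open>|v|\<^sup>\<alpha>\<close> to be truncated
  (\<open>dis_tendsto_imp_moment_convergence\<close>).
  
  The last two points use the continuity theorem in \<open>\<real>\<^sup>d\<close>. Uniqueness and weak convergence come
  from approximation of bounded continuous functions by trigonometric polynomials, uniformly on a
  compact set and boundedly everywhere. Compactness of tight sequences is reduced to Helly's selection
  theorem on the line: a measure on \<open>\<real>\<^sup>d\<close> is lifted to \<open>\<real>\<close> along a Borel section of a space-filling
  curve, and weak limits are pushed forward again by the curve.
\<close>

section \<open>Integrals of radial kernels\<close>

lemma nn_integral_lborel_scale:
  fixes f :: "'a::euclidean_space \<Rightarrow> ennreal"
  assumes [measurable]: "f \<in> borel_measurable borel" and c: "c \<noteq> 0"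
  shows "(\<integral>\<^sup>+x. f x \<partial>lborel) = ennreal (\<bar>c\<bar> ^ DIM('a)) * (\<integral>\<^sup>+x. f (c *\<^sub>R x) \<partial>lborel)"
proof -
  have "(\<integral>\<^sup>+x. f x \<partial>lborel) = (\<integral>\<^sup>+x. f x \<partial>density (distr lborel borel (\<lambda>x. 0 + c *\<^sub>R x)) (\<lambda>_. \<bar>c\<bar>^DIM('a)))"
    using lborel_affine[OF c, of "0::'a"] by simp
  also have "\<dots> = ennreal (\<bar>c\<bar> ^ DIM('a)) * (\<integral>\<^sup>+x. f (c *\<^sub>R x) \<partial>lborel)"
    by (simp add: nn_integral_density nn_integral_distr nn_integral_cmult)
  finally show ?thesis .
qed

lemma dyadic_between:
  fixes x :: real
  assumes "1 \<le> x"
  obtains k :: nat where "2 ^ k \<le> x" "x < 2 ^ Suc k"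
proof -
  have "\<exists>k. x < 2 ^ k" using real_arch_pow[of 2 x] by simp
  then have l: "x < 2 ^ (LEAST k. x < 2 ^ k)" by (rule LeastI_ex)
  have "(LEAST k. x < 2 ^ k) \<noteq> 0" using l assms by (intro notI) simp
  then obtain k where k: "(LEAST k. x < 2 ^ k) = Suc k" by (meson not0_implies_Suc)
  have "\<not> x < 2 ^ k" using not_less_Least[of k "\<lambda>k. x < 2 ^ k"] k by simp
  with l k that[of k] show ?thesis by simp
qed

text \<open>
  On the shell \<open>2\<^bsup>-k-1\<^esup> < x \<le> 2\<^bsup>-k\<^esup>\<close> the kernel is comparable with its value at \<open>2\<^bsup>-k\<^esup>\<close>, and likewise on the
  shells outside the unit ball. Replacing the shells by full balls only increases the sum, and
  the volume of a ball is explicit.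
\<close>
lemma radial_kernel_le_dyadic_sum:
  fixes x a b \<alpha> :: real and d :: nat
  assumes x: "x > 0" and b: "b < \<alpha>" and a: "\<alpha> < a"
  shows "ennreal (min (x powr a) (x powr b) / x powr (real d + \<alpha>)) \<le>
    (\<Sum>k. ennreal (2 powr d * (2 ^ k) powr (real d - (a - \<alpha>))) * indicator {..1 / 2 ^ k} x
        + ennreal ((2 ^ k) powr (- real d - (\<alpha> - b))) * indicator {..2 ^ Suc k} x)" (is "_ \<le> (\<Sum>k. ?f k)")
proof (cases "x \<ge> 1")
  case True
  then obtain k where k: "2 ^ k \<le> x" "x < 2 ^ Suc k" by (rule dyadic_between)
  have "min (x powr a) (x powr b) / x powr (real d + \<alpha>) \<le> x powr b / x powr (real d + \<alpha>)"
    by (intro divide_right_mono) auto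
  also have "\<dots> = x powr (- real d - (\<alpha> - b))"
    using x by (simp add: powr_diff[symmetric] algebra_simps)
  also have "\<dots> \<le> (2 ^ k) powr (- real d - (\<alpha> - b))"
    by (intro powr_mono2') (use k b in auto)
  finally have "ennreal (min (x powr a) (x powr b) / x powr (real d + \<alpha>)) \<le> ?f k"
    using k by (auto intro!: add_increasing ennreal_leI)
  also have "\<dots> \<le> (\<Sum>k. ?f k)"
    using sum_le_suminf[of ?f "{k}"] by simp
  finally show ?thesis .
next
  case False
  then have "1 \<le> 1 / x" using x by simp
  then obtain k where k: "2 ^ k \<le> 1 / x" "1 / x < 2 ^ Suc k" by (rule dyadic_between)
  have xk: "x \<le> 1 / 2 ^ k" using k(1) x by (simp add: field_simps)
  have y: "2 * 2 ^ k > 1 / x" using k by simp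
  have "min (x powr a) (x powr b) / x powr (real d + \<alpha>) \<le> x powr a / x powr (real d + \<alpha>)"
    by (intro divide_right_mono) auto
  also have "\<dots> = x powr (a - \<alpha>) * x powr (- real d)"
    using x by (simp add: powr_add[symmetric] powr_diff[symmetric] algebra_simps)
  also have "\<dots> \<le> (1 / 2 ^ k) powr (a - \<alpha>) * (1 / (2 * 2 ^ k)) powr (- real d)"
    using y x by (intro mult_mono powr_mono2 powr_mono2' xk) (use a in \<open>auto simp: field_simps\<close>)
  also have "\<dots> = 2 powr d * (2 ^ k) powr (real d - (a - \<alpha>))"
    by (simp add: powr_divide powr_mult powr_diff powr_minus field_simps powr_add)
  finally have "ennreal (min (x powr a) (x powr b) / x powr (real d + \<alpha>)) \<le> ?f k"
    using xk by (auto intro!: add_increasing2 ennreal_leI)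
  also have "\<dots> \<le> (\<Sum>k. ?f k)"
    using sum_le_suminf[of ?f "{k}"] by simp
  finally show ?thesis .
qed

lemma summable_two_power_powr:
  fixes s :: real
  assumes "s < 0"
  shows "summable (\<lambda>k. (2 ^ k :: real) powr s)"
proof -
  have "(2 ^ k :: real) powr s = (2 powr s) ^ k" for k
    by (simp add: powr_realpow[symmetric] powr_powr powr_power mult.commute)
  moreover have "2 powr s < 1" using assms by (simp add: powr_less_one)
  ultimately show ?thesis by (simp add: summable_geometric)
qed

text \<open>
  The exponent \<open>a > \<alpha>\<close> ensures integrability at the origin and \<open>b < \<alpha>\<close> integrability at infinity. After
  integration of the dyadic bound, the \<open>k\<close>-th terms are geometric with ratios \<open>2\<^bsup>-(a-\<alpha>)\<^esup>\<close> and \<open>2\<^bsup>-(\<alpha>-b)\<^esup>\<close>.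
\<close>
lemma nn_integral_radial_kernel_finite:
  fixes a b \<alpha> :: real
  assumes b: "b < \<alpha>" and a: "\<alpha> < a"
  shows "(\<integral>\<^sup>+\<xi>. ennreal (min (norm \<xi> powr a) (norm \<xi> powr b) / norm \<xi> powr (real DIM('a) + \<alpha>))
            \<partial>(lborel :: 'a::euclidean_space measure)) < \<infinity>"
proof -
  define d where "d = DIM('a)"
  define V where "V = unit_ball_vol (real d)"
  have V: "V > 0" unfolding V_def by simp
  define g1 g2 :: "nat \<Rightarrow> real"
    where "g1 k = 2 powr d * (2 ^ k) powr (real d - (a - \<alpha>))"
      and "g2 k = (2 ^ k) powr (- real d - (\<alpha> - b))" for k
  have [measurable, simp]: "cball (0::'a) r \<in> sets borel" for r by simp
  have vol: "emeasure lborel (cball (0::'a) r) = ennreal (V * r ^ d)" if "r \<ge> 0" for r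
    using emeasure_cball[of r "0::'a"] that by (simp add: V_def d_def)
  have e1: "g1 k * (V * (1 / 2 ^ k) ^ d) = 2 powr d * V * (2 ^ k) powr (- (a - \<alpha>))" for k
  proof -
    have "(2 ^ k :: real) powr (real d - (a - \<alpha>)) = (2 ^ k) powr (- (a - \<alpha>)) * (2 ^ k) powr (real d)"
      by (simp only: powr_add[symmetric]) (simp add: algebra_simps)
    moreover have "(2 ^ k :: real) powr (real d) = (2 ^ k) ^ d"
      by (simp add: powr_realpow)
    ultimately show ?thesis
      by (simp add: g1_def power_divide)
  qed
  have e2: "g2 k * (V * (2 ^ Suc k) ^ d) = 2 ^ d * V * (2 ^ k) powr (- (\<alpha> - b))" for k
  proof -
    have "(2 ^ k :: real) powr (- real d - (\<alpha> - b)) = (2 ^ k) powr (- (\<alpha> - b)) * (2 ^ k) powr (- real d)"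
      by (simp only: powr_add[symmetric]) (simp add: algebra_simps)
    moreover have "(2 ^ k :: real) powr (- real d) = 1 / (2 ^ k) ^ d"
      by (simp add: powr_minus_divide powr_realpow)
    ultimately show ?thesis
      by (simp add: g2_def power_mult_distrib)
  qed
  have "(\<integral>\<^sup>+\<xi>. ennreal (min (norm \<xi> powr a) (norm \<xi> powr b) / norm \<xi> powr (real DIM('a) + \<alpha>)) \<partial>(lborel :: 'a measure))
     \<le> (\<integral>\<^sup>+\<xi>. (\<Sum>k. ennreal (g1 k) * indicator (cball 0 (1 / 2 ^ k)) \<xi>
          + ennreal (g2 k) * indicator (cball 0 (2 ^ Suc k)) \<xi>) \<partial>(lborel :: 'a measure))"
  proof (intro nn_integral_mono)
    fix \<xi> :: 'a
    have *: "indicator (cball 0 r) \<xi> = (indicator {..r} (norm \<xi>) :: ennreal)" for r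
      by (auto simp: indicator_def)
    show "ennreal (min (norm \<xi> powr a) (norm \<xi> powr b) / norm \<xi> powr (real DIM('a) + \<alpha>))
      \<le> (\<Sum>k. ennreal (g1 k) * indicator (cball 0 (1 / 2 ^ k)) \<xi> + ennreal (g2 k) * indicator (cball 0 (2 ^ Suc k)) \<xi>)"
    proof (cases "\<xi> = 0")
      case False
      then show ?thesis
        using radial_kernel_le_dyadic_sum[of "norm \<xi>" b \<alpha> a d] b a
        unfolding * g1_def g2_def d_def by simp
    qed simp
  qed
  also have "\<dots> = (\<Sum>k. ennreal (g1 k) * ennreal (V * (1 / 2 ^ k) ^ d) + ennreal (g2 k) * ennreal (V * (2 ^ Suc k) ^ d))"
    by (subst nn_integral_suminf) (simp_all add: nn_integral_add nn_integral_cmult vol del: power_Suc)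
  also have "\<dots> = (\<Sum>k. ennreal (2 powr d * V * (2 ^ k) powr (- (a - \<alpha>)) + 2 ^ d * V * (2 ^ k) powr (- (\<alpha> - b))))"
  proof -
    have "ennreal (g1 k) * ennreal (V * (1 / 2 ^ k) ^ d) + ennreal (g2 k) * ennreal (V * (2 ^ Suc k) ^ d)
       = ennreal (2 powr d * V * (2 ^ k) powr (- (a - \<alpha>)) + 2 ^ d * V * (2 ^ k) powr (- (\<alpha> - b)))" for k
    proof -
      have "ennreal (g1 k) * ennreal (V * (1 / 2 ^ k) ^ d) = ennreal (2 powr d * V * (2 ^ k) powr (- (a - \<alpha>)))"
        by (subst ennreal_mult[symmetric]) (use V in \<open>auto simp: g1_def e1[unfolded g1_def]\<close>)
      moreover have "ennreal (g2 k) * ennreal (V * (2 ^ Suc k) ^ d) = ennreal (2 ^ d * V * (2 ^ k) powr (- (\<alpha> - b)))"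
        by (subst ennreal_mult[symmetric]) (use V in \<open>auto simp: g2_def e2[unfolded g2_def] simp del: power_Suc\<close>)
      ultimately show ?thesis using V by (simp add: ennreal_plus)
    qed
    then show ?thesis by simp
  qed
  also have "\<dots> < \<infinity>"
  proof -
    have "summable (\<lambda>k. 2 powr d * V * (2 ^ k) powr (- (a - \<alpha>)) + 2 ^ d * V * (2 ^ k) powr (- (\<alpha> - b)))"
      by (intro summable_add summable_mult summable_two_power_powr) (use a b in auto)
    then show ?thesis
      using V by (subst suminf_ennreal2) auto
  qed
  finally show ?thesis .
qed

text \<open>
  The substitution \<open>\<xi> \<mapsto> c \<xi>\<close>. This homogeneity is what produces the moment \<open>|v|\<^sup>\<alpha>\<close> when \<open>c = |v|\<close>.
\<close>
lemma nn_integral_radial_kernel_scaled: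
  fixes a b \<alpha> c :: real
  assumes c: "c > 0"
  shows "(\<integral>\<^sup>+\<xi>. ennreal (min ((c * norm \<xi>) powr a) ((c * norm \<xi>) powr b) / norm \<xi> powr (real DIM('a) + \<alpha>))
            \<partial>(lborel :: 'a::euclidean_space measure))
      = ennreal (c powr \<alpha>) *
        (\<integral>\<^sup>+\<xi>. ennreal (min (norm \<xi> powr a) (norm \<xi> powr b) / norm \<xi> powr (real DIM('a) + \<alpha>)) \<partial>(lborel :: 'a measure))"
proof -
  have "(\<integral>\<^sup>+\<xi>. ennreal (min (norm \<xi> powr a) (norm \<xi> powr b) / norm \<xi> powr (real DIM('a) + \<alpha>)) \<partial>(lborel :: 'a measure))
     = ennreal (c ^ DIM('a)) * (\<integral>\<^sup>+\<xi>. ennreal (min ((c * norm \<xi>) powr a) ((c * norm \<xi>) powr b) / (c * norm \<xi>) powr (real DIM('a) + \<alpha>)) \<partial>(lborel :: 'a measure))"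
    by (subst nn_integral_lborel_scale[of _ c]) (use c in auto)
  also have "\<dots> = ennreal (c ^ DIM('a)) * (\<integral>\<^sup>+\<xi>. ennreal (c powr (- (real DIM('a) + \<alpha>))) *
       ennreal (min ((c * norm \<xi>) powr a) ((c * norm \<xi>) powr b) / norm \<xi> powr (real DIM('a) + \<alpha>)) \<partial>(lborel :: 'a measure))"
  proof -
    have "X / (c * norm \<xi>) powr s = c powr (- s) * (X / norm \<xi> powr s)" for X s and \<xi> :: 'a
      using c by (simp add: powr_mult powr_minus field_simps)
    then show ?thesis by (simp add: ennreal_mult[symmetric])
  qed
  also have "\<dots> = ennreal (c ^ DIM('a) * c powr (- (real DIM('a) + \<alpha>))) *
       (\<integral>\<^sup>+\<xi>. ennreal (min ((c * norm \<xi>) powr a) ((c * norm \<xi>) powr b) / norm \<xi> powr (real DIM('a) + \<alpha>)) \<partial>(lborel :: 'a measure))"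
    using c by (simp add: nn_integral_cmult ennreal_mult mult.assoc)
  also have "c ^ DIM('a) * c powr (- (real DIM('a) + \<alpha>)) = c powr (- \<alpha>)"
    using c by (simp add: powr_realpow[symmetric] powr_add[symmetric])
  finally show ?thesis
    using c by (simp add: mult.assoc[symmetric] ennreal_mult[symmetric] powr_add[symmetric])
qed

section \<open>Characteristic functions and their Taylor estimate\<close>

abbreviation unit_char :: "'a::euclidean_space \<Rightarrow> 'a \<Rightarrow> complex"
  where "unit_char \<xi> v \<equiv> exp (- (\<i> * complex_of_real (v \<bullet> \<xi>)))"

lemma unit_char_eq_iexp: "unit_char \<xi> v = iexp (- (v \<bullet> \<xi>))"
  by simp

lemma norm_unit_char [simp]: "cmod (unit_char \<xi> v) = 1"
  by (simp add: norm_exp_eq_Re)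

lemma Re_unit_char: "Re (unit_char \<xi> v) = cos (v \<bullet> \<xi>)"
  by (simp add: Re_exp)

lemma Im_unit_char: "Im (unit_char \<xi> v) = - sin (v \<bullet> \<xi>)"
  by (simp add: Im_exp)

lemma P_space_0_iff: "F \<in> P_space 0 \<longleftrightarrow> prob_space F \<and> sets F = sets borel"
proof
  assume F: "prob_space F \<and> sets F = sets borel"
  then interpret prob_space F by simp
  have [measurable_cong]: "sets F = sets borel" using F by simp
  have "integrable F (\<lambda>v. norm v powr 0)"
    by (rule integrable_const_bound[of _ 1]) auto
  with F show "F \<in> P_space 0" by (simp add: P_space_def)
qed (simp add: P_space_def)

lemma P_space_subset_P_space_0: "P_space \<alpha> \<subseteq> P_space 0"
proof
  fix F :: "'a measure" assume "F \<in> P_space \<alpha>"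
  then show "F \<in> P_space 0" unfolding P_space_0_iff by (simp add: P_space_def)
qed

locale borel_prob = prob_space F for F :: "'a::euclidean_space measure" +
  assumes sets_borel [measurable_cong, simp]: "sets F = sets borel"
begin

lemma space_UNIV [simp]: "space F = UNIV"
  using sets_eq_imp_space_eq[OF sets_borel] by simp

lemma prob_UNIV [simp]: "prob UNIV = 1"
  using prob_space by simp

lemma emeasure_UNIV [simp]: "emeasure F UNIV = 1"
  using emeasure_space_1 by simp

lemma integrable_unit_char [simp]: "integrable F (unit_char \<xi>)"
  by (rule integrable_const_bound[of _ 1]) auto

lemma fourier_0: "fourier F 0 = 1"
  by (simp add: fourier_def prob_space)

lemma norm_fourier_le_1: "cmod (fourier F \<xi>) \<le> 1"
proof -
  have "cmod (fourier F \<xi>) \<le> (\<integral>v. cmod (unit_char \<xi> v) \<partial>F)"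
    unfolding fourier_def by (rule integral_norm_bound)
  also have "\<dots> = 1" by (simp add: prob_space)
  finally show ?thesis .
qed

lemma measurable_fourier [measurable]: "fourier F \<in> borel_measurable borel"
proof -
  have "fourier F = (\<lambda>\<xi>. \<integral>v. unit_char \<xi> v \<partial>F)" by (auto simp: fourier_def)
  then show ?thesis by simp
qed

end

lemma P_space_0_iff_borel_prob: "F \<in> P_space 0 \<longleftrightarrow> borel_prob F"
  by (simp add: P_space_0_iff borel_prob_def borel_prob_axioms_def)

lemma P_space_imp_borel_prob: "F \<in> P_space \<alpha> \<Longrightarrow> borel_prob F"
  using P_space_subset_P_space_0 P_space_0_iff_borel_prob by blast

lemma char_fun_cases:
  assumes "\<phi> \<in> char_funs"
  obtains F where "borel_prob F" "fourier F = \<phi>"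
  using assms unfolding char_funs_def by (auto simp: P_space_0_iff_borel_prob)

lemma char_fun_props:
  assumes "\<phi> \<in> char_funs"
  shows "\<phi> 0 = 1" "cmod (\<phi> \<xi>) \<le> 1" "\<phi> \<in> borel_measurable borel"
  using assms borel_prob.fourier_0 borel_prob.norm_fourier_le_1 borel_prob.measurable_fourier
  by (metis char_fun_cases)+

lemma char_fun_diff_le_2:
  assumes "\<phi> \<in> char_funs" "\<psi> \<in> char_funs"
  shows "cmod (\<phi> \<xi> - \<psi> \<xi>) \<le> 2"
  using norm_triangle_ineq4[of "\<phi> \<xi>" "\<psi> \<xi>"] char_fun_props(2)[OF assms(1), of \<xi>] char_fun_props(2)[OF assms(2), of \<xi>]
  by linarith

lemma const_1_char_fun: "(\<lambda>_::'a::euclidean_space. 1) \<in> char_funs"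
proof -
  have "borel_prob (return borel (0::'a))"
    by (simp add: borel_prob_def borel_prob_axioms_def prob_space_return)
  moreover have "fourier (return borel (0::'a)) = (\<lambda>_. 1)"
    by (auto simp: fourier_def integral_return)
  ultimately show ?thesis unfolding char_funs_def by (metis P_space_0_iff_borel_prob image_eqI)
qed

text \<open>
  The number of terms of the Taylor expansion of \<open>exp\<close> that are subtracted beyond the constant one: the
  integer part of \<open>\<alpha>\<close>, for \<open>0 < \<alpha> < 2\<close>.
\<close>
definition mom_index :: "real \<Rightarrow> nat" where "mom_index \<alpha> = (if \<alpha> < 1 then 0 else 1)"

definition taylor_bound :: "nat \<Rightarrow> real \<Rightarrow> real" where "taylor_bound b x = min (x ^ b) (x ^ Suc b)"

lemma taylor_bound_nonneg: "x \<ge> 0 \<Longrightarrow> taylor_bound b x \<ge> 0"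
  by (simp add: taylor_bound_def)

text \<open>
  The remainder of order \<open>b\<close> is bounded both by the next Taylor term and by twice the last one; the
  factor 2 absorbs both constants.
\<close>
lemma iexp_taylor_le: "cmod (iexp x - (\<Sum>k\<le>b. (\<i> * x) ^ k / fact k)) \<le> 2 * taylor_bound b \<bar>x\<bar>"
proof -
  have *: "c * t / fact n \<le> 2 * t" if "t \<ge> 0" "0 \<le> c" "c \<le> 2" for t c :: real and n
  proof -
    have "c * t / fact n \<le> c * t"
      using that divide_left_mono[of 1 "fact n :: real" "c * t"] by (simp add: fact_ge_1)
    also have "\<dots> \<le> 2 * t" using that by (intro mult_right_mono) auto
    finally show ?thesis .
  qed
  from iexp_approx1[of x b] iexp_approx2[of x b] *[of "\<bar>x\<bar> ^ b" 2 b] *[of "\<bar>x\<bar> ^ Suc b" 1 "Suc b"]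
  show ?thesis by (simp add: taylor_bound_def min_def)
qed

lemma taylor_bound_le_powr:
  assumes "x \<ge> 0" "real b \<le> \<alpha>" "\<alpha> \<le> real (Suc b)" "\<alpha> > 0"
  shows "taylor_bound b x \<le> x powr \<alpha>"
proof (cases "x = 0")
  case True then show ?thesis by (simp add: taylor_bound_def)
next
  case False
  then have x: "x > 0" using assms by simp
  have "min (x powr b) (x powr Suc b) \<le> x powr \<alpha>"
    using assms x by (cases "x \<le> 1") (auto simp: min_le_iff_disj intro: powr_mono powr_mono')
  then show ?thesis by (simp only: taylor_bound_def powr_realpow[OF x])
qed

lemma taylor_bound_mono: "0 \<le> x \<Longrightarrow> x \<le> y \<Longrightarrow> taylor_bound b x \<le> taylor_bound b y"
  unfolding taylor_bound_def by (intro min.mono power_mono) auto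

lemma mom_index_bounds: "0 < \<alpha> \<Longrightarrow> \<alpha> < 2 \<Longrightarrow> real (mom_index \<alpha>) \<le> \<alpha> \<and> \<alpha> < real (Suc (mom_index \<alpha>))"
  by (simp add: mom_index_def)

lemma P_space_integrable_powr: "F \<in> P_space \<alpha> \<Longrightarrow> integrable F (\<lambda>v. norm v powr \<alpha>)"
  by (simp add: P_space_def)

lemma borel_prob_integrable_inner:
  assumes "borel_prob F" "integrable F (\<lambda>v. norm v powr \<alpha>)" "\<alpha> \<ge> 1"
  shows "integrable F (\<lambda>v. v \<bullet> \<xi>)"
proof -
  interpret borel_prob F by fact
  have "integrable F (\<lambda>v. (1 + norm v powr \<alpha>) * norm \<xi>)"
    using assms by auto
  then show ?thesis
  proof (rule Bochner_Integration.integrable_bound)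
    show "AE v in F. norm (v \<bullet> \<xi>) \<le> norm ((1 + norm v powr \<alpha>) * norm \<xi>)"
    proof (rule AE_I2)
      fix v :: 'a
      have "norm v \<le> 1 + norm v powr \<alpha>"
      proof (cases "norm v \<le> 1")
        case False
        then have "norm v powr 1 \<le> norm v powr \<alpha>" using assms by (intro powr_mono) auto
        then show ?thesis by simp
      qed (simp add: add_increasing2)
      then show "norm (v \<bullet> \<xi>) \<le> norm ((1 + norm v powr \<alpha>) * norm \<xi>)"
        using Cauchy_Schwarz_ineq2[of v \<xi>] mult_right_mono[of "norm v" "1 + norm v powr \<alpha>" "norm \<xi>"]
        by simp
    qed
  qed simp
qed

lemma integral_inner_P_space:
  assumes F: "F \<in> P_space \<alpha>" and "\<alpha> \<ge> 1"
  shows "(\<integral>v. v \<bullet> \<xi> \<partial>F) = 0"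
proof -
  interpret borel_prob F using P_space_imp_borel_prob[OF F] .
  note int = borel_prob_integrable_inner[OF P_space_imp_borel_prob[OF F] P_space_integrable_powr[OF F] assms(2)]
  have "(\<integral>v. v \<bullet> \<xi> \<partial>F) = (\<integral>v. (\<Sum>j\<in>Basis. (v \<bullet> j) * (\<xi> \<bullet> j)) \<partial>F)"
    by (simp add: euclidean_inner[symmetric])
  also have "\<dots> = (\<Sum>j\<in>Basis. (\<integral>v. (v \<bullet> j) * (\<xi> \<bullet> j) \<partial>F))"
    by (intro Bochner_Integration.integral_sum integrable_mult_left int)
  also have "\<dots> = 0" using F assms by (simp add: P_space_def)
  finally show ?thesis .
qed

text \<open>
  The Taylor polynomial of \<open>v \<mapsto> exp (- \<i> (v \<bullet> \<xi>))\<close> of degree \<open>b\<close> has integral 1: for \<open>b = 0\<close> because \<open>F\<close> is a probability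
  measure, and for \<open>b = 1\<close> because \<open>F\<close> also has mean zero. Hence \<open>fourier F \<xi> - 1\<close> is the integral of the remainder.
\<close>
lemma fourier_diff_1_le:
  assumes F: "F \<in> P_space \<alpha>" and \<alpha>: "0 < \<alpha>" "\<alpha> < 2"
  defines "b \<equiv> mom_index \<alpha>"
  shows "integrable F (\<lambda>v. taylor_bound b (norm v * norm \<xi>))"
    and "cmod (fourier F \<xi> - 1) \<le> 2 * (\<integral>v. taylor_bound b (norm v * norm \<xi>) \<partial>F)"
proof -
  interpret borel_prob F using P_space_imp_borel_prob[OF F] .
  have "integrable F (\<lambda>v. norm v powr \<alpha> * norm \<xi> powr \<alpha>)"
    using P_space_integrable_powr[OF F] by simp
  then show int: "integrable F (\<lambda>v. taylor_bound b (norm v * norm \<xi>))"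
  proof (rule Bochner_Integration.integrable_bound)
    show "AE v in F. norm (taylor_bound b (norm v * norm \<xi>)) \<le> norm (norm v powr \<alpha> * norm \<xi> powr \<alpha>)"
      using taylor_bound_le_powr[of "norm v * norm \<xi>" b \<alpha> for v] \<alpha> mom_index_bounds[OF \<alpha>]
      by (intro AE_I2) (simp add: taylor_bound_nonneg powr_mult b_def)
  qed (simp add: taylor_bound_def)
  define p where "p v = (\<Sum>k\<le>b. (\<i> * complex_of_real (- (v \<bullet> \<xi>))) ^ k / fact k)" for v :: 'a
  have p: "integrable F p \<and> (\<integral>v. p v \<partial>F) = 1"
  proof (cases "\<alpha> < 1")
    case True
    then have "p = (\<lambda>_. 1)" by (auto simp: p_def b_def mom_index_def)
    then show ?thesis by (simp add: prob_space)
  next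
    case False
    have i: "integrable F (\<lambda>v. complex_of_real (v \<bullet> \<xi>))"
      by (intro integrable_of_real borel_prob_integrable_inner[OF _ P_space_integrable_powr[OF F]])
         (use False borel_prob_axioms in auto)
    have "p = (\<lambda>v. 1 - \<i> * complex_of_real (v \<bullet> \<xi>))" using False by (auto simp: p_def b_def mom_index_def)
    moreover have "(\<integral>v. complex_of_real (v \<bullet> \<xi>) \<partial>F) = 0"
      using integral_inner_P_space[OF F] False by (simp add: integral_complex_of_real)
    ultimately show ?thesis using i by (simp add: prob_space)
  qed
  have "cmod (fourier F \<xi> - 1) = cmod (\<integral>v. unit_char \<xi> v - p v \<partial>F)"
    using p unfolding fourier_def by (subst Bochner_Integration.integral_diff) auto
  also have "\<dots> \<le> (\<integral>v. cmod (unit_char \<xi> v - p v) \<partial>F)" by (rule integral_norm_bound)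
  also have "\<dots> \<le> (\<integral>v. 2 * taylor_bound b (norm v * norm \<xi>) \<partial>F)"
  proof (intro integral_mono)
    fix v
    have "cmod (unit_char \<xi> v - p v) \<le> 2 * taylor_bound b \<bar>- (v \<bullet> \<xi>)\<bar>"
      using iexp_taylor_le[of "- (v \<bullet> \<xi>)" b] unfolding unit_char_eq_iexp p_def by simp
    also have "\<dots> \<le> 2 * taylor_bound b (norm v * norm \<xi>)"
      using taylor_bound_mono[OF _ Cauchy_Schwarz_ineq2[of v \<xi>], of b] by simp
    finally show "cmod (unit_char \<xi> v - p v) \<le> 2 * taylor_bound b (norm v * norm \<xi>)" .
  qed (use int p in auto)
  finally show "cmod (fourier F \<xi> - 1) \<le> 2 * (\<integral>v. taylor_bound b (norm v * norm \<xi>) \<partial>F)" by simp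
qed

section \<open>Low frequencies control tails\<close>

definition low_freq :: "real \<Rightarrow> real \<Rightarrow> ('a::euclidean_space \<Rightarrow> complex) \<Rightarrow> ennreal"
  where "low_freq \<alpha> r \<phi> = (\<integral>\<^sup>+\<xi>\<in>cball 0 r. ennreal (cmod (\<phi> \<xi> - 1) / norm \<xi> powr (real DIM('a) + \<alpha>)) \<partial>lborel)"

definition tail_moment :: "real \<Rightarrow> real \<Rightarrow> 'a::euclidean_space measure \<Rightarrow> ennreal"
  where "tail_moment \<alpha> R F = (\<integral>\<^sup>+v\<in>{v. R < norm v}. ennreal (norm v powr \<alpha>) \<partial>F)"

text \<open>
  The constant that comes out of \<open>tail_const_le_kernel_integral\<close>: the infimum of \<open>1 - cos\<close> on \<open>[1/2, 3/2]\<close>, times the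
  volume of a ball of radius \<open>1/2\<close>, divided by the largest weight on that ball, for a unit vector \<open>v\<close>.
\<close>
definition tail_const :: "nat \<Rightarrow> real \<Rightarrow> real"
  where "tail_const d \<alpha> = (1 - cos (1/2)) * unit_ball_vol (real d) * (1/2) ^ d / (3/2) powr (real d + \<alpha>)"

lemma cos_half_less_1: "cos (1/2 :: real) < 1"
  using cos_monotone_0_pi[of 0 "1/2"] pi_gt3 by simp

lemma tail_const_pos: "tail_const d \<alpha> > 0"
  using cos_half_less_1 by (simp add: tail_const_def)

text \<open>
  For \<open>\<xi>\<close> in the ball around \<open>v / |v|\<^sup>2\<close> of radius \<open>1 / (2 |v|)\<close> the product \<open>v \<bullet> \<xi>\<close> lies within \<open>1/2\<close> of 1, so
  \<open>1 - cos (v \<bullet> \<xi>)\<close> is bounded below there. The ball is contained in \<open>|\<xi>| \<le> 2 / R\<close> when \<open>|v| > R\<close>, and it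
  scales like \<open>1 / |v|\<close>, which leaves the factor \<open>|v|\<^sup>\<alpha>\<close>.
\<close>
lemma tail_const_le_kernel_integral:
  fixes v :: "'a::euclidean_space"
  assumes R: "0 < R" "R < norm v" and "0 < \<alpha>"
  shows "ennreal (tail_const DIM('a) \<alpha> * norm v powr \<alpha>)
    \<le> (\<integral>\<^sup>+\<xi>\<in>cball 0 (2 / R). ennreal ((1 - cos (v \<bullet> \<xi>)) / norm \<xi> powr (real DIM('a) + \<alpha>)) \<partial>lborel)"
proof -
  define n where "n = norm v"
  have n: "n > 0" unfolding n_def using R by linarith
  define d where "d = DIM('a)"
  define y where "y = (1 / n\<^sup>2) *\<^sub>R v"
  define B where "B = ball y (1 / (2 * n))"
  have vy: "v \<bullet> y = 1" using n by (simp add: y_def n_def power2_norm_eq_inner[symmetric])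
  have ny: "norm y = 1 / n" using n by (simp add: y_def n_def power2_eq_square)
  have B: "norm \<xi> \<le> 3 / (2 * n) \<and> 0 < norm \<xi> \<and> cos (v \<bullet> \<xi>) \<le> cos (1/2)" if "\<xi> \<in> B" for \<xi>
  proof -
    have dist: "norm (\<xi> - y) < 1 / (2 * n)" using that by (simp add: B_def dist_norm norm_minus_commute)
    have "\<bar>v \<bullet> (\<xi> - y)\<bar> \<le> n * norm (\<xi> - y)" unfolding n_def by (rule Cauchy_Schwarz_ineq2)
    also have "\<dots> \<le> n * (1 / (2 * n))" using dist n by (intro mult_left_mono) auto
    finally have "\<bar>v \<bullet> \<xi> - 1\<bar> \<le> 1/2" using n by (simp add: inner_diff_right vy)
    then have "1/2 \<le> v \<bullet> \<xi>" "v \<bullet> \<xi> \<le> 3/2" by arith+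
    then have "cos (v \<bullet> \<xi>) \<le> cos (1/2)" using pi_gt3 by (intro cos_monotone_0_pi_le) auto
    moreover have "norm \<xi> \<le> norm (\<xi> - y) + norm y" using norm_triangle_ineq[of "\<xi> - y" y] by simp
    then have "norm \<xi> \<le> 3 / (2 * n)" using dist ny n by (simp add: field_simps)
    moreover have "\<xi> \<noteq> 0" using \<open>1/2 \<le> v \<bullet> \<xi>\<close> by auto
    ultimately show ?thesis by simp
  qed
  have [measurable]: "B \<in> sets borel" by (simp add: B_def)
  have vol: "emeasure lborel B = ennreal (unit_ball_vol (real d) * (1 / (2 * n)) ^ d)"
    using n by (simp add: B_def emeasure_ball d_def)
  have "tail_const d \<alpha> * n powr \<alpha> = (1 - cos (1/2)) / (3 / (2 * n)) powr (real d + \<alpha>) * (unit_ball_vol (real d) * (1 / (2 * n)) ^ d)"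
  proof -
    have "(3 / (2 * n)) powr (real d + \<alpha>) = (3/2) powr (real d + \<alpha>) / n powr (real d + \<alpha>)"
      using n by (simp add: powr_divide powr_mult)
    moreover have "n powr (real d + \<alpha>) = n ^ d * n powr \<alpha>"
      using n by (simp add: powr_add powr_realpow)
    ultimately show ?thesis using n by (simp add: tail_const_def power_divide power_mult_distrib mult_ac)
  qed
  then have "ennreal (tail_const DIM('a) \<alpha> * norm v powr \<alpha>) =
      ennreal ((1 - cos (1/2)) / (3 / (2 * n)) powr (real d + \<alpha>)) * emeasure lborel B"
    unfolding vol using cos_half_less_1 n
    by (subst ennreal_mult[symmetric]) (auto simp: d_def n_def)
  also have "\<dots> = (\<integral>\<^sup>+\<xi>\<in>B. ennreal ((1 - cos (1/2)) / (3 / (2 * n)) powr (real d + \<alpha>)) \<partial>lborel)"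
    by (simp add: nn_integral_cmult)
  also have "\<dots> \<le> (\<integral>\<^sup>+\<xi>\<in>cball 0 (2 / R). ennreal ((1 - cos (v \<bullet> \<xi>)) / norm \<xi> powr (real DIM('a) + \<alpha>)) \<partial>lborel)"
  proof (intro nn_integral_mono)
    fix \<xi> :: 'a
    show "ennreal ((1 - cos (1/2)) / (3 / (2 * n)) powr (real d + \<alpha>)) * indicator B \<xi>
       \<le> ennreal ((1 - cos (v \<bullet> \<xi>)) / norm \<xi> powr (real DIM('a) + \<alpha>)) * indicator (cball 0 (2 / R)) \<xi>"
    proof (cases "\<xi> \<in> B")
      case True
      have "R < n" using R by (simp add: n_def)
      then have "3 / (2 * n) \<le> 2 / R" using R(1) n by (simp add: field_simps)
      then have "\<xi> \<in> cball 0 (2 / R)" using B[OF True] by simp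
      moreover have "(1 - cos (1/2)) / (3 / (2 * n)) powr (real d + \<alpha>) \<le> (1 - cos (v \<bullet> \<xi>)) / norm \<xi> powr (real d + \<alpha>)"
        using B[OF True] cos_half_less_1 \<open>0 < \<alpha>\<close> by (intro frac_le powr_mono2) auto
      ultimately show ?thesis using True by (simp add: d_def ennreal_leI)
    qed simp
  qed
  finally show ?thesis .
qed

text \<open>
  Integrate the preceding bound over \<open>v\<close>, exchange the integrals, and use \<open>Re (1 - \<phi>) \<le> |\<phi> - 1|\<close>.
\<close>
lemma (in borel_prob) tail_moment_le_low_freq:
  assumes R: "R > 0" and \<alpha>: "0 < \<alpha>"
  shows "ennreal (tail_const DIM('a) \<alpha>) * tail_moment \<alpha> R F \<le> low_freq \<alpha> (2 / R) (fourier F)"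
proof -
  let ?w = "\<lambda>\<xi>::'a. norm \<xi> powr (real DIM('a) + \<alpha>)"
  interpret pair_sigma_finite "lborel :: 'a measure" F ..
  have [measurable, simp]: "cball (0::'a) r \<in> sets borel" for r by simp
  have "ennreal (tail_const DIM('a) \<alpha>) * tail_moment \<alpha> R F
     = (\<integral>\<^sup>+v\<in>{v. R < norm v}. ennreal (tail_const DIM('a) \<alpha> * norm v powr \<alpha>) \<partial>F)"
    unfolding tail_moment_def using tail_const_pos[of "DIM('a)" \<alpha>]
    by (subst nn_integral_cmult[symmetric]) (auto simp: ennreal_mult mult_ac)
  also have "\<dots> \<le> (\<integral>\<^sup>+v. (\<integral>\<^sup>+\<xi>. ennreal ((1 - cos (v \<bullet> \<xi>)) / ?w \<xi>) * indicator (cball 0 (2 / R)) \<xi> \<partial>lborel) \<partial>F)"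
    using tail_const_le_kernel_integral[OF R _ \<alpha>] by (intro nn_integral_mono) (auto simp: indicator_def)
  also have "\<dots> = (\<integral>\<^sup>+\<xi>. (\<integral>\<^sup>+v. ennreal ((1 - cos (v \<bullet> \<xi>)) / ?w \<xi>) * indicator (cball 0 (2 / R)) \<xi> \<partial>F) \<partial>lborel)"
    by (rule Fubini') simp
  also have "\<dots> \<le> low_freq \<alpha> (2 / R) (fourier F)"
    unfolding low_freq_def
  proof (intro nn_integral_mono)
    fix \<xi> :: 'a
    have int: "integrable F (\<lambda>v. cos (v \<bullet> \<xi>))" by (rule integrable_const_bound[of _ 1]) auto
    have "(\<integral>v. cos (v \<bullet> \<xi>) \<partial>F) = Re (fourier F \<xi>)"
      unfolding fourier_def by (subst integral_Re[symmetric]) (auto simp: Re_unit_char)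
    then have *: "(\<integral>v. (1 - cos (v \<bullet> \<xi>)) / ?w \<xi> \<partial>F) = (1 - Re (fourier F \<xi>)) / ?w \<xi>"
      using int by simp
    have "(\<integral>\<^sup>+v. ennreal ((1 - cos (v \<bullet> \<xi>)) / ?w \<xi>) \<partial>F) = ennreal ((1 - Re (fourier F \<xi>)) / ?w \<xi>)"
    proof (subst nn_integral_eq_integral)
      show "integrable F (\<lambda>v. (1 - cos (v \<bullet> \<xi>)) / ?w \<xi>)" using int by simp
    qed (simp_all only: *, simp)
    also have "\<dots> \<le> ennreal (cmod (fourier F \<xi> - 1) / ?w \<xi>)"
      using abs_Re_le_cmod[of "fourier F \<xi> - 1"] by (intro ennreal_leI divide_right_mono) auto
    finally show "(\<integral>\<^sup>+v. ennreal ((1 - cos (v \<bullet> \<xi>)) / ?w \<xi>) * indicator (cball 0 (2 / R)) \<xi> \<partial>F)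
        \<le> ennreal (cmod (fourier F \<xi> - 1) / ?w \<xi>) * indicator (cball 0 (2 / R)) \<xi>"
      by (auto simp: indicator_def)
  qed
  finally show ?thesis .
qed

lemma low_freq_le_dist_M: "low_freq \<alpha> r \<phi> \<le> dist_M \<alpha> \<phi> (\<lambda>_. 1)"
  unfolding low_freq_def dist_M_def by (intro nn_integral_mono) (auto simp: indicator_def)

lemma low_freq_tendsto_0:
  assumes [measurable]: "\<phi> \<in> borel_measurable borel" and fin: "dist_M \<alpha> \<phi> (\<lambda>_. 1) < \<infinity>"
  shows "((\<lambda>n. low_freq \<alpha> (1 / real (Suc n)) \<phi>) \<longlonglongrightarrow> 0)"
proof -
  let ?f = "\<lambda>\<xi>::'a. ennreal (cmod (\<phi> \<xi> - 1) / norm \<xi> powr (real DIM('a) + \<alpha>))"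
  have [measurable, simp]: "cball (0::'a) r \<in> sets borel" for r by simp
  have "(\<lambda>n. low_freq \<alpha> (1 / real (Suc n)) \<phi>) \<longlonglongrightarrow> (\<integral>\<^sup>+\<xi>. (0::ennreal) \<partial>(lborel::'a measure))"
    unfolding low_freq_def
  proof (rule nn_integral_dominated_convergence[where w="?f"])
    show "(\<integral>\<^sup>+x. ?f x \<partial>lborel) < \<infinity>" using fin by (simp add: dist_M_def)
    show "AE x in lborel. ?f x * indicator (cball 0 (1 / real (Suc j))) x \<le> ?f x" for j
      by (auto simp: indicator_def)
    show "AE x in lborel. (\<lambda>n. ?f x * indicator (cball 0 (1 / real (Suc n))) x) \<longlonglongrightarrow> 0"
    proof (rule AE_I2)
      fix x :: 'a
      show "(\<lambda>n. ?f x * indicator (cball 0 (1 / real (Suc n))) x) \<longlonglongrightarrow> 0"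
      proof (cases "x = 0")
        case False
        have "eventually (\<lambda>n. 1 / real (Suc n) < norm x) sequentially"
          using False by (intro order_tendstoD(2)[OF LIMSEQ_Suc[OF lim_1_over_n]]) auto
        then have "eventually (\<lambda>n. ?f x * indicator (cball 0 (1 / real (Suc n))) x = 0) sequentially"
          by eventually_elim (auto simp: indicator_def)
        then show ?thesis by (rule tendsto_eventually)
      qed simp
    qed
  qed auto
  then show ?thesis by simp
qed

lemma low_freq_mono: "r \<le> s \<Longrightarrow> low_freq \<alpha> r \<phi> \<le> low_freq \<alpha> s \<phi>"
  unfolding low_freq_def by (intro nn_integral_mono) (auto simp: indicator_def)

lemma M_space_char_fun: "\<phi> \<in> M_space \<alpha> \<Longrightarrow> \<phi> \<in> char_funs"
  by (simp add: M_space_def)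

lemma M_space_low_freq_small:
  assumes "\<phi> \<in> M_space \<alpha>" "\<epsilon> > 0"
  obtains r where "r > 0" "low_freq \<alpha> r \<phi> < \<epsilon>"
proof -
  have "eventually (\<lambda>n. low_freq \<alpha> (1 / real (Suc n)) \<phi> < \<epsilon>) sequentially"
    using assms char_fun_props(3)
    by (intro order_tendstoD(2)[OF low_freq_tendsto_0]) (auto simp: M_space_def)
  then obtain n where "low_freq \<alpha> (1 / real (Suc n)) \<phi> < \<epsilon>"
    by (meson eventually_sequentially order_refl)
  then show ?thesis by (intro that[of "1 / real (Suc n)"]) auto
qed

section \<open>Moment and mean of a measure at finite integral distance from 1\<close>

lemma (in borel_prob) integrable_powr_if_dist_M_finite:
  assumes fin: "dist_M \<alpha> (fourier F) (\<lambda>_. 1) < \<infinity>" and \<alpha>: "0 < \<alpha>"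
  shows "integrable F (\<lambda>v. norm v powr \<alpha>)"
proof -
  have "ennreal (tail_const DIM('a) \<alpha>) * tail_moment \<alpha> 1 F < \<infinity>"
    using tail_moment_le_low_freq[of 1 \<alpha>] low_freq_le_dist_M[of \<alpha> "2 / 1" "fourier F"] fin \<alpha>
    by (meson order_le_less_trans zero_less_one)
  then have t: "tail_moment \<alpha> 1 F < \<infinity>"
    using tail_const_pos[of "DIM('a)" \<alpha>] by (auto simp: ennreal_mult_less_top)
  have "(\<integral>\<^sup>+v. ennreal (norm v powr \<alpha>) \<partial>F) \<le> (\<integral>\<^sup>+v. 1 + ennreal (norm v powr \<alpha>) * indicator {v. 1 < norm v} v \<partial>F)"
  proof (intro nn_integral_mono)
    fix v :: 'a
    show "ennreal (norm v powr \<alpha>) \<le> 1 + ennreal (norm v powr \<alpha>) * indicator {v. 1 < norm v} v"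
    proof (cases "1 < norm v")
      case False
      then have "norm v powr \<alpha> \<le> 1" using \<alpha> by (intro powr_le1) auto
      then show ?thesis using False by simp
    qed simp
  qed
  also have "\<dots> = 1 + tail_moment \<alpha> 1 F"
    unfolding tail_moment_def by (subst nn_integral_add) auto
  also have "\<dots> < \<infinity>" using t by simp
  finally show ?thesis by (intro integrableI_bounded) auto
qed

text \<open>
  Differentiability of the characteristic function at the origin in direction \<open>\<eta>\<close>; the derivative is
  \<open>- \<i>\<close> times the mean of \<open>v \<bullet> \<eta>\<close>.
\<close>
lemma (in borel_prob) fourier_difference_quotient:
  assumes int: "integrable F (\<lambda>v. norm v powr \<alpha>)" and \<alpha>: "1 \<le> \<alpha>"
    and r: "r \<longlonglongrightarrow> 0" "\<And>n. r n > 0"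
  shows "(\<lambda>n. (fourier F (r n *\<^sub>R \<eta>) - 1) / of_real (r n)) \<longlonglongrightarrow> - \<i> * of_real (\<integral>v. v \<bullet> \<eta> \<partial>F)"
proof -
  have i: "integrable F (\<lambda>v. v \<bullet> \<eta>)"
    by (rule borel_prob_integrable_inner[OF _ int \<alpha>]) (rule borel_prob_axioms)
  have eq: "(fourier F (r n *\<^sub>R \<eta>) - 1) / of_real (r n) = (\<integral>v. (unit_char (r n *\<^sub>R \<eta>) v - 1) / of_real (r n) \<partial>F)" for n
  proof -
    have "(\<integral>v. unit_char \<zeta> v - 1 \<partial>F) = fourier F \<zeta> - 1" for \<zeta>
      by (simp add: fourier_def)
    then show ?thesis by (simp only: integral_divide_zero)
  qed
  have "(\<lambda>n. \<integral>v. (unit_char (r n *\<^sub>R \<eta>) v - 1) / of_real (r n) \<partial>F) \<longlonglongrightarrow> (\<integral>v. - \<i> * complex_of_real (v \<bullet> \<eta>) \<partial>F)"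
  proof (rule integral_dominated_convergence[where w="\<lambda>v. \<bar>v \<bullet> \<eta>\<bar>"])
    show "integrable F (\<lambda>v. \<bar>v \<bullet> \<eta>\<bar>)" using i by simp
    show "AE v in F. (\<lambda>n. (unit_char (r n *\<^sub>R \<eta>) v - 1) / of_real (r n)) \<longlonglongrightarrow> - \<i> * complex_of_real (v \<bullet> \<eta>)"
    proof (rule AE_I2)
      fix v
      have "((\<lambda>t. exp (- (\<i> * complex_of_real (v \<bullet> \<eta>)) * t)) has_field_derivative (- (\<i> * complex_of_real (v \<bullet> \<eta>)))) (at 0)"
        by (auto intro!: derivative_eq_intros)
      then have "((\<lambda>t. (exp (- (\<i> * complex_of_real (v \<bullet> \<eta>)) * t) - 1) / t) \<longlongrightarrow> (- (\<i> * complex_of_real (v \<bullet> \<eta>)))) (at 0)"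
        by (simp add: DERIV_def)
      moreover have "filterlim (\<lambda>n. complex_of_real (r n)) (at 0) sequentially"
        using r by (intro filterlim_atI) (auto simp: less_imp_neq[symmetric] intro!: tendsto_eq_intros eventuallyI)
      ultimately have "(\<lambda>n. (exp (- (\<i> * complex_of_real (v \<bullet> \<eta>)) * of_real (r n)) - 1) / of_real (r n)) \<longlonglongrightarrow> (- (\<i> * complex_of_real (v \<bullet> \<eta>)))"
        by (rule filterlim_compose)
      then show "(\<lambda>n. (unit_char (r n *\<^sub>R \<eta>) v - 1) / of_real (r n)) \<longlonglongrightarrow> - \<i> * complex_of_real (v \<bullet> \<eta>)"
        by (simp add: mult_ac)
    qed
    show "AE v in F. cmod ((unit_char (r n *\<^sub>R \<eta>) v - 1) / of_real (r n)) \<le> \<bar>v \<bullet> \<eta>\<bar>" for n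
    proof (rule AE_I2)
      fix v
      have "cmod (unit_char (r n *\<^sub>R \<eta>) v - 1) \<le> \<bar>r n * (v \<bullet> \<eta>)\<bar>"
        using iexp_approx1[of "- (v \<bullet> (r n *\<^sub>R \<eta>))" 0] by simp
      then show "cmod ((unit_char (r n *\<^sub>R \<eta>) v - 1) / of_real (r n)) \<le> \<bar>v \<bullet> \<eta>\<bar>"
        using r(2)[of n] by (simp add: norm_divide abs_mult field_simps)
    qed
  qed auto
  then show ?thesis unfolding eq by (simp add: integral_complex_of_real)
qed

text \<open>
  Blow-up of the ball of radius \<open>r\<close> to the unit ball. The weight and the volume element together contribute
  \<open>r\<^bsup>-\<alpha>\<^esup> \<ge> 1 / r\<close>, the factor that turns \<open>\<phi> - 1\<close> into a difference quotient.
\<close>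
lemma nn_integral_cball_difference_quotient_le_low_freq:
  fixes \<phi> :: "'a::euclidean_space \<Rightarrow> complex"
  assumes [measurable]: "\<phi> \<in> borel_measurable borel" and \<alpha>: "1 \<le> \<alpha>" and r: "0 < r" "r \<le> 1"
  shows "(\<integral>\<^sup>+\<eta>\<in>cball 0 1. ennreal (cmod ((\<phi> (r *\<^sub>R \<eta>) - 1) / of_real r)) \<partial>lborel) \<le> low_freq \<alpha> r \<phi>"
proof -
  let ?d = "real DIM('a)"
  have [measurable, simp]: "cball (0::'a) r \<in> sets borel" for r by simp
  have "low_freq \<alpha> r \<phi> = ennreal (r ^ DIM('a)) * (\<integral>\<^sup>+\<eta>. ennreal (cmod (\<phi> (r *\<^sub>R \<eta>) - 1) / norm (r *\<^sub>R \<eta>) powr (?d + \<alpha>)) * indicator (cball 0 r) (r *\<^sub>R \<eta>) \<partial>lborel)"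
    unfolding low_freq_def by (subst nn_integral_lborel_scale[of _ r]) (use r in auto)
  also have "\<dots> = (\<integral>\<^sup>+\<eta>. ennreal (r ^ DIM('a)) * (ennreal (cmod (\<phi> (r *\<^sub>R \<eta>) - 1) / norm (r *\<^sub>R \<eta>) powr (?d + \<alpha>)) * indicator (cball 0 r) (r *\<^sub>R \<eta>)) \<partial>lborel)"
    by (subst nn_integral_cmult) auto
  also have "\<dots> \<ge> (\<integral>\<^sup>+\<eta>\<in>cball 0 1. ennreal (cmod ((\<phi> (r *\<^sub>R \<eta>) - 1) / of_real r)) \<partial>lborel)"
  proof (intro nn_integral_mono_AE, use AE_lborel_singleton[of "0::'a"] in eventually_elim)
    case (elim \<eta>)
    show ?case
    proof (cases "norm \<eta> \<le> 1")
      case True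
      have "r powr \<alpha> * norm \<eta> powr (?d + \<alpha>) \<le> r * 1"
        using r True \<alpha> powr_mono'[of 1 \<alpha> r] by (intro mult_mono powr_le1) auto
      then have "1 / r \<le> 1 / (r powr \<alpha> * norm \<eta> powr (?d + \<alpha>))"
        using elim r by (intro divide_left_mono) auto
      also have "\<dots> = r ^ DIM('a) / norm (r *\<^sub>R \<eta>) powr (?d + \<alpha>)"
        using r by (simp add: powr_mult powr_add powr_realpow)
      finally have "cmod (\<phi> (r *\<^sub>R \<eta>) - 1) * (1 / r) \<le> cmod (\<phi> (r *\<^sub>R \<eta>) - 1) * (r ^ DIM('a) / norm (r *\<^sub>R \<eta>) powr (?d + \<alpha>))"
        by (intro mult_left_mono) auto
      then show ?thesis using True r
        by (simp add: norm_divide ennreal_mult[symmetric] mult.commute ennreal_leI)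
    qed simp
  qed
  finally show ?thesis .
qed

text \<open>
  The difference quotients converge to \<open>\<bar>m \<eta>\<bar>\<close> in modulus, where \<open>m \<eta>\<close> is the mean of \<open>v \<bullet> \<eta>\<close>, while their
  integrals over the unit ball are bounded by low-frequency integrals, which tend to zero. By
  Fatou's lemma \<open>m\<close> vanishes almost everywhere on the ball, and then everywhere by continuity and linearity.
\<close>
lemma (in borel_prob) mean_zero_if_dist_M_finite:
  assumes fin: "dist_M \<alpha> (fourier F) (\<lambda>_. 1) < \<infinity>" and \<alpha>: "1 \<le> \<alpha>"
  shows "(\<integral>v. v \<bullet> j \<partial>F) = 0"
proof -
  have int: "integrable F (\<lambda>v. norm v powr \<alpha>)"
    using integrable_powr_if_dist_M_finite[OF fin] \<alpha> by simp
  have i: "integrable F (\<lambda>v. v \<bullet> \<eta>)" for \<eta>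
    by (rule borel_prob_integrable_inner[OF _ int \<alpha>]) (rule borel_prob_axioms)
  define m where "m \<eta> = (\<integral>v. v \<bullet> \<eta> \<partial>F)" for \<eta>
  have lin: "linear m"
    using i by (intro linearI) (auto simp: m_def inner_add_right)
  then have cont: "continuous_on UNIV m" using linear_continuous_on linear_conv_bounded_linear by blast
  then have [measurable]: "m \<in> borel_measurable borel" by (rule borel_measurable_continuous_onI)
  define r where "r n = 1 / real (Suc n)" for n
  have r: "r \<longlonglongrightarrow> 0" "\<And>n. r n > 0" "\<And>n. r n \<le> 1"
    unfolding r_def using LIMSEQ_Suc[OF lim_1_over_n] by auto
  define q where "q n \<eta> = ennreal (cmod ((fourier F (r n *\<^sub>R \<eta>) - 1) / of_real (r n))) * indicator (cball 0 1) \<eta>" for n \<eta>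
  have [measurable, simp]: "cball (0::'a) r \<in> sets borel" for r by simp
  have [measurable]: "q n \<in> borel_measurable borel" for n
    unfolding q_def by measurable
  have "(\<integral>\<^sup>+\<eta>. ennreal \<bar>m \<eta>\<bar> * indicator (cball 0 1) \<eta> \<partial>lborel) = (\<integral>\<^sup>+\<eta>. liminf (\<lambda>n. q n \<eta>) \<partial>lborel)"
  proof (intro nn_integral_cong)
    fix \<eta>
    have "(\<lambda>n. q n \<eta>) \<longlonglongrightarrow> ennreal (cmod (- \<i> * of_real (m \<eta>))) * indicator (cball 0 1) \<eta>"
      unfolding q_def m_def
      by (intro tendsto_mult_ennreal tendsto_ennrealI tendsto_norm fourier_difference_quotient[OF int \<alpha> r(1,2)] tendsto_const)
         (auto simp: indicator_def)
    then show "ennreal \<bar>m \<eta>\<bar> * indicator (cball 0 1) \<eta> = liminf (\<lambda>n. q n \<eta>)"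
      by (subst lim_imp_Liminf) (auto simp: norm_mult)
  qed
  also have "\<dots> \<le> liminf (\<lambda>n. \<integral>\<^sup>+\<eta>. q n \<eta> \<partial>lborel)"
    by (rule nn_integral_liminf) simp
  also have "\<dots> \<le> liminf (\<lambda>n. low_freq \<alpha> (r n) (fourier F))"
    unfolding q_def using r by (intro Liminf_mono always_eventually allI nn_integral_cball_difference_quotient_le_low_freq \<alpha>) auto
  also have "\<dots> = 0"
    using low_freq_tendsto_0[OF _ fin] unfolding r_def by (intro lim_imp_Liminf) auto
  finally have "(\<integral>\<^sup>+\<eta>. ennreal \<bar>m \<eta>\<bar> * indicator (cball 0 1) \<eta> \<partial>lborel) = 0" by simp
  then have "AE \<eta> in lborel. ennreal \<bar>m \<eta>\<bar> * indicator (cball 0 1) \<eta> = 0"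
    by (subst (asm) nn_integral_0_iff_AE) auto
  then have ae: "AE \<eta> in lborel. \<eta> \<in> ball 0 1 \<longrightarrow> m \<eta> = 0"
    by eventually_elim (auto simp: indicator_def split: if_splits)
  have "AE \<eta> \<in> ball 0 1 in lebesgue. \<eta> \<in> {\<eta>. m \<eta> = 0}"
    using AE_completion[OF ae] by simp
  moreover have "closed {\<eta>. m \<eta> = 0}" using cont by (intro closed_Collect_eq) auto
  ultimately have z: "m \<eta> = 0" if "\<eta> \<in> ball 0 1" for \<eta>
    using mem_closed_if_AE_lebesgue_open[of "ball 0 1" "{\<eta>. m \<eta> = 0}" \<eta>] that by auto
  have "m ((1 / (norm j + 1)) *\<^sub>R j) = 0"
  proof (rule z)
    have "norm j / (norm j + 1) < 1" by (simp add: divide_less_eq) (smt (verit) norm_ge_zero)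
    then show "(1 / (norm j + 1)) *\<^sub>R j \<in> ball 0 1" by simp
  qed
  then have "(1 / (norm j + 1)) * m j = 0" using linear_scale[OF lin] by simp
  moreover have "norm j + 1 \<noteq> 0" by (smt (verit) norm_ge_zero)
  ultimately show ?thesis by (simp add: m_def)
qed

theorem M_space_subset_fourier_P_space:
  assumes \<alpha>: "0 < \<alpha>"
  shows "M_space \<alpha> \<subseteq> fourier ` P_space \<alpha>"
proof
  fix \<phi> assume M: "\<phi> \<in> M_space \<alpha>"
  then obtain F where F: "borel_prob F" "fourier F = \<phi>" using M_space_char_fun char_fun_cases by metis
  interpret borel_prob F by fact
  have fin: "dist_M \<alpha> (fourier F) (\<lambda>_. 1) < \<infinity>" using M F by (simp add: M_space_def)
  have "F \<in> P_space \<alpha>"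
    using prob_space_axioms integrable_powr_if_dist_M_finite[OF fin \<alpha>] mean_zero_if_dist_M_finite[OF fin]
    by (simp add: P_space_def)
  then show "\<phi> \<in> fourier ` P_space \<alpha>" using F by auto
qed

section \<open>The inclusions between the spaces\<close>

lemma cmod_diff_le_dist_K:
  assumes "dist_K \<beta> \<phi> \<psi> < \<infinity>" "\<xi> \<noteq> 0"
  shows "cmod (\<phi> \<xi> - \<psi> \<xi>) \<le> enn2real (dist_K \<beta> \<phi> \<psi>) * norm \<xi> powr \<beta>"
proof -
  have "ennreal (cmod (\<phi> \<xi> - \<psi> \<xi>) / norm \<xi> powr \<beta>) \<le> dist_K \<beta> \<phi> \<psi>"
    unfolding dist_K_def using assms by (intro SUP_upper) auto
  then have "cmod (\<phi> \<xi> - \<psi> \<xi>) / norm \<xi> powr \<beta> \<le> enn2real (dist_K \<beta> \<phi> \<psi>)"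
    using assms(1) by (cases "dist_K \<beta> \<phi> \<psi>") (auto simp: ennreal_le_iff2)
  then show ?thesis using assms(2) by (simp add: divide_le_eq)
qed

lemma dist_K_leI:
  assumes "\<And>\<xi>. \<xi> \<noteq> 0 \<Longrightarrow> cmod (\<phi> \<xi> - \<psi> \<xi>) \<le> C * norm \<xi> powr \<beta>"
  shows "dist_K \<beta> \<phi> \<psi> \<le> ennreal C"
  unfolding dist_K_def using assms by (intro SUP_least ennreal_leI) (auto simp: divide_le_eq)

text \<open>
  A function in \<open>K_space \<beta>\<close> satisfies \<open>|\<phi> - 1| \<le> C min (|\<xi>|\<^sup>\<beta>) 1\<close>, where the second bound holds for every
  characteristic function, and this minimum is integrable against \<open>|\<xi>|\<^bsup>-d-\<alpha>\<^esup>\<close> when \<open>0 < \<alpha> < \<beta>\<close>.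
\<close>
theorem K_space_subset_M_space:
  assumes "0 < \<alpha>" "\<alpha> < \<beta>"
  shows "K_space \<beta> \<subseteq> (M_space \<alpha> :: ('a::euclidean_space \<Rightarrow> complex) set)"
proof
  fix \<phi> :: "'a \<Rightarrow> complex" assume K: "\<phi> \<in> K_space \<beta>"
  then have \<phi>: "\<phi> \<in> char_funs" and fin: "dist_K \<beta> \<phi> (\<lambda>_. 1) < \<infinity>" by (auto simp: K_space_def)
  define C where "C = max 2 (enn2real (dist_K \<beta> \<phi> (\<lambda>_. 1)))"
  define w where "w \<xi> = min (norm \<xi> powr \<beta>) (norm \<xi> powr 0) / norm \<xi> powr (real DIM('a) + \<alpha>)" for \<xi> :: 'a
  have C: "C \<ge> 2" by (simp add: C_def)
  have "dist_M \<alpha> \<phi> (\<lambda>_. 1) \<le> (\<integral>\<^sup>+\<xi>. ennreal C * ennreal (w \<xi>) \<partial>lborel)"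
    unfolding dist_M_def
  proof (intro nn_integral_mono)
    fix \<xi> :: 'a
    have "cmod (\<phi> \<xi> - 1) \<le> C * min (norm \<xi> powr \<beta>) (norm \<xi> powr 0)" if nz: "\<xi> \<noteq> 0"
    proof -
      have "cmod (\<phi> \<xi> - 1) \<le> enn2real (dist_K \<beta> \<phi> (\<lambda>_. 1)) * norm \<xi> powr \<beta>"
        using cmod_diff_le_dist_K[OF fin nz] .
      also have "\<dots> \<le> C * norm \<xi> powr \<beta>" by (intro mult_right_mono) (auto simp: C_def)
      finally have "cmod (\<phi> \<xi> - 1) \<le> C * norm \<xi> powr \<beta>" .
      moreover have "cmod (\<phi> \<xi> - 1) \<le> C"
        using char_fun_diff_le_2[OF \<phi> const_1_char_fun, of \<xi>] C by simp
      ultimately show ?thesis using C nz by (simp add: min_def)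
    qed
    then show "ennreal (cmod (\<phi> \<xi> - 1) / norm \<xi> powr (real DIM('a) + \<alpha>)) \<le> ennreal C * ennreal (w \<xi>)"
      using C by (cases "\<xi> = 0") (auto simp: w_def ennreal_mult[symmetric] intro!: ennreal_leI divide_right_mono)
  qed
  also have "\<dots> < \<infinity>"
    using nn_integral_radial_kernel_finite[of 0 \<alpha> \<beta>, where 'a='a] assms
    by (subst nn_integral_cmult) (auto simp: w_def ennreal_mult_less_top)
  finally show "\<phi> \<in> M_space \<alpha>" using \<phi> by (simp add: M_space_def)
qed

theorem fourier_P_space_subset_K_space:
  assumes \<alpha>: "0 < \<alpha>" "\<alpha> < 2"
  shows "fourier ` P_space \<alpha> \<subseteq> K_space \<alpha>"
proof clarify
  fix F :: "'a measure" assume F: "F \<in> P_space \<alpha>"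
  have "dist_K \<alpha> (fourier F) (\<lambda>_. 1) \<le> ennreal (2 * (\<integral>v. norm v powr \<alpha> \<partial>F))"
  proof (rule dist_K_leI)
    fix \<xi> :: 'a
    have "(\<integral>v. taylor_bound (mom_index \<alpha>) (norm v * norm \<xi>) \<partial>F) \<le> (\<integral>v. norm v powr \<alpha> * norm \<xi> powr \<alpha> \<partial>F)"
    proof (rule integral_mono)
      show "taylor_bound (mom_index \<alpha>) (norm v * norm \<xi>) \<le> norm v powr \<alpha> * norm \<xi> powr \<alpha>" for v
        using taylor_bound_le_powr[of "norm v * norm \<xi>" "mom_index \<alpha>" \<alpha>] mom_index_bounds[OF \<alpha>] \<alpha>
        by (simp add: powr_mult)
    qed (use fourier_diff_1_le(1)[OF F \<alpha>] P_space_integrable_powr[OF F] in auto)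
    then show "cmod (fourier F \<xi> - 1) \<le> 2 * (\<integral>v. norm v powr \<alpha> \<partial>F) * norm \<xi> powr \<alpha>"
      using fourier_diff_1_le(2)[OF F \<alpha>, of \<xi>] by simp
  qed
  also have "\<dots> < \<infinity>" by simp
  finally show "fourier F \<in> K_space \<alpha>"
    using F P_space_subset_P_space_0 by (auto simp: K_space_def char_funs_def)
qed

lemma nn_integral_taylor_bound:
  fixes v :: "'a::euclidean_space"
  assumes \<alpha>: "real b < \<alpha>" "\<alpha> < real (Suc b)"
  shows "(\<integral>\<^sup>+\<xi>. ennreal (taylor_bound b (norm v * norm \<xi>) / norm \<xi> powr (real DIM('a) + \<alpha>)) \<partial>(lborel :: 'a measure))
    = ennreal (norm v powr \<alpha>) * (\<integral>\<^sup>+\<xi>. ennreal (min (norm \<xi> powr real (Suc b)) (norm \<xi> powr real b) / norm \<xi> powr (real DIM('a) + \<alpha>)) \<partial>(lborel :: 'a measure))"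
proof (cases "v = 0")
  case True
  then show ?thesis by (simp add: taylor_bound_def power_0_left)
next
  case False
  have eq: "taylor_bound b (norm v * norm \<xi>) / norm \<xi> powr (real DIM('a) + \<alpha>) =
      min ((norm v * norm \<xi>) powr real (Suc b)) ((norm v * norm \<xi>) powr real b) / norm \<xi> powr (real DIM('a) + \<alpha>)" for \<xi> :: 'a
  proof (cases "\<xi> = 0")
    case nz: False
    have p: "0 < norm v * norm \<xi>" using False nz by simp
    show ?thesis by (simp only: taylor_bound_def powr_realpow[OF p] min.commute)
  qed simp
  show ?thesis
    unfolding eq using False by (intro nn_integral_radial_kernel_scaled) simp
qed

text \<open>
  For \<open>\<alpha> = 1\<close> the Taylor remainder \<open>min x (x\<^sup>2)\<close> is not integrable against \<open>x\<^bsup>-2\<^esup>\<close> at infinity; for the other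
  exponents \<open>\<alpha>\<close> lies strictly between \<open>b\<close> and \<open>b + 1\<close> and the kernel integral is finite.
\<close>
theorem fourier_P_space_subset_M_space:
  assumes \<alpha>: "0 < \<alpha>" "\<alpha> < 2" "\<alpha> \<noteq> 1"
  shows "fourier ` P_space \<alpha> \<subseteq> (M_space \<alpha> :: ('a::euclidean_space \<Rightarrow> complex) set)"
proof clarify
  fix F :: "'a measure" assume F: "F \<in> P_space \<alpha>"
  interpret borel_prob F using P_space_imp_borel_prob[OF F] .
  interpret pair_sigma_finite "lborel :: 'a measure" F ..
  define b where "b = mom_index \<alpha>"
  have b: "real b < \<alpha>" "\<alpha> < real (Suc b)" using \<alpha> by (auto simp: b_def mom_index_def)
  let ?w = "\<lambda>\<xi>::'a. norm \<xi> powr (real DIM('a) + \<alpha>)"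
  define C where "C = (\<integral>\<^sup>+\<xi>. ennreal (min (norm \<xi> powr real (Suc b)) (norm \<xi> powr real b) / ?w \<xi>) \<partial>(lborel :: 'a measure))"
  have C: "C < \<infinity>" unfolding C_def by (rule nn_integral_radial_kernel_finite) (use b in auto)
  have [measurable]: "taylor_bound b \<in> borel_measurable borel" unfolding taylor_bound_def[abs_def] by measurable
  have "dist_M \<alpha> (fourier F) (\<lambda>_. 1) \<le> (\<integral>\<^sup>+\<xi>. (\<integral>\<^sup>+v. 2 * ennreal (taylor_bound b (norm v * norm \<xi>) / ?w \<xi>) \<partial>F) \<partial>lborel)"
    unfolding dist_M_def
  proof (intro nn_integral_mono)
    fix \<xi> :: 'a
    have int: "integrable F (\<lambda>v. 2 * (taylor_bound b (norm v * norm \<xi>) / ?w \<xi>))"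
      using fourier_diff_1_le(1)[OF F \<alpha>(1,2)] unfolding b_def by (intro integrable_mult_right integrable_divide) auto
    have "ennreal (cmod (fourier F \<xi> - 1) / ?w \<xi>) \<le> ennreal (\<integral>v. 2 * (taylor_bound b (norm v * norm \<xi>) / ?w \<xi>) \<partial>F)"
      using fourier_diff_1_le(2)[OF F \<alpha>(1,2), of \<xi>] unfolding b_def by (auto intro!: ennreal_leI divide_right_mono)
    also have "\<dots> = (\<integral>\<^sup>+v. ennreal (2 * (taylor_bound b (norm v * norm \<xi>) / ?w \<xi>)) \<partial>F)"
      by (rule nn_integral_eq_integral[symmetric, OF int]) (auto simp: taylor_bound_nonneg)
    also have "\<dots> = (\<integral>\<^sup>+v. 2 * ennreal (taylor_bound b (norm v * norm \<xi>) / ?w \<xi>) \<partial>F)"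
      by (intro nn_integral_cong) (subst ennreal_mult, auto simp: taylor_bound_nonneg)
    finally show "ennreal (cmod (fourier F \<xi> - 1) / ?w \<xi>) \<le> (\<integral>\<^sup>+v. 2 * ennreal (taylor_bound b (norm v * norm \<xi>) / ?w \<xi>) \<partial>F)" .
  qed
  also have "\<dots> = (\<integral>\<^sup>+v. (\<integral>\<^sup>+\<xi>. 2 * ennreal (taylor_bound b (norm v * norm \<xi>) / ?w \<xi>) \<partial>lborel) \<partial>F)"
    by (rule Fubini'[symmetric]) simp
  also have "\<dots> = (\<integral>\<^sup>+v. 2 * (ennreal (norm v powr \<alpha>) * C) \<partial>F)"
    by (simp add: nn_integral_cmult nn_integral_taylor_bound[OF b] C_def)
  also have "\<dots> = 2 * ((\<integral>\<^sup>+v. ennreal (norm v powr \<alpha>) \<partial>F) * C)"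
    by (simp add: nn_integral_cmult nn_integral_multc)
  also have "\<dots> < \<infinity>"
    using C P_space_integrable_powr[OF F] by (auto simp: ennreal_mult_less_top nn_integral_eq_integral)
  finally show "fourier F \<in> M_space \<alpha>"
    using F P_space_subset_P_space_0 by (auto simp: M_space_def char_funs_def)
qed

section \<open>A measure without a moment of order \<open>\<alpha>\<close>\<close>

text \<open>
  The integrand is homogeneous of degree \<open>-d\<close>, so dilation by 2 does not change the integral except that
  the domain grows by the shell \<open>1/2 \<le> |v| < 1\<close>. A value \<open>I\<close> with \<open>I = J + I\<close> and \<open>J > 0\<close> is infinite.
\<close>
lemma nn_integral_norm_powr_neg_dim:
  "(\<integral>\<^sup>+v\<in>{v::'a::euclidean_space. 1 \<le> norm v}. ennreal (norm v powr (- real DIM('a))) \<partial>lborel) = \<infinity>"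
proof -
  define g where "g v = ennreal (norm v powr (- real DIM('a)))" for v :: 'a
  have [measurable]: "g \<in> borel_measurable borel" unfolding g_def by measurable
  define A where "A = {v::'a. 1/2 \<le> norm v \<and> norm v < 1}"
  define I where "I = (\<integral>\<^sup>+v\<in>{v. 1 \<le> norm v}. g v \<partial>lborel)"
  have [measurable]: "A \<in> sets borel" unfolding A_def by measurable
  have "I = ennreal (\<bar>2\<bar> ^ DIM('a)) * (\<integral>\<^sup>+v. g (2 *\<^sub>R v) * indicator {v. 1 \<le> norm v} (2 *\<^sub>R v) \<partial>lborel)"
    unfolding I_def by (rule nn_integral_lborel_scale) auto
  also have "\<dots> = (\<integral>\<^sup>+v. ennreal (2 ^ DIM('a)) * (g (2 *\<^sub>R v) * indicator {v. 1 \<le> norm v} (2 *\<^sub>R v)) \<partial>lborel)"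
    by (simp add: nn_integral_cmult)
  also have "\<dots> = (\<integral>\<^sup>+v. g v * indicator A v + g v * indicator {v. 1 \<le> norm v} v \<partial>lborel)"
  proof (intro nn_integral_cong)
    fix v :: 'a
    have "ennreal (2 ^ DIM('a)) * g (2 *\<^sub>R v) = g v"
      by (simp add: g_def ennreal_mult[symmetric] powr_mult powr_minus powr_realpow)
    then show "ennreal (2 ^ DIM('a)) * (g (2 *\<^sub>R v) * indicator {v. 1 \<le> norm v} (2 *\<^sub>R v)) = g v * indicator A v + g v * indicator {v. 1 \<le> norm v} v"
      by (auto simp: indicator_def A_def)
  qed
  also have "\<dots> = (\<integral>\<^sup>+v\<in>A. g v \<partial>lborel) + I"
    unfolding I_def by (subst nn_integral_add) auto
  finally have eq: "I = (\<integral>\<^sup>+v\<in>A. g v \<partial>lborel) + I" .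
  have "emeasure lborel A > 0"
  proof -
    obtain j :: 'a where j: "j \<in> Basis" using nonempty_Basis by blast
    have "ball ((3/4) *\<^sub>R j) (1/4) \<subseteq> A"
    proof
      fix x assume "x \<in> ball ((3/4) *\<^sub>R j) (1/4)"
      then have x: "norm ((3/4) *\<^sub>R j - x) < 1/4" by (simp add: dist_norm)
      have "norm ((3/4) *\<^sub>R j) = 3/4" using j by simp
      with x norm_triangle_ineq2[of "(3/4) *\<^sub>R j" x] norm_triangle_ineq2[of x "(3/4) *\<^sub>R j"] norm_minus_commute[of x "(3/4) *\<^sub>R j"]
      show "x \<in> A" by (auto simp: A_def)
    qed
    then have "emeasure lborel (ball ((3/4) *\<^sub>R j) (1/4)) \<le> emeasure lborel A" by (intro emeasure_mono) auto
    moreover have "emeasure lborel (ball ((3/4) *\<^sub>R j) (1/4)) > 0" by (subst emeasure_ball) auto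
    ultimately show ?thesis by simp
  qed
  also have "emeasure lborel A = (\<integral>\<^sup>+v. indicator A v \<partial>lborel)" by simp
  also have "\<dots> \<le> (\<integral>\<^sup>+v\<in>A. g v \<partial>lborel)"
  proof (intro nn_integral_mono)
    fix v :: 'a
    have "1 \<le> norm v powr (- real DIM('a))" if "v \<in> A"
      using that powr_mono2'[of "real DIM('a)" "norm v" 1] by (auto simp: A_def powr_minus powr_le1 intro!: one_le_inverse)
    then show "indicator A v \<le> g v * indicator A v" by (auto simp: indicator_def g_def)
  qed
  finally have "(\<integral>\<^sup>+v\<in>A. g v \<partial>lborel) > 0" .
  with eq have "I = \<infinity>"
    by (metis add.right_neutral ennreal_add_left_cancel add.commute infinity_ennreal_def less_irrefl)
  then show ?thesis by (simp add: I_def g_def)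
qed

lemma integral_lborel_odd:
  fixes f :: "'a::euclidean_space \<Rightarrow> real"
  assumes [measurable]: "f \<in> borel_measurable borel" and odd: "\<And>x. f (- x) = - f x"
  shows "(\<integral>x. f x \<partial>lborel) = 0"
proof -
  have "(lborel :: 'a measure) = distr lborel borel uminus"
    by (subst lborel_affine[of "-1" "0::'a"]) (simp_all add: density_1 scaleR_minus1_left[abs_def])
  then have "(\<integral>x. f x \<partial>lborel) = (\<integral>x. f x \<partial>distr lborel borel uminus)" by simp
  also have "\<dots> = - (\<integral>x. f x \<partial>lborel)" by (subst integral_distr) (auto simp: odd)
  finally show ?thesis by simp
qed

text \<open>
  The density is proportional to \<open>|v|\<^bsup>-d-\<alpha>\<^esup>\<close> on \<open>|v| \<ge> 1\<close>. Multiplied by \<open>|v|\<^sup>\<alpha>\<close> it becomes \<open>|v|\<^bsup>-d\<^esup>\<close>, whose integral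
  diverges. By symmetry \<open>1 - \<phi>\<close> is real and equals the integral of \<open>1 - cos (v \<bullet> \<xi>)\<close>; the bound
  \<open>2 min (|v|\<^sup>2 |\<xi>|\<^sup>2) 1\<close> for the cosine term and the scaling of the radial kernel give \<open>|1 - \<phi>| \<le> C |\<xi>|\<^sup>\<alpha>\<close>.
\<close>
lemma infinite_moment_with_K_space_fourier:
  assumes \<alpha>: "0 < \<alpha>" "\<alpha> < 2"
  obtains F :: "'a::euclidean_space measure"
    where "borel_prob F" "\<not> integrable F (\<lambda>v. norm v powr \<alpha>)" "fourier F \<in> K_space \<alpha>"
proof -
  let ?d = "real DIM('a)"
  define W where "W v = norm v powr (- (?d + \<alpha>)) * indicator {v. 1 \<le> norm v} v" for v :: 'a
  have [measurable]: "W \<in> borel_measurable borel" unfolding W_def by measurable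
  have W0: "W v \<ge> 0" for v by (simp add: W_def)
  define C where "C = (\<integral>\<^sup>+v. ennreal (min (norm v powr 2) (norm v powr 0) / norm v powr (?d + \<alpha>)) \<partial>(lborel :: 'a measure))"
  have C: "C < \<infinity>" unfolding C_def by (rule nn_integral_radial_kernel_finite) (use \<alpha> in auto)
  define z where "z = enn2real (\<integral>\<^sup>+v. ennreal (W v) \<partial>lborel)"
  have "(\<integral>\<^sup>+v. ennreal (W v) \<partial>lborel) \<le> C"
    unfolding C_def
  proof (intro nn_integral_mono ennreal_leI)
    fix v :: 'a
    have "1 \<le> norm v powr 2" if "1 \<le> norm v" using that by (intro ge_one_powr_ge_zero) auto
    then show "W v \<le> min (norm v powr 2) (norm v powr 0) / norm v powr (?d + \<alpha>)"
      unfolding W_def powr_minus_divide by (auto simp: indicator_def intro!: divide_right_mono)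
  qed
  with C have fin: "(\<integral>\<^sup>+v. ennreal (W v) \<partial>lborel) < \<infinity>" by simp
  then have Z: "(\<integral>\<^sup>+v. ennreal (W v) \<partial>lborel) = ennreal z" by (simp add: z_def less_top)
  have inf: "(\<integral>\<^sup>+v. ennreal (norm v powr \<alpha> * W v) \<partial>lborel) = \<infinity>"
  proof -
    have "ennreal (norm v powr \<alpha> * W v) = ennreal (norm v powr (- ?d)) * indicator {v. 1 \<le> norm v} v" for v
      by (auto simp: W_def indicator_def powr_add[symmetric])
    then show ?thesis using nn_integral_norm_powr_neg_dim[where 'a='a] by simp
  qed
  have "z \<noteq> 0"
  proof
    assume "z = 0"
    then have "AE v in lborel. ennreal (W v) = 0" using Z by (simp add: nn_integral_0_iff_AE)
    then have "AE v in lborel. ennreal (norm v powr \<alpha> * W v) = 0"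
    proof eventually_elim
      case (elim v)
      then have "W v = 0" using W0[of v] by (simp add: ennreal_eq_0_iff)
      then show ?case by simp
    qed
    then have "(\<integral>\<^sup>+v. ennreal (norm v powr \<alpha> * W v) \<partial>lborel) = 0" by (simp add: nn_integral_0_iff_AE)
    with inf show False by simp
  qed
  then have z: "z > 0" by (simp add: z_def less_le)
  define F where "F = density lborel (\<lambda>v. ennreal (W v / z))"
  have nnF: "(\<integral>\<^sup>+v. f v \<partial>F) = ennreal (1 / z) * (\<integral>\<^sup>+v. ennreal (W v) * f v \<partial>lborel)"
    if [measurable]: "f \<in> borel_measurable borel" for f
    unfolding F_def using z W0
    by (simp add: nn_integral_density nn_integral_cmult[symmetric] ennreal_mult[symmetric] mult.assoc[symmetric])
  have "emeasure F (space F) = 1"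
  proof -
    have "emeasure F (space F) = (\<integral>\<^sup>+v. 1 \<partial>F)" by simp
    also have "\<dots> = ennreal (1 / z) * (\<integral>\<^sup>+v. ennreal (W v) * 1 \<partial>lborel)" by (rule nnF) simp
    also have "\<dots> = 1" using z by (simp add: Z ennreal_mult[symmetric])
    finally show ?thesis .
  qed
  then have F: "borel_prob F" by (simp add: borel_prob_def borel_prob_axioms_def prob_spaceI F_def)
  interpret borel_prob F by fact
  have "(\<integral>\<^sup>+v. ennreal (norm v powr \<alpha>) \<partial>F) = ennreal (1 / z) * (\<integral>\<^sup>+v. ennreal (norm v powr \<alpha> * W v) \<partial>lborel)"
    using W0 by (simp add: nnF ennreal_mult mult.commute)
  also have "\<dots> = \<infinity>" unfolding inf using z by (simp add: ennreal_mult_top)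
  finally have ni: "\<not> integrable F (\<lambda>v. norm v powr \<alpha>)"
    by (auto simp: nn_integral_eq_integral)
  have bound: "cmod (fourier F \<xi> - 1) \<le> 2 / z * enn2real C * norm \<xi> powr \<alpha>" if nz: "\<xi> \<noteq> 0" for \<xi>
  proof -
    have int: "integrable F (\<lambda>v. cos (v \<bullet> \<xi>))" "integrable F (\<lambda>v. sin (v \<bullet> \<xi>))"
      by (rule integrable_const_bound[of _ 1]; simp)+
    have re: "Re (fourier F \<xi>) = (\<integral>v. cos (v \<bullet> \<xi>) \<partial>F)"
      unfolding fourier_def by (subst integral_Re[symmetric]) (auto simp: Re_unit_char)
    have "Im (fourier F \<xi>) = (\<integral>v. - sin (v \<bullet> \<xi>) \<partial>F)"
      unfolding fourier_def by (subst integral_Im[symmetric]) (auto simp: Im_unit_char)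
    also have "\<dots> = (\<integral>v. - (W v / z) * sin (v \<bullet> \<xi>) \<partial>lborel)"
      unfolding F_def using W0 z by (subst integral_density) auto
    also have "\<dots> = 0" by (rule integral_lborel_odd) (auto simp: W_def indicator_def)
    finally have im: "Im (fourier F \<xi>) = 0" .
    have "fourier F \<xi> - 1 = - of_real (\<integral>v. 1 - cos (v \<bullet> \<xi>) \<partial>F)"
      using int by (simp add: complex_eq_iff re im)
    then have "cmod (fourier F \<xi> - 1) = (\<integral>v. 1 - cos (v \<bullet> \<xi>) \<partial>F)"
      by (simp only: norm_minus_cancel norm_of_real) (auto intro!: integral_nonneg)
    then have "ennreal (cmod (fourier F \<xi> - 1)) = (\<integral>\<^sup>+v. ennreal (1 - cos (v \<bullet> \<xi>)) \<partial>F)"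
      using int by (subst nn_integral_eq_integral) auto
    also have "\<dots> = ennreal (1 / z) * (\<integral>\<^sup>+v. ennreal (W v) * ennreal (1 - cos (v \<bullet> \<xi>)) \<partial>lborel)"
      by (rule nnF) simp
    also have "\<dots> \<le> ennreal (1 / z) * (\<integral>\<^sup>+v. 2 * ennreal (min ((norm \<xi> * norm v) powr 2) ((norm \<xi> * norm v) powr 0) / norm v powr (?d + \<alpha>)) \<partial>(lborel :: 'a measure))"
    proof (intro mult_left_mono nn_integral_mono)
      fix v :: 'a
      define x where "x = norm \<xi> * norm v"
      show "ennreal (W v) * ennreal (1 - cos (v \<bullet> \<xi>)) \<le> 2 * ennreal (min ((norm \<xi> * norm v) powr 2) ((norm \<xi> * norm v) powr 0) / norm v powr (?d + \<alpha>))"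
      proof (cases "1 \<le> norm v")
        case True
        then have x: "x > 0" using nz unfolding x_def by (intro mult_pos_pos) auto
        have "1 - cos (v \<bullet> \<xi>) \<le> 2 * min (x powr 2) (x powr 0)"
        proof -
          have "1 - cos (v \<bullet> \<xi>) = 2 * (sin ((v \<bullet> \<xi>) / 2))\<^sup>2"
            using cos_double_sin[of "(v \<bullet> \<xi>) / 2"] by simp
          moreover have "\<bar>sin ((v \<bullet> \<xi>) / 2)\<bar> \<le> x"
            using abs_sin_x_le_abs_x[of "(v \<bullet> \<xi>) / 2"] Cauchy_Schwarz_ineq2[of v \<xi>] by (simp add: x_def mult.commute)
          then have "(sin ((v \<bullet> \<xi>) / 2))\<^sup>2 \<le> x\<^sup>2" using x by (simp add: abs_le_square_iff[symmetric])
          moreover have "(sin ((v \<bullet> \<xi>) / 2))\<^sup>2 \<le> 1" by (simp add: abs_square_le_1)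
          ultimately show ?thesis using x by simp
        qed
        then have "W v * (1 - cos (v \<bullet> \<xi>)) \<le> W v * (2 * min (x powr 2) (x powr 0))"
          by (intro mult_left_mono W0)
        also have "\<dots> = 2 * (min (x powr 2) (x powr 0) / norm v powr (?d + \<alpha>))"
          unfolding W_def powr_minus_divide using True by simp
        finally have "ennreal (W v * (1 - cos (v \<bullet> \<xi>))) \<le> ennreal (2 * (min (x powr 2) (x powr 0) / norm v powr (?d + \<alpha>)))"
          by (rule ennreal_leI)
        also have "\<dots> = 2 * ennreal (min (x powr 2) (x powr 0) / norm v powr (?d + \<alpha>))"
          by (subst ennreal_mult) auto
        also have "ennreal (W v * (1 - cos (v \<bullet> \<xi>))) = ennreal (W v) * ennreal (1 - cos (v \<bullet> \<xi>))"
          using W0 by (subst ennreal_mult) auto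
        finally show ?thesis by (simp only: x_def)
      qed (simp add: W_def)
    qed simp
    also have "\<dots> = ennreal (1 / z) * (2 * (ennreal (norm \<xi> powr \<alpha>) * C))"
    proof -
      have "0 < norm \<xi>" using nz by simp
      then show ?thesis unfolding C_def
        by (simp only: nn_integral_radial_kernel_scaled[symmetric]) (subst nn_integral_cmult, auto)
    qed
    also have "\<dots> = ennreal (2 / z * enn2real C * norm \<xi> powr \<alpha>)"
    proof -
      obtain c where c: "C = ennreal c" "c \<ge> 0" using C by (cases C) auto
      have "ennreal (1 / z) * (2 * (ennreal (norm \<xi> powr \<alpha>) * C)) = 2 * ennreal (c * norm \<xi> powr \<alpha> / z)"
        using z c by (simp add: ennreal_mult[symmetric] mult_ac)
      also have "\<dots> = ennreal (2 * (c * norm \<xi> powr \<alpha> / z))"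
        using z c(2) by (subst ennreal_mult) auto
      finally show ?thesis using c by (simp add: mult_ac)
    qed
    finally show ?thesis using z by (subst (asm) ennreal_le_iff) auto
  qed
  have "dist_K \<alpha> (fourier F) (\<lambda>_. 1) < \<infinity>"
    using dist_K_leI[OF bound] by (rule order.strict_trans1) simp_all
  then have "fourier F \<in> K_space \<alpha>" using F by (auto simp: K_space_def char_funs_def P_space_0_iff_borel_prob)
  with F ni that show ?thesis by blast
qed

section \<open>Trigonometric polynomials, uniqueness and weak convergence\<close>

inductive trig_poly :: "('a::euclidean_space \<Rightarrow> real) \<Rightarrow> bool" where
  wave: "trig_poly (\<lambda>v. a * cos (v \<bullet> \<xi> + t))"
| add: "trig_poly p \<Longrightarrow> trig_poly q \<Longrightarrow> trig_poly (\<lambda>v. p v + q v)"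

lemma trig_poly_const: "trig_poly (\<lambda>_. c)"
  using trig_poly.wave[of c 0 0] by simp

lemma trig_poly_mult:
  assumes "trig_poly p" "trig_poly q"
  shows "trig_poly (\<lambda>v. p v * q v)"
  using assms
proof (induction arbitrary: q)
  case (wave a \<xi> t)
  from wave.prems show ?case
  proof induction
    case (wave b \<eta> s)
    have "(\<lambda>v. a * cos (v \<bullet> \<xi> + t) * (b * cos (v \<bullet> \<eta> + s))) =
      (\<lambda>v. a * b / 2 * cos (v \<bullet> (\<xi> - \<eta>) + (t - s)) + a * b / 2 * cos (v \<bullet> (\<xi> + \<eta>) + (t + s)))"
    proof
      fix v
      have product: "a * cos x * (b * cos y) = a * b / 2 * cos (x - y) + a * b / 2 * cos (x + y)" for x y
        by (simp add: cos_diff cos_add algebra_simps)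
      have e: "v \<bullet> (\<xi> - \<eta>) + (t - s) = (v \<bullet> \<xi> + t) - (v \<bullet> \<eta> + s)" "v \<bullet> (\<xi> + \<eta>) + (t + s) = (v \<bullet> \<xi> + t) + (v \<bullet> \<eta> + s)"
        by (auto simp: inner_diff_right inner_add_right)
      show "a * cos (v \<bullet> \<xi> + t) * (b * cos (v \<bullet> \<eta> + s)) =
        a * b / 2 * cos (v \<bullet> (\<xi> - \<eta>) + (t - s)) + a * b / 2 * cos (v \<bullet> (\<xi> + \<eta>) + (t + s))"
        unfolding e by (rule product)
    qed
    then show ?case by (simp only: trig_poly.intros)
  next
    case (add p q)
    then have "trig_poly (\<lambda>v. a * cos (v \<bullet> \<xi> + t) * p v + a * cos (v \<bullet> \<xi> + t) * q v)"
      by (intro trig_poly.add)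
    then show ?case by (simp add: distrib_left)
  qed
next
  case (add p p')
  then have "trig_poly (\<lambda>v. p v * q v + p' v * q v)" by (intro trig_poly.add) auto
  then show ?case by (simp add: distrib_right)
qed

lemma trig_poly_continuous: "trig_poly p \<Longrightarrow> continuous_on S p"
  by (induction rule: trig_poly.induct) (auto intro!: continuous_intros)

lemma trig_poly_bounded:
  "trig_poly p \<Longrightarrow> \<exists>B. \<forall>v. \<bar>p v\<bar> \<le> B"
proof (induction rule: trig_poly.induct)
  case (wave a \<xi> t)
  have "\<bar>a * cos (v \<bullet> \<xi> + t)\<bar> \<le> \<bar>a\<bar>" for v
    using mult_left_mono[OF abs_cos_le_one, of "\<bar>a\<bar>"] by (simp add: abs_mult)
  then show ?case by blast
next
  case (add p q)
  then obtain A B where AB: "\<And>v. \<bar>p v\<bar> \<le> A" "\<And>v. \<bar>q v\<bar> \<le> B" by blast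
  have "\<bar>p v + q v\<bar> \<le> A + B" for v using AB[of v] by linarith
  then show ?case by blast
qed

lemma trig_poly_separates:
  fixes x y :: "'a::euclidean_space"
  assumes "x \<noteq> y"
  shows "\<exists>p. trig_poly p \<and> p x \<noteq> p y"
proof -
  \<comment> \<open>the frequency for which the phases at \<open>x\<close> and \<open>y\<close> differ by \<open>pi\<close>\<close>
  define \<xi> where "\<xi> = (pi / (norm (x - y))\<^sup>2) *\<^sub>R (x - y)"
  have "x \<bullet> \<xi> - y \<bullet> \<xi> = (x - y) \<bullet> \<xi>" by (simp add: inner_diff_left)
  also have "\<dots> = pi" using assms by (simp add: \<xi>_def power2_norm_eq_inner[symmetric])
  finally have "x \<bullet> \<xi> - y \<bullet> \<xi> = pi" .
  then have "1 * cos (x \<bullet> \<xi> + - (y \<bullet> \<xi>)) \<noteq> 1 * cos (y \<bullet> \<xi> + - (y \<bullet> \<xi>))" by simp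
  moreover have "trig_poly (\<lambda>v. 1 * cos (v \<bullet> \<xi> + - (y \<bullet> \<xi>)))" by (rule trig_poly.wave)
  ultimately show ?thesis by blast
qed

lemma trig_poly_compose_polynomial:
  fixes q :: "real \<Rightarrow> real"
  assumes "real_polynomial_function q" and p: "trig_poly p"
  shows "trig_poly (\<lambda>v. q (p v))"
  using assms(1)
proof induction
  case (linear f)
  then obtain c where "f = (\<lambda>x. x * c)" using real_bounded_linear by blast
  then show ?case using trig_poly_mult[OF p trig_poly_const] by simp
qed (auto intro: trig_poly.add trig_poly_mult trig_poly_const)

text \<open>
  The Stone-Weierstrass theorem gives an approximation \<open>p\<close> on \<open>K\<close>, but without control outside \<open>K\<close>. The
  remedy is to compose \<open>p\<close> with a polynomial \<open>q\<close> that approximates the truncation to \<open>[-M, M]\<close> on the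
  range of \<open>p\<close>: truncation moves \<open>p\<close> no further from \<open>f\<close>, and \<open>q \<circ> p\<close> is again a trigonometric polynomial.
\<close>
lemma trig_poly_approx:
  fixes f :: "'a::euclidean_space \<Rightarrow> real"
  assumes f: "continuous_on UNIV f" "\<And>v. \<bar>f v\<bar> \<le> M" and K: "compact K" and \<epsilon>: "\<epsilon> > 0"
  obtains p where "trig_poly p" "\<And>v. v \<in> K \<Longrightarrow> \<bar>f v - p v\<bar> \<le> \<epsilon>" "\<And>v. \<bar>p v\<bar> \<le> M + \<epsilon>"
proof -
  have "\<exists>p. trig_poly p \<and> (\<forall>v\<in>K. \<bar>f v - p v\<bar> < \<epsilon> / 2)"
    by (rule Stone_Weierstrass_HOL)
       (use K f(1) \<epsilon> in \<open>auto intro: trig_poly_const trig_poly_continuous trig_poly.add trig_poly_mult trig_poly_separates continuous_on_subset\<close>)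
  then obtain p where p: "trig_poly p" "\<And>v. v \<in> K \<Longrightarrow> \<bar>f v - p v\<bar> < \<epsilon> / 2" by blast
  obtain B where B: "\<And>v. \<bar>p v\<bar> \<le> B" using trig_poly_bounded[OF p(1)] by blast
  define clamp where "clamp x = max (- M) (min M x)" for x
  have M: "M \<ge> 0" using f(2)[of 0] by linarith
  have "continuous_on {-B..B} clamp" unfolding clamp_def by (intro continuous_intros)
  moreover have "\<epsilon> / 2 > 0" using \<epsilon> by simp
  ultimately obtain q where q: "real_polynomial_function q" "\<And>x. x \<in> {-B..B} \<Longrightarrow> \<bar>clamp x - q x\<bar> < \<epsilon> / 2"
    using Stone_Weierstrass_real_polynomial_function[of "{-B..B}" clamp "\<epsilon> / 2"] by blast
  have close: "\<bar>clamp (p v) - q (p v)\<bar> < \<epsilon> / 2" for v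
    using q(2)[of "p v"] B[of v] by (simp add: abs_le_iff)
  show ?thesis
  proof (rule that[of "\<lambda>v. q (p v)"])
    show "trig_poly (\<lambda>v. q (p v))" by (rule trig_poly_compose_polynomial[OF q(1) p(1)])
    show "\<bar>f v - q (p v)\<bar> \<le> \<epsilon>" if "v \<in> K" for v
    proof -
      have "\<bar>f v - clamp (p v)\<bar> \<le> \<bar>f v - p v\<bar>" using f(2)[of v] unfolding clamp_def by linarith
      then show ?thesis using p(2)[OF that] close[of v] by linarith
    qed
    show "\<bar>q (p v)\<bar> \<le> M + \<epsilon>" for v
    proof -
      have "\<bar>clamp (p v)\<bar> \<le> M" using M unfolding clamp_def by linarith
      then show ?thesis using close[of v] \<epsilon> by linarith
    qed
  qed
qed

lemma integral_trig_poly_tendsto: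
  assumes F: "\<And>n. borel_prob (F n)" and G: "borel_prob G"
    and conv: "\<And>\<xi>. (\<lambda>n. fourier (F n) \<xi>) \<longlonglongrightarrow> fourier G \<xi>" and p: "trig_poly p"
  shows "(\<lambda>n. \<integral>v. p v \<partial>F n) \<longlonglongrightarrow> (\<integral>v. p v \<partial>G)"
proof -
  have int: "integrable H p" if "borel_prob H" and tp: "trig_poly p" for H :: "'a measure" and p
  proof -
    interpret borel_prob H by fact
    obtain B where "\<And>v. \<bar>p v\<bar> \<le> B" using trig_poly_bounded[OF tp] by blast
    moreover have "p \<in> borel_measurable borel"
      using trig_poly_continuous[OF tp] by (rule borel_measurable_continuous_onI)
    ultimately show ?thesis by (intro integrable_const_bound[of _ B]) auto
  qed
  from p show ?thesis
  proof induction
    case (wave a \<xi> t)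
    have eq: "(\<integral>v. a * cos (v \<bullet> \<xi> + t) \<partial>H) = Re (of_real a * exp (- (\<i> * of_real t)) * fourier H \<xi>)"
      if "borel_prob H" for H
    proof -
      interpret borel_prob H by fact
      have "of_real a * exp (- (\<i> * of_real t)) * fourier H \<xi> = (\<integral>v. of_real a * exp (- (\<i> * of_real t)) * unit_char \<xi> v \<partial>H)"
        by (simp add: fourier_def)
      also have "Re \<dots> = (\<integral>v. Re (of_real a * exp (- (\<i> * of_real t)) * unit_char \<xi> v) \<partial>H)"
        by (subst integral_Re) auto
      also have "\<dots> = (\<integral>v. a * cos (v \<bullet> \<xi> + t) \<partial>H)"
      proof (intro Bochner_Integration.integral_cong refl)
        fix v
        have "exp (- (\<i> * of_real t)) * unit_char \<xi> v = exp (- (\<i> * of_real (v \<bullet> \<xi> + t)))"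
          by (simp add: exp_add[symmetric] algebra_simps)
        moreover have "Re (exp (- (\<i> * of_real x))) = cos x" for x
          by (simp add: Re_exp)
        moreover have "Re (of_real a * c) = a * Re c" for c by simp
        ultimately show "Re (of_real a * exp (- (\<i> * of_real t)) * unit_char \<xi> v) = a * cos (v \<bullet> \<xi> + t)"
          by (simp only: mult.assoc)
      qed
      finally show ?thesis ..
    qed
    show ?case
      unfolding eq[OF F] eq[OF G] by (intro tendsto_intros conv)
  next
    case (add p q)
    have "(\<integral>v. p v + q v \<partial>H) = (\<integral>v. p v \<partial>H) + (\<integral>v. q v \<partial>H)" if "borel_prob H" for H
      using int[OF that] add by simp
    then show ?case using add F G by (simp add: tendsto_add)
  qed
qed

definition uniformly_tight :: "(nat \<Rightarrow> 'a::euclidean_space measure) \<Rightarrow> bool"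
  where "uniformly_tight F \<longleftrightarrow> (\<forall>\<epsilon>>0. \<exists>R. \<forall>n. measure (F n) {v. R < norm v} \<le> \<epsilon>)"

lemma (in borel_prob) tail_small:
  assumes "\<epsilon> > 0"
  shows "\<exists>R\<ge>0. measure F {v. R < norm v} \<le> \<epsilon>"
proof -
  have "(\<lambda>n. measure F {v. real n < norm v}) \<longlonglongrightarrow> measure F (\<Inter>n. {v. real n < norm v})"
    by (intro finite_Lim_measure_decseq) (auto simp: decseq_def)
  moreover have "(\<Inter>n. {v::'a. real n < norm v}) = {}"
  proof -
    have "v \<notin> (\<Inter>n. {v::'a. real n < norm v})" for v
    proof -
      obtain n where "norm v \<le> real n" using real_arch_simple by blast
      then show ?thesis by (auto simp: not_less intro!: exI[of _ n])
    qed
    then show ?thesis by blast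
  qed
  ultimately have "(\<lambda>n. measure F {v. real n < norm v}) \<longlonglongrightarrow> 0" by simp
  from order_tendstoD(2)[OF this assms] obtain n where "measure F {v. real n < norm v} < \<epsilon>"
    by (meson eventually_sequentially order_refl)
  then show ?thesis by (intro exI[of _ "real n"]) auto
qed

text \<open>
  Finitely many measures are always tight together; the sum of their radii dominates each of them.
\<close>
lemma uniformly_tightI_eventually:
  assumes F: "\<And>n. borel_prob (F n)"
    and ev: "\<And>\<epsilon>. \<epsilon> > 0 \<Longrightarrow> \<exists>R N. \<forall>n\<ge>N. measure (F n) {v. R < norm v} \<le> \<epsilon>"
  shows "uniformly_tight F"
  unfolding uniformly_tight_def
proof safe
  fix \<epsilon> :: real assume \<epsilon>: "\<epsilon> > 0"
  obtain R N where RN: "\<And>n. n \<ge> N \<Longrightarrow> measure (F n) {v. R < norm v} \<le> \<epsilon>" using ev[OF \<epsilon>] by blast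
  have "\<exists>r. \<forall>n. r n \<ge> 0 \<and> measure (F n) {v. r n < norm v} \<le> \<epsilon>"
    using borel_prob.tail_small[OF F \<epsilon>] by (intro choice) blast
  then obtain r where r: "\<And>n. r n \<ge> 0" "\<And>n. measure (F n) {v. r n < norm v} \<le> \<epsilon>" by blast
  define S where "S = max R (\<Sum>n<N. r n)"
  have "measure (F n) {v. S < norm v} \<le> \<epsilon>" for n
  proof -
    interpret borel_prob "F n" by (rule F)
    define T where "T = (if n < N then r n else R)"
    have "T \<le> S" using r(1) by (auto simp: T_def S_def intro!: max.coboundedI2 member_le_sum)
    then have "measure (F n) {v. S < norm v} \<le> measure (F n) {v. T < norm v}"
      by (intro finite_measure_mono) auto
    also have "\<dots> \<le> \<epsilon>" using r(2) RN by (simp add: T_def)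
    finally show ?thesis .
  qed
  then show "\<exists>R. \<forall>n. measure (F n) {v. R < norm v} \<le> \<epsilon>" by blast
qed

lemma (in borel_prob) integral_diff_le_bound_plus_tail:
  fixes f g :: "'a \<Rightarrow> real"
  assumes [measurable]: "f \<in> borel_measurable borel" "g \<in> borel_measurable borel"
    and fb: "\<And>v. \<bar>f v\<bar> \<le> A" and gb: "\<And>v. \<bar>g v\<bar> \<le> B" and close: "\<And>v. norm v \<le> R \<Longrightarrow> \<bar>f v - g v\<bar> \<le> \<epsilon>"
    and "\<epsilon> \<ge> 0"
  shows "\<bar>(\<integral>v. f v \<partial>F) - (\<integral>v. g v \<partial>F)\<bar> \<le> \<epsilon> + (A + B) * measure F {v. R < norm v}"
proof -
  have int: "integrable F f" "integrable F g"
    by (rule integrable_const_bound[of _ A], use fb in auto)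
       (rule integrable_const_bound[of _ B], use gb in auto)
  have "\<bar>(\<integral>v. f v \<partial>F) - (\<integral>v. g v \<partial>F)\<bar> = \<bar>\<integral>v. f v - g v \<partial>F\<bar>" using int by simp
  also have "\<dots> \<le> (\<integral>v. \<bar>f v - g v\<bar> \<partial>F)" by (rule integral_abs_bound)
  also have "\<dots> \<le> (\<integral>v. \<epsilon> + (A + B) * indicator {v. R < norm v} v \<partial>F)"
  proof (rule integral_mono)
    show "integrable F (\<lambda>v. \<epsilon> + (A + B) * indicator {v. R < norm v} v)"
      by (auto simp: emeasure_eq_measure)
    show "\<bar>f v - g v\<bar> \<le> \<epsilon> + (A + B) * indicator {v. R < norm v} v" for v
      using fb[of v] gb[of v] close[of v] \<open>\<epsilon> \<ge> 0\<close> by (auto simp: indicator_def not_less)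
  qed (use int in auto)
  also have "\<dots> = \<epsilon> + (A + B) * measure F {v. R < norm v}"
    by (simp add: emeasure_eq_measure)
  finally show ?thesis .
qed

text \<open>
  Both integrals of \<open>f\<close> are close to those of one trigonometric polynomial, inside a large ball by
  uniform approximation and outside by tightness, and the integrals of trigonometric polynomials
  converge because they are linear combinations of values of the characteristic function.
\<close>
theorem weak_convergence_if_fourier_tendsto:
  fixes f :: "'a::euclidean_space \<Rightarrow> real"
  assumes F: "\<And>n. borel_prob (F n)" and G: "borel_prob G" and tight: "uniformly_tight F"
    and conv: "\<And>\<xi>. (\<lambda>n. fourier (F n) \<xi>) \<longlonglongrightarrow> fourier G \<xi>"
    and f: "continuous_on UNIV f" "\<And>v. \<bar>f v\<bar> \<le> M"
  shows "(\<lambda>n. \<integral>v. f v \<partial>F n) \<longlonglongrightarrow> (\<integral>v. f v \<partial>G)"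
proof (rule LIMSEQ_I)
  fix \<epsilon> :: real assume \<epsilon>: "\<epsilon> > 0"
  have M: "M \<ge> 0" using f(2)[of 0] by linarith
  define \<delta> where "\<delta> = min 1 (\<epsilon> / 4)"
  have \<delta>: "\<delta> > 0" "\<delta> \<le> 1" "\<delta> \<le> \<epsilon> / 4" using \<epsilon> by (auto simp: \<delta>_def)
  \<comment> \<open>the approximation errors for the sequence and for the limit add up to \<open>2 (\<delta> + (2 M + 1) t) \<le> 3 \<epsilon> / 4\<close>\<close>
  define t where "t = \<epsilon> / (8 * (2 * M + 1))"
  have t: "t > 0" using \<epsilon> M by (simp add: t_def)
  obtain R1 where R1: "\<And>n. measure (F n) {v. R1 < norm v} \<le> t" using tight t unfolding uniformly_tight_def by blast
  obtain R2 where R2: "measure G {v. R2 < norm v} \<le> t" using borel_prob.tail_small[OF G t] by blast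
  define R where "R = max R1 R2"
  obtain p where p: "trig_poly p" "\<And>v. v \<in> cball 0 R \<Longrightarrow> \<bar>f v - p v\<bar> \<le> \<delta>" "\<And>v. \<bar>p v\<bar> \<le> M + \<delta>"
    using trig_poly_approx[OF f compact_cball \<delta>(1)] by blast
  have fm: "f \<in> borel_measurable borel" using f(1) by (rule borel_measurable_continuous_onI)
  have pm: "p \<in> borel_measurable borel" using trig_poly_continuous[OF p(1)] by (rule borel_measurable_continuous_onI)
  have key: "\<bar>(\<integral>v. f v \<partial>H) - (\<integral>v. p v \<partial>H)\<bar> \<le> 3 / 8 * \<epsilon>"
    if H: "borel_prob H" and tail: "measure H {v. R < norm v} \<le> t" for H
  proof -
    have "\<bar>(\<integral>v. f v \<partial>H) - (\<integral>v. p v \<partial>H)\<bar> \<le> \<delta> + (M + (M + \<delta>)) * measure H {v. R < norm v}"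
      using p(2) \<delta> by (intro borel_prob.integral_diff_le_bound_plus_tail[OF H fm pm f(2) p(3)]) auto
    also have "(M + (M + \<delta>)) * measure H {v. R < norm v} \<le> (2 * M + 1) * t"
      by (rule mult_mono) (use \<delta> M tail in simp_all)
    also have "\<delta> \<le> \<epsilon> / 4" by fact
    also have "\<epsilon> / 4 + (2 * M + 1) * t = 3 / 8 * \<epsilon>" using M by (simp add: t_def field_simps)
    finally show ?thesis by simp
  qed
  have kF: "\<bar>(\<integral>v. f v \<partial>F n) - (\<integral>v. p v \<partial>F n)\<bar> \<le> 3 / 8 * \<epsilon>" for n
  proof (rule key[OF F])
    interpret borel_prob "F n" by (rule F)
    have "measure (F n) {v. R < norm v} \<le> measure (F n) {v. R1 < norm v}"
      by (intro finite_measure_mono) (auto simp: R_def)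
    then show "measure (F n) {v. R < norm v} \<le> t" using R1[of n] by linarith
  qed
  have kG: "\<bar>(\<integral>v. f v \<partial>G) - (\<integral>v. p v \<partial>G)\<bar> \<le> 3 / 8 * \<epsilon>"
  proof (rule key[OF G])
    interpret borel_prob G by (rule G)
    have "measure G {v. R < norm v} \<le> measure G {v. R2 < norm v}"
      by (intro finite_measure_mono) (auto simp: R_def)
    then show "measure G {v. R < norm v} \<le> t" using R2 by linarith
  qed
  obtain N where N: "\<And>n. n \<ge> N \<Longrightarrow> norm ((\<integral>v. p v \<partial>F n) - (\<integral>v. p v \<partial>G)) < \<epsilon> / 4"
    using LIMSEQ_D[OF integral_trig_poly_tendsto[OF F G conv p(1)], of "\<epsilon> / 4"] \<epsilon> by auto
  show "\<exists>N. \<forall>n\<ge>N. norm ((\<integral>v. f v \<partial>F n) - (\<integral>v. f v \<partial>G)) < \<epsilon>"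
  proof (intro exI[of _ N] allI impI)
    fix n assume "n \<ge> N"
    then show "norm ((\<integral>v. f v \<partial>F n) - (\<integral>v. f v \<partial>G)) < \<epsilon>"
      using N[of n] kF[of n] kG \<epsilon> unfolding real_norm_def by linarith
  qed
qed

text \<open>
  A constant sequence is tight, so weak convergence shows that \<open>F\<close> and \<open>G\<close> integrate bounded continuous
  functions alike. Indicators of closed sets are decreasing limits of such functions.
\<close>
theorem fourier_inj:
  assumes F: "borel_prob F" and G: "borel_prob G" and eq: "fourier F = fourier G"
  shows "F = G"
proof -
  interpret F: borel_prob F by fact
  interpret G: borel_prob G by fact
  have *: "(\<integral>v. f v \<partial>F) = (\<integral>v. f v \<partial>G)" if "continuous_on UNIV f" "\<And>v. \<bar>f v\<bar> \<le> 1" for f :: "'a \<Rightarrow> real"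
  proof -
    have "uniformly_tight (\<lambda>_. F)" using F.tail_small unfolding uniformly_tight_def by blast
    then have "(\<lambda>n::nat. \<integral>v. f v \<partial>F) \<longlonglongrightarrow> (\<integral>v. f v \<partial>G)"
      using that F G eq by (intro weak_convergence_if_fourier_tendsto[where M=1]) auto
    then show ?thesis by (simp add: LIMSEQ_const_iff)
  qed
  have closed: "emeasure F C = emeasure G C" if C: "closed C" for C
  proof (cases "C = {}")
    case False
    \<comment> \<open>continuous functions that decrease to the indicator of \<open>C\<close>\<close>
  define g where "g n v = max 0 (1 - real n * infdist v C)" for n and v :: 'a
    have cont: "continuous_on UNIV (g n)" for n unfolding g_def by (intro continuous_intros)
    have gb: "\<bar>g n v\<bar> \<le> 1" for n v using infdist_nonneg[of v C] by (auto simp: g_def)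
    have lim: "(\<lambda>n. g n v) \<longlonglongrightarrow> indicator C v" for v
    proof (cases "v \<in> C")
      case True
      then show ?thesis using C False by (simp add: g_def)
    next
      case nC: False
      then have pos: "infdist v C > 0"
        using in_closed_iff_infdist_zero[OF C False] infdist_nonneg[of v C] by (auto simp: less_le)
      obtain N where N: "1 / infdist v C \<le> real N" using real_arch_simple by blast
      have "g n v = 0" if "n \<ge> N" for n
      proof -
        have "1 / infdist v C \<le> real n" using N that by linarith
        then show ?thesis using pos by (simp add: g_def divide_le_eq)
      qed
      then have "eventually (\<lambda>n. g n v = 0) sequentially" by (auto simp: eventually_sequentially)
      then show ?thesis using nC by (simp add: tendsto_eventually)
    qed
    have conv: "(\<lambda>n. \<integral>v. g n v \<partial>H) \<longlonglongrightarrow> measure H C" if "borel_prob H" for H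
    proof -
      interpret borel_prob H by fact
      have [measurable]: "g n \<in> borel_measurable borel" for n using cont by (rule borel_measurable_continuous_onI)
      have [measurable]: "C \<in> sets borel" using C by simp
      have "(\<lambda>n. \<integral>v. g n v \<partial>H) \<longlonglongrightarrow> (\<integral>v. indicator C v \<partial>H)"
        by (rule integral_dominated_convergence[where w="\<lambda>_. 1"]) (use gb lim in auto)
      then show ?thesis by simp
    qed
    have "measure F C = measure G C"
      using conv[OF F] conv[OF G] *[OF cont gb] by (simp add: LIMSEQ_unique)
    then show ?thesis by (simp add: F.emeasure_eq_measure G.emeasure_eq_measure)
  qed simp
  show ?thesis
  proof (rule measure_eqI_generator_eq[where E="{C. closed C}" and \<Omega>=UNIV and A="\<lambda>_. UNIV"])
    show "Int_stable {C::'a set. closed C}" by (auto simp: Int_stable_def)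
  qed (auto simp: closed borel_eq_closed)
qed

lemma fourier_inv_fourier:
  assumes "borel_prob F"
  shows "fourier_inv (fourier F) = F"
  unfolding fourier_inv_def
  using assms fourier_inj by (intro the_equality) (auto simp: P_space_0_iff_borel_prob)

section \<open>A space-filling curve and compactness of tight sequences\<close>

text \<open>
  The 2-periodic zigzag with \<open>triangle_wave u = u\<close> on \<open>[0, 1]\<close> and \<open>triangle_wave u = 2 - u\<close> on \<open>[1, 2]\<close>.
\<close>
definition triangle_wave :: "real \<Rightarrow> real" where "triangle_wave t = arccos (cos (pi * t)) / pi"

lemma continuous_triangle_wave: "continuous_on S triangle_wave"
  unfolding triangle_wave_def by (intro continuous_intros) auto

lemma triangle_wave_even_shift:
  assumes "0 \<le> u" "u \<le> 1"
  shows "triangle_wave (2 * real_of_int k + u) = u"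
proof -
  have "cos (pi * (2 * real_of_int k + u)) = cos (2 * pi * real_of_int k + pi * u)" by (simp add: algebra_simps)
  also have "\<dots> = cos (pi * u)" by (simp only: cos_add cos_int_2pin sin_int_2pin)
  finally show ?thesis using assms by (simp add: triangle_wave_def arccos_cos)
qed

text \<open>
  The function of Schoenberg's space-filling curve: even and 2-periodic, equal to 0 on \<open>[0, 1/3]\<close> and to
  1 on \<open>[2/3, 1]\<close>. Applied to \<open>3\<^sup>M t\<close> for \<open>t\<close> in the Cantor set, it reads off half the ternary digit of \<open>t\<close> with index \<open>M\<close>.
\<close>
definition schoenberg_digit :: "real \<Rightarrow> real"
  where "schoenberg_digit t = max 0 (min 1 (3 * triangle_wave t - 1))"

text \<open>
  The point of the Cantor set whose ternary digits are \<open>2 a(M), 2 a(M+1), \<dots>\<close>.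
\<close>
definition cantor_sum :: "(nat \<Rightarrow> bool) \<Rightarrow> nat \<Rightarrow> real"
  where "cantor_sum a M = (\<Sum>m. 2 * of_bool (a (M + m)) / 3 ^ Suc m)"

lemma
  shows cantor_sum_bounds: "0 \<le> cantor_sum a M" "cantor_sum a M \<le> 1"
    and cantor_sum_rec: "3 * cantor_sum a M = 2 * of_bool (a M) + cantor_sum a (Suc M)"
proof -
  have geo: "(\<lambda>m. 2 / 3 ^ Suc m :: real) sums 1"
    using sums_mult[OF geometric_sums[of "1/3 :: real"], of "2/3"] by (simp add: power_divide)
  have s: "summable (\<lambda>m. 2 * of_bool (a (M + m)) / 3 ^ Suc m :: real)" for M
    by (rule summable_comparison_test'[OF sums_summable[OF geo], of 0]) (auto simp: of_bool_def)
  show "0 \<le> cantor_sum a M" unfolding cantor_sum_def by (intro suminf_nonneg s) auto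
  have "cantor_sum a M \<le> (\<Sum>m. 2 / 3 ^ Suc m)"
    unfolding cantor_sum_def by (intro suminf_le s sums_summable[OF geo]) (auto simp: of_bool_def divide_right_mono)
  then show "cantor_sum a M \<le> 1" using sums_unique[OF geo] by simp
  have "cantor_sum a M = 2 * of_bool (a M) / 3 + (\<Sum>m. 2 * of_bool (a (M + Suc m)) / 3 ^ Suc (Suc m))"
    unfolding cantor_sum_def using suminf_split_head[OF s[of M]] by simp
  also have "(\<Sum>m. 2 * of_bool (a (M + Suc m)) / 3 ^ Suc (Suc m)) = (\<Sum>m. (2 * of_bool (a (Suc M + m)) / 3 ^ Suc m) / 3 :: real)"
    by (simp add: mult.commute)
  also have "\<dots> = cantor_sum a (Suc M) / 3"
    unfolding cantor_sum_def by (rule suminf_divide[OF s])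
  finally show "3 * cantor_sum a M = 2 * of_bool (a M) + cantor_sum a (Suc M)" by simp
qed

text \<open>
  Multiplication by \<open>3\<^sup>M\<close> shifts the ternary point. The digits to its left contribute an even integer,
  which a 2-periodic function does not see.
\<close>
lemma cantor_sum_shift: "\<exists>k::int. 3 ^ M * cantor_sum a 0 = 2 * real_of_int k + cantor_sum a M"
proof (induction M)
  case (Suc M)
  then obtain k :: int where k: "3 ^ M * cantor_sum a 0 = 2 * real_of_int k + cantor_sum a M" by blast
  have "3 ^ Suc M * cantor_sum a 0 = 2 * real_of_int (3 * k + of_bool (a M)) + cantor_sum a (Suc M)"
    using k cantor_sum_rec[of a M] by (simp add: algebra_simps)
  then show ?case by blast
qed (auto intro: exI[of _ 0])

lemma schoenberg_digit_cantor_sum: "schoenberg_digit (3 ^ M * cantor_sum a 0) = of_bool (a M)"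
proof -
  obtain k :: int where k: "3 ^ M * cantor_sum a 0 = 2 * real_of_int k + cantor_sum a M"
    using cantor_sum_shift by blast
  have "triangle_wave (3 ^ M * cantor_sum a 0) = cantor_sum a M"
    unfolding k by (intro triangle_wave_even_shift cantor_sum_bounds)
  then show ?thesis
    using cantor_sum_rec[of a M] cantor_sum_bounds[of a "Suc M"]
    by (cases "a M") (auto simp: schoenberg_digit_def)
qed

lemma binary_expansion:
  fixes x :: real
  assumes "0 \<le> x" "x < 1"
  shows "\<exists>c. (\<lambda>k. of_bool (c k) / 2 ^ Suc k) sums x"
proof -
  \<comment> \<open>the orbit of \<open>x\<close> under doubling modulo 1; the digit is 1 when the orbit is in the upper half\<close>
  define y where "y n = frac (2 ^ n * x)" for n
  define c where "c n = (1/2 \<le> y n)" for n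
  have rec: "2 * y n = of_bool (c n) + y (Suc n)" for n
  proof -
    have "y (Suc n) = 2 * y n - of_bool (c n)"
      unfolding y_def[of "Suc n"]
    proof (subst frac_unique_iff, safe)
      have "2 ^ Suc n * x - (2 * y n - of_bool (c n)) = of_int (2 * \<lfloor>2 ^ n * x\<rfloor> + of_bool (c n))"
        by (simp add: y_def frac_def)
      then show "2 ^ Suc n * x - (2 * y n - of_bool (c n)) \<in> \<int>" by (metis Ints_of_int)
      show "0 \<le> 2 * y n - of_bool (c n)" using frac_ge_0[of "2 ^ n * x"] by (simp add: c_def y_def)
      show "2 * y n - of_bool (c n) < 1" using frac_lt_1[of "2 ^ n * x"] by (simp add: c_def y_def)
    qed
    then show ?thesis by simp
  qed
  have part: "(\<Sum>k<n. of_bool (c k) / 2 ^ Suc k) = x - y n / 2 ^ n" for n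
  proof (induction n)
    case 0
    then show ?case using assms by (simp add: y_def frac_eq)
  next
    case (Suc n)
    have "y n / 2 ^ n = (2 * y n) / 2 ^ Suc n" by simp
    also have "\<dots> = of_bool (c n) / 2 ^ Suc n + y (Suc n) / 2 ^ Suc n"
      by (simp only: rec add_divide_distrib)
    finally show ?case by (simp only: sum.lessThan_Suc Suc.IH)
  qed
  have "(\<lambda>n. y n / 2 ^ n) \<longlonglongrightarrow> 0"
  proof (rule tendsto_sandwich[OF always_eventually always_eventually tendsto_const])
    show "\<forall>n. 0 \<le> y n / 2 ^ n" by (simp add: y_def)
    have "y n \<le> 1" for n using frac_lt_1[of "2 ^ n * x"] by (simp add: y_def)
    then show "\<forall>n. y n / 2 ^ n \<le> (1/2) ^ n"
      by (auto simp: power_divide divide_right_mono)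
    show "(\<lambda>n. (1/2 :: real) ^ n) \<longlonglongrightarrow> 0" by (rule LIMSEQ_realpow_zero) auto
  qed
  then have "(\<lambda>n. x - y n / 2 ^ n) \<longlonglongrightarrow> x - 0" by (intro tendsto_intros)
  then show ?thesis by (intro exI[of _ c]) (simp only: sums_def part diff_0_right)
qed

text \<open>
  Schoenberg's construction: the coordinate with index \<open>j\<close> reads the ternary digits of \<open>t\<close> whose indices are
  congruent to \<open>j\<close> modulo \<open>d\<close> and uses them as binary digits. Any \<open>d\<close> binary expansions can be
  interleaved into one Cantor point, so the curve covers a half-open unit cube, which is centred at the origin here.
\<close>
lemma space_filling_curve:
  "\<exists>s :: real \<Rightarrow> 'a::euclidean_space. continuous_on UNIV s \<and> (\<forall>x. norm x \<le> 1/4 \<longrightarrow> (\<exists>t\<in>{0..1}. s t = x))"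
proof -
  define N where "N = DIM('a)"
  have N: "N > 0" by (simp add: N_def)
  obtain h :: "'a \<Rightarrow> nat" where h: "bij_betw h Basis {0..<N}"
    using ex_bij_betw_finite_nat[OF finite_Basis] unfolding N_def by blast
  define coord where "coord j t = (\<Sum>k. schoenberg_digit (3 ^ (N * k + j) * t) / 2 ^ Suc k)" for j t
  have cd: "continuous_on UNIV (\<lambda>t. schoenberg_digit (c * t))" for c
    unfolding schoenberg_digit_def
    by (intro continuous_intros continuous_on_compose2[OF continuous_triangle_wave[of UNIV]]) auto
  have cont: "continuous_on UNIV (coord j)" for j
  proof (rule uniform_limit_theorem)
    show "uniform_limit UNIV (\<lambda>n t. \<Sum>k<n. schoenberg_digit (3 ^ (N * k + j) * t) / 2 ^ Suc k) (coord j) sequentially"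
      unfolding coord_def
    proof (rule Weierstrass_m_test)
      show "norm (schoenberg_digit (3 ^ (N * n + j) * t) / 2 ^ Suc n) \<le> (1/2) ^ n" for n t
        by (simp add: schoenberg_digit_def power_divide divide_le_eq)
      show "summable (\<lambda>n. (1/2 :: real) ^ n)" by (rule summable_geometric) simp
    qed
    show "\<forall>\<^sub>F n in sequentially. continuous_on UNIV (\<lambda>t. \<Sum>k<n. schoenberg_digit (3 ^ (N * k + j) * t) / 2 ^ Suc k)"
      by (intro always_eventually allI continuous_intros cd) auto
  qed simp
  define s where "s t = (\<Sum>b\<in>Basis. (coord (h b) t - 1/2) *\<^sub>R b)" for t
  have "continuous_on UNIV s" unfolding s_def by (intro continuous_intros cont)
  moreover have "\<exists>t\<in>{0..1}. s t = x" if x: "norm x \<le> 1/4" for x :: 'a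
  proof -
    have "\<exists>c. (\<lambda>k. of_bool (c k) / 2 ^ Suc k) sums (x \<bullet> b + 1/2)" if "b \<in> Basis" for b
      using Basis_le_norm[OF that, of x] x by (intro binary_expansion) auto
    then obtain c where c: "\<And>b. b \<in> Basis \<Longrightarrow> (\<lambda>k. of_bool (c b k) / 2 ^ Suc k) sums (x \<bullet> b + 1/2)" by metis
    \<comment> \<open>the digit sequences of the \<open>d\<close> coordinates, interleaved\<close>
    define a where "a m = c (inv_into Basis h (m mod N)) (m div N)" for m
    have a: "a (N * k + h b) = c b k" if "b \<in> Basis" for b k
    proof -
      have "h b < N" using bij_betwE[OF h] that by auto
      then show ?thesis using bij_betw_inv_into_left[OF h that] N by (simp add: a_def)
    qed
    have "coord (h b) (cantor_sum a 0) = x \<bullet> b + 1/2" if "b \<in> Basis" for b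
      unfolding coord_def schoenberg_digit_cantor_sum a[OF that] by (rule sums_unique[OF c[OF that], symmetric])
    then have "s (cantor_sum a 0) = (\<Sum>b\<in>Basis. (x \<bullet> b) *\<^sub>R b)" by (simp add: s_def)
    then show ?thesis
      using cantor_sum_bounds[of a 0] by (intro bexI[of _ "cantor_sum a 0"]) (auto simp: euclidean_representation)
  qed
  ultimately show ?thesis by blast
qed

text \<open>
  To cover the whole space, the curve is traversed on each interval \<open>[2k, 2k+1]\<close> with magnification \<open>k\<close>. The
  magnification \<open>(t - triangle_wave t) / 2\<close> is constant there and interpolates linearly in between.
\<close>
lemma space_filling_curve_proper:
  "\<exists>s :: real \<Rightarrow> 'a::euclidean_space. continuous_on UNIV s \<and> (\<forall>L. \<exists>T. \<forall>x. norm x \<le> L \<longrightarrow> (\<exists>t\<in>{0..T}. s t = x))"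
proof -
  obtain s0 :: "real \<Rightarrow> 'a" where s0: "continuous_on UNIV s0" "\<And>x. norm x \<le> 1/4 \<Longrightarrow> \<exists>t\<in>{0..1}. s0 t = x"
    using space_filling_curve by blast
  define s where "s t = ((t - triangle_wave t) / 2) *\<^sub>R s0 (triangle_wave t)" for t
  have "continuous_on UNIV s"
    unfolding s_def by (intro continuous_intros continuous_triangle_wave continuous_on_compose2[OF s0(1)]) auto
  moreover have "\<exists>T. \<forall>x. norm x \<le> L \<longrightarrow> (\<exists>t\<in>{0..T}. s t = x)" for L
  proof (intro exI allI impI)
    fix x :: 'a assume x: "norm x \<le> L"
    define k where "k = \<lceil>4 * \<bar>L\<bar>\<rceil> + 1"
    have k: "real_of_int k \<ge> 4 * \<bar>L\<bar>" "real_of_int k \<ge> 1" unfolding k_def by linarith+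
    have "norm ((1 / real_of_int k) *\<^sub>R x) \<le> 1/4" using k x by (simp add: field_simps)
    then obtain u where u: "u \<in> {0..1}" "s0 u = (1 / real_of_int k) *\<^sub>R x" using s0(2) by blast
    have "s (2 * real_of_int k + u) = x"
      unfolding s_def using u k by (simp add: triangle_wave_even_shift)
    moreover have "2 * real_of_int k + u \<in> {0..2 * real_of_int k + 1}" using u k by auto
    ultimately show "\<exists>t\<in>{0..2 * real_of_int (\<lceil>4 * \<bar>L\<bar>\<rceil> + 1) + 1}. s t = x" unfolding k_def by blast
  qed
  ultimately show ?thesis by blast
qed

text \<open>
  Let \<open>r x\<close> be the first nonnegative time at which the curve \<open>s\<close> visits \<open>x\<close>. The sublevel sets of \<open>r\<close> are the
  compact sets \<open>s ` {0..T}\<close>, so \<open>r\<close> is a Borel section of \<open>s\<close>. The images of the measures under \<open>r\<close> are tight,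
  because bounded sets are covered in bounded time. Helly's theorem yields a
  weak limit on the line, and its image under \<open>s\<close> is the limit in \<open>\<real>\<^sup>d\<close>: as \<open>f = (f \<circ> s) \<circ> r\<close>, the function to be
  integrated on the line is \<open>f \<circ> s\<close>, which is continuous although \<open>r\<close> may jump.
\<close>
theorem tight_imp_weakly_convergent_subsequence:
  fixes F :: "nat \<Rightarrow> 'a::euclidean_space measure"
  assumes F: "\<And>n. borel_prob (F n)" and tight: "uniformly_tight F"
  shows "\<exists>\<rho> G. strict_mono \<rho> \<and> borel_prob G \<and>
    (\<forall>(f :: 'a \<Rightarrow> complex) B. continuous_on UNIV f \<longrightarrow> (\<forall>v. cmod (f v) \<le> B) \<longrightarrow>
       (\<lambda>n. \<integral>v. f v \<partial>F (\<rho> n)) \<longlonglongrightarrow> (\<integral>v. f v \<partial>G))"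
proof -
  obtain s :: "real \<Rightarrow> 'a" where s: "continuous_on UNIV s"
    and cover: "\<And>L. \<exists>T. \<forall>x. norm x \<le> L \<longrightarrow> (\<exists>t\<in>{0..T}. s t = x)"
    using space_filling_curve_proper by blast
  have [measurable]: "s \<in> borel_measurable borel" using s by (rule borel_measurable_continuous_onI)
  define r where "r x = Inf {t. 0 \<le> t \<and> s t = x}" for x
  have bdd: "bdd_below {t. 0 \<le> t \<and> s t = x}" for x by (intro bdd_belowI[of _ 0]) auto
  have ne: "{t. 0 \<le> t \<and> s t = x} \<noteq> {}" for x using cover[of "norm x"] by force
  have "closed {t. 0 \<le> t \<and> s t = x}" for x
    by (intro closed_Collect_conj closed_Collect_le closed_Collect_eq s continuous_intros)
  then have r_in: "r x \<in> {t. 0 \<le> t \<and> s t = x}" for x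
    unfolding r_def by (intro closed_contains_Inf ne bdd)
  then have r: "0 \<le> r x" "s (r x) = x" for x by auto
  have r_le: "r x \<le> T" if "t \<in> {0..T}" "s t = x" for x t T
  proof -
    have "r x \<le> t" unfolding r_def using that by (intro cInf_lower bdd) auto
    then show ?thesis using that by auto
  qed
  have [measurable]: "r \<in> borel_measurable borel"
  proof (rule borel_measurable_iff_le[THEN iffD2], intro allI)
    fix T
    have "{x. r x \<le> T} = s ` {0..T}"
    proof (intro equalityI subsetI)
      fix x assume "x \<in> {x. r x \<le> T}"
      then have "r x \<in> {0..T}" using r(1)[of x] by simp
      then show "x \<in> s ` {0..T}" by (intro image_eqI[where x="r x"]) (simp_all only: r(2))
    next
      fix x assume "x \<in> s ` {0..T}"
      then obtain t where "t \<in> {0..T}" "s t = x" by blast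
      then have "r x \<le> T" by (rule r_le)
      then show "x \<in> {x. r x \<le> T}" by simp
    qed
    moreover have "compact (s ` {0..T})"
      by (intro compact_continuous_image continuous_on_subset[OF s]) auto
    ultimately show "{x \<in> space borel. r x \<le> T} \<in> sets borel"
      by (simp add: borel_compact)
  qed
  define \<mu> where "\<mu> n = distr (F n) borel r" for n
  have \<mu>: "real_distribution (\<mu> n)" for n
  proof -
    interpret borel_prob "F n" by (rule F)
    show ?thesis unfolding \<mu>_def by (intro real_distribution_distr) simp
  qed
  have "tight \<mu>"
    unfolding tight_def
  proof (intro conjI allI impI \<mu>)
    fix \<epsilon> :: real assume \<epsilon>: "\<epsilon> > 0"
    then obtain R where R: "\<And>n. measure (F n) {v. R < norm v} \<le> \<epsilon> / 2"
      using tight unfolding uniformly_tight_def by (meson half_gt_zero)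
    obtain T where T: "\<And>x. norm x \<le> R \<Longrightarrow> \<exists>t\<in>{0..T}. s t = x" using cover by blast
    have "measure (\<mu> n) {-1<..max T 0} > 1 - \<epsilon>" for n
    proof -
      interpret borel_prob "F n" by (rule F)
      have "1 - measure (F n) {v. R < norm v} = measure (F n) (space (F n) - {v. R < norm v})"
        by (rule prob_compl[symmetric]) simp
      also have "\<dots> \<le> measure (F n) (r -` {-1<..max T 0} \<inter> space (F n))"
      proof (intro finite_measure_mono subsetI)
        fix x assume "x \<in> space (F n) - {v. R < norm v}"
        then have "norm x \<le> R" by auto
        then obtain t where "t \<in> {0..T}" "s t = x" using T by blast
        then have "r x \<le> T" by (rule r_le)
        then show "x \<in> r -` {-1<..max T 0} \<inter> space (F n)" using r(1)[of x] by auto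
      qed measurable
      also have "\<dots> = measure (\<mu> n) {-1<..max T 0}" unfolding \<mu>_def by (subst measure_distr) auto
      finally show ?thesis using R[of n] \<epsilon> by linarith
    qed
    then show "\<exists>a b. a < b \<and> (\<forall>n. 1 - \<epsilon> < measure (\<mu> n) {a<..b})"
      by (intro exI[of _ "-1"] exI[of _ "max T 0"]) auto
  qed
  then obtain \<rho> M where \<rho>: "strict_mono (\<rho> :: nat \<Rightarrow> nat)" and M: "real_distribution M" and conv: "weak_conv_m (\<mu> \<circ> id \<circ> \<rho>) M"
    using tight_imp_convergent_subsubsequence[OF _ strict_mono_id] by blast
  interpret M: real_distribution M by fact
  define G where "G = distr M borel s"
  have G: "borel_prob G"
    unfolding G_def borel_prob_def borel_prob_axioms_def by (auto intro!: M.prob_space_distr)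
  show ?thesis
  proof (intro exI conjI allI impI, rule \<rho>, rule G)
    fix f :: "'a \<Rightarrow> complex" and B
    assume f: "continuous_on UNIV f" "\<forall>v. cmod (f v) \<le> B"
    have [measurable]: "f \<in> borel_measurable borel" using f(1) by (rule borel_measurable_continuous_onI)
    have "continuous_on UNIV (\<lambda>t. f (s t))"
      by (rule continuous_on_compose2[OF f(1) s]) auto
    then have "(\<lambda>n. \<integral>t. f (s t) \<partial>(\<mu> \<circ> id \<circ> \<rho>) n) \<longlonglongrightarrow> (\<integral>t. f (s t) \<partial>M)"
      using \<mu> M f(2) by (intro weak_conv_imp_integral_bdd_continuous_conv[OF _ _ conv]) (auto simp: continuous_on_eq_continuous_at)
    moreover have "(\<integral>t. f (s t) \<partial>(\<mu> \<circ> id \<circ> \<rho>) n) = (\<integral>v. f v \<partial>F (\<rho> n))" for n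
    proof -
      interpret borel_prob "F (\<rho> n)" by (rule F)
      show ?thesis by (simp add: \<mu>_def integral_distr r(2))
    qed
    moreover have "(\<integral>t. f (s t) \<partial>M) = (\<integral>v. f v \<partial>G)" unfolding G_def by (simp add: integral_distr)
    ultimately show "(\<lambda>n. \<integral>v. f v \<partial>F (\<rho> n)) \<longlonglongrightarrow> (\<integral>v. f v \<partial>G)" by simp
  qed
qed

text \<open>
  The existence part of the continuity theorem: a weak limit point of the measures has characteristic
  function \<open>\<phi>\<close>, because \<open>v \<mapsto> exp (- \<i> (v \<bullet> \<xi>))\<close> is bounded and continuous.
\<close>
theorem char_fun_limit:
  fixes \<phi> :: "'a::euclidean_space \<Rightarrow> complex"
  assumes F: "\<And>n. borel_prob (F n)" and tight: "uniformly_tight F"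
    and conv: "\<And>\<xi>. (\<lambda>n. fourier (F n) \<xi>) \<longlonglongrightarrow> \<phi> \<xi>"
  shows "\<phi> \<in> char_funs"
proof -
  obtain \<rho> G where \<rho>: "strict_mono \<rho>" and G: "borel_prob G"
    and lim: "\<forall>(f :: 'a \<Rightarrow> complex) B. continuous_on UNIV f \<longrightarrow> (\<forall>v. cmod (f v) \<le> B) \<longrightarrow>
       (\<lambda>n. \<integral>v. f v \<partial>F (\<rho> n)) \<longlonglongrightarrow> (\<integral>v. f v \<partial>G)"
    using tight_imp_weakly_convergent_subsequence[OF F tight] by (elim exE conjE)
  have "\<phi> \<xi> = fourier G \<xi>" for \<xi>
  proof (rule LIMSEQ_unique)
    show "(\<lambda>n. fourier (F (\<rho> n)) \<xi>) \<longlonglongrightarrow> \<phi> \<xi>"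
      using LIMSEQ_subseq_LIMSEQ[OF conv \<rho>] by (simp add: comp_def)
    show "(\<lambda>n. fourier (F (\<rho> n)) \<xi>) \<longlonglongrightarrow> fourier G \<xi>"
      unfolding fourier_def by (rule lim[rule_format, where B=1]) (auto intro!: continuous_intros)
  qed
  then have "\<phi> = fourier G" by (rule ext)
  then show ?thesis using G unfolding char_funs_def by (simp add: P_space_0_iff_borel_prob)
qed

section \<open>The metric\<close>

lemma dist_K_commute: "dist_K \<alpha> \<phi> \<psi> = dist_K \<alpha> \<psi> \<phi>"
  by (simp add: dist_K_def norm_minus_commute)

lemma dist_M_commute: "dist_M \<alpha> \<phi> \<psi> = dist_M \<alpha> \<psi> \<phi>"
  by (simp add: dist_M_def norm_minus_commute)

lemma dis_commute: "dis \<alpha> \<beta> \<phi> \<psi> = dis \<alpha> \<beta> \<psi> \<phi>"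
  by (simp add: dis_def dist_K_commute dist_M_commute)

lemma ennreal_cmod_triangle_divide:
  assumes "w \<ge> 0"
  shows "ennreal (cmod (a - c) / w) \<le> ennreal (cmod (a - b) / w) + ennreal (cmod (b - c) / w)"
proof -
  have "cmod (a - c) / w \<le> (cmod (a - b) + cmod (b - c)) / w"
    using assms norm_triangle_ineq[of "a - b" "b - c"] by (intro divide_right_mono) auto
  then have "ennreal (cmod (a - c) / w) \<le> ennreal (cmod (a - b) / w + cmod (b - c) / w)"
    by (simp add: add_divide_distrib ennreal_leI)
  then show ?thesis using assms by (simp add: ennreal_plus)
qed

lemma dist_K_triangle: "dist_K \<alpha> \<phi> \<theta> \<le> dist_K \<alpha> \<phi> \<psi> + dist_K \<alpha> \<psi> \<theta>"
proof -
  have "ennreal (cmod (\<phi> \<xi> - \<theta> \<xi>) / norm \<xi> powr \<alpha>) \<le> dist_K \<alpha> \<phi> \<psi> + dist_K \<alpha> \<psi> \<theta>" if "\<xi> \<noteq> 0" for \<xi>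
  proof (rule order_trans[OF ennreal_cmod_triangle_divide[of _ _ _ "\<psi> \<xi>"]])
    show "ennreal (cmod (\<phi> \<xi> - \<psi> \<xi>) / norm \<xi> powr \<alpha>) + ennreal (cmod (\<psi> \<xi> - \<theta> \<xi>) / norm \<xi> powr \<alpha>)
      \<le> dist_K \<alpha> \<phi> \<psi> + dist_K \<alpha> \<psi> \<theta>"
      unfolding dist_K_def using that by (intro add_mono SUP_upper) auto
  qed simp
  then show ?thesis unfolding dist_K_def[of \<alpha> \<phi> \<theta>] by (intro SUP_least) auto
qed

lemma dist_M_triangle:
  assumes [measurable]: "\<phi> \<in> borel_measurable borel" "\<psi> \<in> borel_measurable borel" "\<theta> \<in> borel_measurable borel"
  shows "dist_M \<alpha> \<phi> \<theta> \<le> dist_M \<alpha> \<phi> \<psi> + dist_M \<alpha> \<psi> \<theta>"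
  unfolding dist_M_def
  by (subst nn_integral_add[symmetric]) (auto intro!: nn_integral_mono ennreal_cmod_triangle_divide)

lemma dis_triangle:
  assumes "\<phi> \<in> char_funs" "\<psi> \<in> char_funs" "\<theta> \<in> char_funs"
  shows "dis \<alpha> \<beta> \<phi> \<theta> \<le> dis \<alpha> \<beta> \<phi> \<psi> + dis \<alpha> \<beta> \<psi> \<theta>"
  using add_mono[OF dist_M_triangle[of \<phi> \<psi> \<theta> \<alpha>] dist_K_triangle[of \<beta> \<phi> \<theta> \<psi>]]
    char_fun_props(3)[OF assms(1)] char_fun_props(3)[OF assms(2)] char_fun_props(3)[OF assms(3)]
  by (simp add: dis_def ac_simps)

text \<open>
  Near the origin a smaller exponent is a weaker condition, and away from it every bounded
  function satisfies the condition with any exponent \<open>\<beta> \<ge> 0\<close>.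
\<close>
lemma K_space_antimono:
  assumes "0 \<le> \<beta>" "\<beta> \<le> \<alpha>"
  shows "K_space \<alpha> \<subseteq> (K_space \<beta> :: ('a::euclidean_space \<Rightarrow> complex) set)"
proof
  fix \<phi> :: "'a \<Rightarrow> complex" assume K: "\<phi> \<in> K_space \<alpha>"
  then have \<phi>: "\<phi> \<in> char_funs" and fin: "dist_K \<alpha> \<phi> (\<lambda>_. 1) < \<infinity>" by (auto simp: K_space_def)
  define C where "C = max 2 (enn2real (dist_K \<alpha> \<phi> (\<lambda>_. 1)))"
  have "dist_K \<beta> \<phi> (\<lambda>_. 1) \<le> ennreal C"
  proof (rule dist_K_leI)
    fix \<xi> :: 'a assume nz: "\<xi> \<noteq> 0"
    show "cmod (\<phi> \<xi> - 1) \<le> C * norm \<xi> powr \<beta>"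
    proof (cases "norm \<xi> \<le> 1")
      case True
      have "cmod (\<phi> \<xi> - 1) \<le> enn2real (dist_K \<alpha> \<phi> (\<lambda>_. 1)) * norm \<xi> powr \<alpha>"
        by (rule cmod_diff_le_dist_K[OF fin nz])
      also have "\<dots> \<le> C * norm \<xi> powr \<beta>"
        using True nz assms by (intro mult_mono powr_mono') (auto simp: C_def)
      finally show ?thesis .
    next
      case False
      have "cmod (\<phi> \<xi> - 1) \<le> 2 * 1" using char_fun_diff_le_2[OF \<phi> const_1_char_fun, of \<xi>] by simp
      also have "\<dots> \<le> C * norm \<xi> powr \<beta>"
        using False assms by (intro mult_mono ge_one_powr_ge_zero) (auto simp: C_def)
      finally show ?thesis .
    qed
  qed
  also have "\<dots> < \<infinity>" by simp
  finally show "\<phi> \<in> K_space \<beta>" using \<phi> by (simp add: K_space_def)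
qed

lemma M_space_subset_K_space:
  assumes "0 < \<beta>" "\<beta> \<le> \<alpha>" "\<alpha> < 2"
  shows "M_space \<alpha> \<subseteq> K_space \<beta>"
  using M_space_subset_fourier_P_space[of \<alpha>] fourier_P_space_subset_K_space[of \<alpha>] K_space_antimono[of \<beta> \<alpha>] assms
  by fastforce

lemma dis_finite:
  assumes \<alpha>\<beta>: "0 < \<beta>" "\<beta> \<le> \<alpha>" "\<alpha> < 2" and \<phi>: "\<phi> \<in> M_space \<alpha>" and \<psi>: "\<psi> \<in> M_space \<alpha>"
  shows "dis \<alpha> \<beta> \<phi> \<psi> < \<infinity>"
proof -
  have fin: "dis \<alpha> \<beta> \<theta> (\<lambda>_. 1) < \<infinity>" if "\<theta> \<in> M_space \<alpha>" for \<theta>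
    using that M_space_subset_K_space[OF \<alpha>\<beta>] by (auto simp: dis_def M_space_def K_space_def)
  have "dis \<alpha> \<beta> \<phi> \<psi> \<le> dis \<alpha> \<beta> \<phi> (\<lambda>_. 1) + dis \<alpha> \<beta> (\<lambda>_. 1) \<psi>"
    by (intro dis_triangle M_space_char_fun[OF \<phi>] M_space_char_fun[OF \<psi>] const_1_char_fun)
  also have "\<dots> < \<infinity>" using fin[OF \<phi>] fin[OF \<psi>] by (simp add: dis_commute[of _ _ _ \<psi>])
  finally show ?thesis .
qed

lemma dis_eq_0_imp_eq:
  assumes "\<phi> \<in> char_funs" "\<psi> \<in> char_funs" "dis \<alpha> \<beta> \<phi> \<psi> = 0"
  shows "\<phi> = \<psi>"
proof
  fix \<xi>
  show "\<phi> \<xi> = \<psi> \<xi>"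
  proof (cases "\<xi> = 0")
    case False
    have "dist_K \<beta> \<phi> \<psi> = 0" using assms(3) by (simp add: dis_def)
    then show ?thesis using cmod_diff_le_dist_K[of \<beta> \<phi> \<psi> \<xi>] False by simp
  qed (use char_fun_props(1)[OF assms(1)] char_fun_props(1)[OF assms(2)] in simp)
qed

lemma dist_K_self: "dist_K \<beta> \<phi> \<phi> = 0"
  using dist_K_leI[of \<phi> \<phi> 0 \<beta>] by simp

theorem Metric_space_M_space:
  assumes \<alpha>\<beta>: "0 < \<beta>" "\<beta> \<le> \<alpha>" "\<alpha> < 2"
  shows "Metric_space (M_space \<alpha> :: ('a::euclidean_space \<Rightarrow> complex) set) (\<lambda>\<phi> \<psi>. enn2real (dis \<alpha> \<beta> \<phi> \<psi>))"
proof
  fix \<phi> \<psi> \<theta> :: "'a \<Rightarrow> complex"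
  show "0 \<le> enn2real (dis \<alpha> \<beta> \<phi> \<psi>)" by simp
  show "enn2real (dis \<alpha> \<beta> \<phi> \<psi>) = enn2real (dis \<alpha> \<beta> \<psi> \<phi>)" by (simp add: dis_commute)
  assume \<phi>: "\<phi> \<in> M_space \<alpha>" and \<psi>: "\<psi> \<in> M_space \<alpha>"
  note fin = dis_finite[OF \<alpha>\<beta>]
  show "enn2real (dis \<alpha> \<beta> \<phi> \<psi>) = 0 \<longleftrightarrow> \<phi> = \<psi>"
  proof
    assume "enn2real (dis \<alpha> \<beta> \<phi> \<psi>) = 0"
    then have "dis \<alpha> \<beta> \<phi> \<psi> = 0" using fin[OF \<phi> \<psi>] by (auto simp: enn2real_eq_0_iff)
    then show "\<phi> = \<psi>" by (rule dis_eq_0_imp_eq[OF M_space_char_fun[OF \<phi>] M_space_char_fun[OF \<psi>]])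
  next
    assume "\<phi> = \<psi>"
    then show "enn2real (dis \<alpha> \<beta> \<phi> \<psi>) = 0" by (simp add: dis_def dist_M_def dist_K_self)
  qed
  assume \<theta>: "\<theta> \<in> M_space \<alpha>"
  have "enn2real (dis \<alpha> \<beta> \<phi> \<theta>) \<le> enn2real (dis \<alpha> \<beta> \<phi> \<psi> + dis \<alpha> \<beta> \<psi> \<theta>)"
    using fin[OF \<phi> \<psi>] fin[OF \<psi> \<theta>] dis_triangle[OF \<phi>[THEN M_space_char_fun] \<psi>[THEN M_space_char_fun] \<theta>[THEN M_space_char_fun]]
    by (intro enn2real_mono) auto
  also have "\<dots> = enn2real (dis \<alpha> \<beta> \<phi> \<psi>) + enn2real (dis \<alpha> \<beta> \<psi> \<theta>)"
    using fin[OF \<phi> \<psi>] fin[OF \<psi> \<theta>] by (intro enn2real_plus) auto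
  finally show "enn2real (dis \<alpha> \<beta> \<phi> \<theta>) \<le> enn2real (dis \<alpha> \<beta> \<phi> \<psi>) + enn2real (dis \<alpha> \<beta> \<psi> \<theta>)" .
qed

section \<open>Uniform tails and equivalence of the distances\<close>

text \<open>
  The low-frequency integral over a small ball is small for \<open>\<phi>\<^sub>0\<close> and changes by at most \<open>dist_M\<close>. The
  admissible distance is independent of \<open>\<phi>\<^sub>0\<close>; only the radius depends on it. This order of quantifiers is
  what the completeness proof needs, where \<open>\<phi>\<^sub>0\<close> is a late member of a Cauchy sequence that can be chosen
  only once the distance is known.
\<close>
lemma tail_moment_uniformly_small:
  fixes \<phi>\<^sub>0 :: "'a::euclidean_space \<Rightarrow> complex"
  assumes \<phi>\<^sub>0: "\<phi>\<^sub>0 \<in> M_space \<alpha>" and \<alpha>: "0 < \<alpha>" and e: "e > 0"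
  obtains R where "R \<ge> 1"
    "\<And>F. borel_prob F \<Longrightarrow> dist_M \<alpha> (fourier F) \<phi>\<^sub>0 \<le> ennreal (tail_const DIM('a) \<alpha> * e / 2) \<Longrightarrow> tail_moment \<alpha> R F \<le> ennreal e"
proof -
  define c where "c = tail_const DIM('a) \<alpha>"
  have c: "c > 0" unfolding c_def by (rule tail_const_pos)
  have "ennreal (c * e / 2) > 0" using c e by simp
  then obtain r where r: "r > 0" "low_freq \<alpha> r \<phi>\<^sub>0 < ennreal (c * e / 2)"
    using M_space_low_freq_small[OF \<phi>\<^sub>0] by blast
  \<comment> \<open>\<open>2 / R \<le> r\<close> is what the tail estimate needs, and \<open>R \<ge> 1\<close> makes the tail moment dominate the tail probability\<close>
  define R where "R = max 1 (2 / r)"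
  have R: "R \<ge> 1" "2 / R \<le> r"
  proof -
    show "R \<ge> 1" by (simp add: R_def)
    have "2 / r \<le> R" by (simp add: R_def)
    then show "2 / R \<le> r" using r \<open>R \<ge> 1\<close> by (simp add: field_simps)
  qed
  show ?thesis
  proof (rule that[OF R(1)])
    fix F :: "'a measure"
    assume F: "borel_prob F" and close: "dist_M \<alpha> (fourier F) \<phi>\<^sub>0 \<le> ennreal (tail_const DIM('a) \<alpha> * e / 2)"
    interpret borel_prob F by fact
    have [measurable]: "\<phi>\<^sub>0 \<in> borel_measurable borel" using char_fun_props(3)[OF M_space_char_fun[OF \<phi>\<^sub>0]] .
    have [measurable, simp]: "cball (0::'a) r \<in> sets borel" for r by simp
    let ?w = "\<lambda>\<xi>::'a. norm \<xi> powr (real DIM('a) + \<alpha>)"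
    have "ennreal c * tail_moment \<alpha> R F \<le> low_freq \<alpha> (2 / R) (fourier F)"
      unfolding c_def using R by (intro tail_moment_le_low_freq \<alpha>) auto
    also have "\<dots> \<le> low_freq \<alpha> r (fourier F)" by (rule low_freq_mono[OF R(2)])
    also have "\<dots> \<le> (\<integral>\<^sup>+\<xi>. ennreal (cmod (fourier F \<xi> - \<phi>\<^sub>0 \<xi>) / ?w \<xi>) + ennreal (cmod (\<phi>\<^sub>0 \<xi> - 1) / ?w \<xi>) * indicator (cball 0 r) \<xi> \<partial>lborel)"
      unfolding low_freq_def
      using ennreal_cmod_triangle_divide[of "?w \<xi>" "fourier F \<xi>" 1 "\<phi>\<^sub>0 \<xi>" for \<xi>]
      by (intro nn_integral_mono) (auto simp: indicator_def)
    also have "\<dots> = dist_M \<alpha> (fourier F) \<phi>\<^sub>0 + low_freq \<alpha> r \<phi>\<^sub>0"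
      unfolding dist_M_def low_freq_def by (subst nn_integral_add) auto
    also have "\<dots> \<le> ennreal (c * e / 2) + ennreal (c * e / 2)"
      using close r(2) by (intro add_mono) (auto simp: c_def)
    also have "\<dots> = ennreal c * ennreal e"
      using c e by (simp add: ennreal_plus[symmetric] ennreal_mult[symmetric] del: ennreal_plus)
    finally show "tail_moment \<alpha> R F \<le> ennreal e"
      using c by (simp add: ennreal_mult_le_mult_iff)
  qed
qed

lemma (in borel_prob) measure_tail_le_tail_moment:
  assumes "R \<ge> 1" "\<alpha> \<ge> 0" "tail_moment \<alpha> R F \<le> ennreal e" "e \<ge> 0"
  shows "measure F {v. R < norm v} \<le> e"
proof -
  have "emeasure F {v. R < norm v} = (\<integral>\<^sup>+v. indicator {v. R < norm v} v \<partial>F)" by simp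
  also have "\<dots> \<le> tail_moment \<alpha> R F"
    unfolding tail_moment_def
  proof (intro nn_integral_mono)
    fix v :: 'a
    have "1 \<le> norm v powr \<alpha>" if "R < norm v" using that assms by (intro ge_one_powr_ge_zero) auto
    then show "indicator {v. R < norm v} v \<le> ennreal (norm v powr \<alpha>) * indicator {v. R < norm v} v"
      by (auto simp: indicator_def)
  qed
  finally have "ennreal (measure F {v. R < norm v}) \<le> ennreal e"
    using assms(3) by (simp only: emeasure_eq_measure)
  then show ?thesis using assms(4) by simp
qed

lemma (in borel_prob)
  assumes int: "integrable F (\<lambda>v. norm v powr \<alpha>)"
    and T: "tail_moment \<alpha> R F \<le> ennreal T" "T \<ge> 0"
  shows integrable_tail: "integrable F (\<lambda>v. norm v powr \<alpha> * indicator {v. R < norm v} v)" (is "integrable F ?g")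
    and integral_tail_le: "(\<integral>v. norm v powr \<alpha> * indicator {v. R < norm v} v \<partial>F) \<le> T"
proof -
  show i: "integrable F ?g"
    using int by (intro integrable_real_mult_indicator) auto
  have "ennreal (\<integral>v. ?g v \<partial>F) = tail_moment \<alpha> R F"
    unfolding tail_moment_def using i
    by (subst nn_integral_eq_integral[symmetric]) (auto simp: ennreal_mult ennreal_indicator)
  then have "ennreal (\<integral>v. ?g v \<partial>F) \<le> ennreal T" using T(1) by (simp only:)
  then show "(\<integral>v. ?g v \<partial>F) \<le> T" using T(2) by simp
qed

text \<open>
  Split the integral of the Taylor remainder at \<open>|v| = R\<close>. The inner part is of order \<open>b + 1 > \<alpha>\<close> in \<open>\<xi>\<close>, hence
  negligible near the origin compared with \<open>|\<xi>|\<^sup>\<alpha>\<close>, and the outer part is controlled by the tail.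
\<close>
lemma P_space_fourier_diff_1_le_tail:
  assumes F: "F \<in> P_space \<alpha>" and \<alpha>: "0 < \<alpha>" "\<alpha> < 2" and R: "R \<ge> 0"
    and T: "tail_moment \<alpha> R F \<le> ennreal T" "T \<ge> 0"
  shows "cmod (fourier F \<xi> - 1) \<le> 2 * ((R * norm \<xi>) ^ Suc (mom_index \<alpha>) + norm \<xi> powr \<alpha> * T)"
proof -
  interpret borel_prob F using P_space_imp_borel_prob[OF F] .
  define b where "b = mom_index \<alpha>"
  note b = mom_index_bounds[OF \<alpha>, folded b_def]
  let ?g = "\<lambda>v. norm v powr \<alpha> * indicator {v. R < norm v} v"
  note int = integrable_tail[OF P_space_integrable_powr[OF F] T]
  note tail_le = integral_tail_le[OF P_space_integrable_powr[OF F] T]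
  have "(\<integral>v. taylor_bound b (norm v * norm \<xi>) \<partial>F) \<le> (\<integral>v. (R * norm \<xi>) ^ Suc b + norm \<xi> powr \<alpha> * ?g v \<partial>F)"
  proof (rule integral_mono)
    show "integrable F (\<lambda>v. (R * norm \<xi>) ^ Suc b + norm \<xi> powr \<alpha> * ?g v)" using int by simp
    fix v
    show "taylor_bound b (norm v * norm \<xi>) \<le> (R * norm \<xi>) ^ Suc b + norm \<xi> powr \<alpha> * ?g v"
    proof (cases "R < norm v")
      case True
      have "taylor_bound b (norm v * norm \<xi>) \<le> (norm v * norm \<xi>) powr \<alpha>"
        using b \<alpha> by (intro taylor_bound_le_powr) auto
      then show ?thesis using True R by (simp add: powr_mult mult.commute add_increasing)
    next
      case False
      have "taylor_bound b (norm v * norm \<xi>) \<le> (norm v * norm \<xi>) ^ Suc b" by (simp add: taylor_bound_def)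
      also have "\<dots> \<le> (R * norm \<xi>) ^ Suc b" using False by (intro power_mono mult_right_mono) auto
      finally show ?thesis using False by simp
    qed
  qed (use fourier_diff_1_le(1)[OF F \<alpha>] in \<open>simp add: b_def\<close>)
  also have "\<dots> = (R * norm \<xi>) ^ Suc b + norm \<xi> powr \<alpha> * (\<integral>v. ?g v \<partial>F)"
    using int by simp
  also have "\<dots> \<le> (R * norm \<xi>) ^ Suc b + norm \<xi> powr \<alpha> * T"
    using tail_le by (intro add_left_mono mult_left_mono) auto
  finally have "2 * (\<integral>v. taylor_bound b (norm v * norm \<xi>) \<partial>F) \<le> 2 * ((R * norm \<xi>) ^ Suc b + norm \<xi> powr \<alpha> * T)"
    by (rule mult_left_mono) simp
  with fourier_diff_1_le(2)[OF F \<alpha>, of \<xi>] show ?thesis unfolding b_def by (rule order_trans)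
qed

lemma powr_le_sum_powr:
  fixes x y z s :: real
  assumes "0 < x" "x \<le> y" "y \<le> z"
  shows "y powr s \<le> x powr s + z powr s"
proof (cases "s \<ge> 0")
  case True
  then have "y powr s \<le> z powr s" using assms by (intro powr_mono2) auto
  then show ?thesis by (simp add: add_increasing)
next
  case False
  then have "y powr s \<le> x powr s" using assms by (intro powr_mono2') auto
  then show ?thesis by (simp add: add_increasing2)
qed

lemma exists_powr_le:
  fixes c s :: real
  assumes "c > 0" "s > 0"
  shows "\<exists>\<eta>. 0 < \<eta> \<and> \<eta> \<le> 1 \<and> \<eta> powr s \<le> c"
proof (intro exI[of _ "min 1 (c powr (1 / s))"] conjI)
  have "(min 1 (c powr (1 / s))) powr s \<le> (c powr (1 / s)) powr s"
    using assms by (intro powr_mono2) auto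
  also have "\<dots> = c" using assms by (simp add: powr_powr)
  finally show "(min 1 (c powr (1 / s))) powr s \<le> c" .
qed (use assms in auto)

lemma exists_powr_ge:
  fixes c s :: real
  assumes "c > 0" "s > 0"
  shows "\<exists>A\<ge>1. c \<le> A powr s"
proof (intro exI[of _ "max 1 (c powr (1 / s))"] conjI)
  have "c = (c powr (1 / s)) powr s" using assms by (simp add: powr_powr)
  also have "\<dots> \<le> (max 1 (c powr (1 / s))) powr s"
    using assms by (intro powr_mono2) auto
  finally show "c \<le> (max 1 (c powr (1 / s))) powr s" .
qed simp

text \<open>
  The quotient \<open>|\<phi> - \<phi>\<^sub>0| / |\<xi>|\<^bsup>\<beta>'\<^esup>\<close> is estimated in three regions. For \<open>|\<xi>| \<le> \<eta>\<close> both functions are close to 1 to order \<open>\<alpha>\<close>,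
  by the uniform tails. For \<open>|\<xi>| \<ge> A\<close> the numerator is at most 2. In between, the powers of \<open>|\<xi>|\<close> with
  exponents \<open>\<beta>\<close> and \<open>\<beta>'\<close> are comparable, so that \<open>dist_K \<beta>\<close> decides.
\<close>
theorem dis_equivalent:
  fixes \<phi>\<^sub>0 :: "'a::euclidean_space \<Rightarrow> complex"
  assumes \<alpha>: "0 < \<alpha>" "\<alpha> < 2" and \<beta>': "0 < \<beta>'" "\<beta>' \<le> \<alpha>"
    and \<phi>\<^sub>0: "\<phi>\<^sub>0 \<in> M_space \<alpha>" and \<epsilon>: "\<epsilon> > 0"
  shows "\<exists>\<delta>>0. \<forall>\<phi>\<in>M_space \<alpha>. dis \<alpha> \<beta> \<phi> \<phi>\<^sub>0 < ennreal \<delta> \<longrightarrow> dis \<alpha> \<beta>' \<phi> \<phi>\<^sub>0 < ennreal \<epsilon>"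
proof -
  define b where "b = mom_index \<alpha>"
  note b = mom_index_bounds[OF \<alpha>, folded b_def]
  \<comment> \<open>four tail contributions of size \<open>T\<close> and four inner ones of size \<open>\<epsilon> / 16\<close> add up to \<open>\<epsilon> / 2\<close>\<close>
  define T where "T = \<epsilon> / 16"
  have T: "T > 0" using \<epsilon> by (simp add: T_def)
  define \<delta>1 where "\<delta>1 = tail_const DIM('a) \<alpha> * T / 2"
  have \<delta>1: "\<delta>1 > 0" using T tail_const_pos[of "DIM('a)" \<alpha>] by (simp add: \<delta>1_def)
  obtain R where R: "R \<ge> 1" and tail: "\<And>F. borel_prob F \<Longrightarrow> dist_M \<alpha> (fourier F) \<phi>\<^sub>0 \<le> ennreal \<delta>1 \<Longrightarrow> tail_moment \<alpha> R F \<le> ennreal T"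
    using tail_moment_uniformly_small[OF \<phi>\<^sub>0 \<alpha>(1) T] unfolding \<delta>1_def by metis
  define s where "s = real (Suc b) - \<alpha>"
  have s: "s > 0" using b by (simp add: s_def)
  obtain \<eta> where \<eta>: "0 < \<eta>" "\<eta> \<le> 1" "\<eta> powr s \<le> \<epsilon> / (16 * R ^ Suc b)"
    using exists_powr_le[of "\<epsilon> / (16 * R ^ Suc b)" s] s \<epsilon> R by auto
  obtain A where A: "A \<ge> 1" "4 / \<epsilon> \<le> A powr \<beta>'" using exists_powr_ge[of "4 / \<epsilon>" \<beta>'] \<epsilon> \<beta>' by auto
  define K where "K = \<eta> powr (\<beta> - \<beta>') + A powr (\<beta> - \<beta>')"
  have K: "K > 0" using \<eta> A by (simp add: K_def add_pos_pos)
  define \<delta> where "\<delta> = min \<delta>1 (min (\<epsilon> / 4) (\<epsilon> / (2 * K)))"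
  have \<delta>: "\<delta> > 0" "\<delta> \<le> \<delta>1" "\<delta> \<le> \<epsilon> / 4" "\<delta> * K \<le> \<epsilon> / 2"
  proof -
    show "\<delta> > 0" "\<delta> \<le> \<delta>1" "\<delta> \<le> \<epsilon> / 4" using \<delta>1 \<epsilon> K by (auto simp: \<delta>_def)
    have "\<delta> \<le> \<epsilon> / (2 * K)" by (simp add: \<delta>_def)
    then show "\<delta> * K \<le> \<epsilon> / 2" using K by (simp add: field_simps)
  qed
  have near: "cmod (\<psi> \<xi> - 1) \<le> \<epsilon> / 4 * norm \<xi> powr \<beta>'"
    if \<psi>: "\<psi> \<in> M_space \<alpha>" and close: "dist_M \<alpha> \<psi> \<phi>\<^sub>0 \<le> ennreal \<delta>1" and \<xi>: "norm \<xi> \<le> \<eta>" "\<xi> \<noteq> 0" for \<psi> \<xi>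
  proof -
    obtain F where F: "F \<in> P_space \<alpha>" "\<psi> = fourier F" using \<psi> M_space_subset_fourier_P_space[OF \<alpha>(1)] by blast
    have "tail_moment \<alpha> R F \<le> ennreal T"
      using tail[OF P_space_imp_borel_prob[OF F(1)]] close F(2) by simp
    then have "cmod (\<psi> \<xi> - 1) \<le> 2 * ((R * norm \<xi>) ^ Suc b + norm \<xi> powr \<alpha> * T)"
      unfolding F(2) b_def using R T by (intro P_space_fourier_diff_1_le_tail[OF F(1) \<alpha>]) auto
    also have "(R * norm \<xi>) ^ Suc b = R ^ Suc b * norm \<xi> powr s * norm \<xi> powr \<alpha>"
    proof -
      have "norm \<xi> ^ Suc b = norm \<xi> powr (s + \<alpha>)"
        using \<xi> powr_realpow[of "norm \<xi>" "Suc b"] by (simp add: s_def)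
      then show ?thesis by (simp add: power_mult_distrib powr_add)
    qed
    also have "R ^ Suc b * norm \<xi> powr s * norm \<xi> powr \<alpha> \<le> \<epsilon> / 16 * norm \<xi> powr \<alpha>"
    proof (intro mult_right_mono)
      have "norm \<xi> powr s \<le> \<epsilon> / (16 * R ^ Suc b)"
        using \<xi> s \<eta>(3) powr_mono2[of s "norm \<xi>" \<eta>] by simp
      then have "R ^ Suc b * norm \<xi> powr s \<le> R ^ Suc b * (\<epsilon> / (16 * R ^ Suc b))"
        using R by (intro mult_left_mono) auto
      also have "\<dots> = \<epsilon> / 16" using R by simp
      finally show "R ^ Suc b * norm \<xi> powr s \<le> \<epsilon> / 16" .
    qed simp
    also have "2 * (\<epsilon> / 16 * norm \<xi> powr \<alpha> + norm \<xi> powr \<alpha> * T) = \<epsilon> / 4 * norm \<xi> powr \<alpha>"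
      by (simp add: T_def)
    also have "\<dots> \<le> \<epsilon> / 4 * norm \<xi> powr \<beta>'"
      using \<xi> \<eta> \<beta>' \<epsilon> by (intro mult_left_mono powr_mono') auto
    finally show ?thesis by simp
  qed
  have self: "dist_M \<alpha> \<phi>\<^sub>0 \<phi>\<^sub>0 \<le> ennreal \<delta>1" by (simp add: dist_M_def)
  have "dis \<alpha> \<beta>' \<phi> \<phi>\<^sub>0 < ennreal \<epsilon>" if \<phi>: "\<phi> \<in> M_space \<alpha>" and close: "dis \<alpha> \<beta> \<phi> \<phi>\<^sub>0 < ennreal \<delta>" for \<phi>
  proof -
    have M: "dist_M \<alpha> \<phi> \<phi>\<^sub>0 \<le> ennreal \<delta>" and Kd: "dist_K \<beta> \<phi> \<phi>\<^sub>0 \<le> ennreal \<delta>"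
    proof -
      have "dist_M \<alpha> \<phi> \<phi>\<^sub>0 \<le> dis \<alpha> \<beta> \<phi> \<phi>\<^sub>0" "dist_K \<beta> \<phi> \<phi>\<^sub>0 \<le> dis \<alpha> \<beta> \<phi> \<phi>\<^sub>0"
        by (simp_all add: dis_def add_increasing add_increasing2)
      then show "dist_M \<alpha> \<phi> \<phi>\<^sub>0 \<le> ennreal \<delta>" "dist_K \<beta> \<phi> \<phi>\<^sub>0 \<le> ennreal \<delta>" using close by auto
    qed
    have M1: "dist_M \<alpha> \<phi> \<phi>\<^sub>0 \<le> ennreal \<delta>1" using M \<delta>(2) ennreal_leI order_trans by blast
    have "dist_K \<beta>' \<phi> \<phi>\<^sub>0 \<le> ennreal (\<epsilon> / 2)"
    proof (rule dist_K_leI)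
      fix \<xi> :: 'a assume nz: "\<xi> \<noteq> 0"
      consider "norm \<xi> \<le> \<eta>" | "\<eta> \<le> norm \<xi>" "norm \<xi> \<le> A" | "A \<le> norm \<xi>" by linarith
      then show "cmod (\<phi> \<xi> - \<phi>\<^sub>0 \<xi>) \<le> \<epsilon> / 2 * norm \<xi> powr \<beta>'"
      proof cases
        case 1
        have "cmod (\<phi> \<xi> - \<phi>\<^sub>0 \<xi>) \<le> cmod (\<phi> \<xi> - 1) + cmod (\<phi>\<^sub>0 \<xi> - 1)"
          using norm_triangle_ineq4[of "\<phi> \<xi> - 1" "\<phi>\<^sub>0 \<xi> - 1"] by simp
        then show ?thesis using near[OF \<phi> M1 1 nz] near[OF \<phi>\<^sub>0 self 1 nz] by simp
      next
        case 2
        have fin: "dist_K \<beta> \<phi> \<phi>\<^sub>0 < \<infinity>" using Kd by (simp add: le_less_trans)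
        have "enn2real (dist_K \<beta> \<phi> \<phi>\<^sub>0) \<le> \<delta>" using Kd \<delta>(1) by (simp add: enn2real_leI)
        then have "cmod (\<phi> \<xi> - \<phi>\<^sub>0 \<xi>) \<le> \<delta> * norm \<xi> powr \<beta>"
          using cmod_diff_le_dist_K[OF fin nz] mult_right_mono[of _ \<delta> "norm \<xi> powr \<beta>"] order_trans powr_ge_zero by blast
        also have "norm \<xi> powr \<beta> = norm \<xi> powr (\<beta> - \<beta>') * norm \<xi> powr \<beta>'" using nz by (simp add: powr_add[symmetric])
        also have "norm \<xi> powr (\<beta> - \<beta>') \<le> K"
          unfolding K_def using \<eta> 2 by (intro powr_le_sum_powr) auto
        finally have "cmod (\<phi> \<xi> - \<phi>\<^sub>0 \<xi>) \<le> \<delta> * (K * norm \<xi> powr \<beta>')"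
          using \<delta>(1) by (simp add: mult_left_mono mult_right_mono)
        also have "\<dots> = \<delta> * K * norm \<xi> powr \<beta>'" by simp
        also have "\<dots> \<le> \<epsilon> / 2 * norm \<xi> powr \<beta>'" using \<delta>(4) by (intro mult_right_mono) auto
        finally show ?thesis .
      next
        case 3
        have "4 / \<epsilon> \<le> norm \<xi> powr \<beta>'"
          using A 3 \<beta>' powr_mono2[of \<beta>' A "norm \<xi>"] by simp
        then have "2 \<le> \<epsilon> / 2 * norm \<xi> powr \<beta>'" using \<epsilon> by (simp add: field_simps)
        then show ?thesis
          using char_fun_diff_le_2[OF M_space_char_fun[OF \<phi>] M_space_char_fun[OF \<phi>\<^sub>0], of \<xi>] by linarith
      qed
    qed
    then have "dis \<alpha> \<beta>' \<phi> \<phi>\<^sub>0 \<le> ennreal \<delta> + ennreal (\<epsilon> / 2)" unfolding dis_def using M by (intro add_mono)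
    also have "\<dots> = ennreal (\<delta> + \<epsilon> / 2)" using \<delta> \<epsilon> by (simp add: ennreal_plus)
    also have "\<dots> < ennreal \<epsilon>" using \<delta> \<epsilon> by (intro ennreal_lessI) auto
    finally show ?thesis .
  qed
  then show ?thesis using \<delta>(1) by blast
qed

section \<open>Completeness\<close>

text \<open>
  A Cauchy sequence converges pointwise by its \<open>dist_K\<close> part and is tight by its \<open>dist_M\<close> part, so the limit is
  a characteristic function. Convergence in \<open>dist_M\<close> follows from Fatou's lemma and convergence in
  \<open>dist_K\<close> by passing to the limit in the pointwise bounds.
\<close>
theorem mcomplete_M_space:
  assumes \<alpha>\<beta>: "0 < \<beta>" "\<beta> \<le> \<alpha>" "\<alpha> < 2"
  shows "Metric_space.mcomplete (M_space \<alpha> :: ('a::euclidean_space \<Rightarrow> complex) set) (\<lambda>\<phi> \<psi>. enn2real (dis \<alpha> \<beta> \<phi> \<psi>))"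
proof -
  interpret M: Metric_space "M_space \<alpha> :: ('a \<Rightarrow> complex) set" "\<lambda>\<phi> \<psi>. enn2real (dis \<alpha> \<beta> \<phi> \<psi>)"
    by (rule Metric_space_M_space[OF \<alpha>\<beta>])
  have \<alpha>: "0 < \<alpha>" using \<alpha>\<beta> by simp
  show ?thesis
    unfolding M.mcomplete_def
  proof (intro allI impI)
    fix \<sigma> :: "nat \<Rightarrow> 'a \<Rightarrow> complex" assume "M.MCauchy \<sigma>"
    then have \<sigma>: "\<And>n. \<sigma> n \<in> M_space \<alpha>"
      and cauchy0: "\<And>\<epsilon>. \<epsilon> > 0 \<Longrightarrow> \<exists>N. \<forall>n n'. N \<le> n \<longrightarrow> N \<le> n' \<longrightarrow> enn2real (dis \<alpha> \<beta> (\<sigma> n) (\<sigma> n')) < \<epsilon>"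
      by (auto simp: M.MCauchy_def)
    have cauchy: "\<exists>N. \<forall>n\<ge>N. \<forall>m\<ge>N. dist_M \<alpha> (\<sigma> n) (\<sigma> m) \<le> ennreal \<epsilon> \<and> dist_K \<beta> (\<sigma> n) (\<sigma> m) \<le> ennreal \<epsilon>" if \<epsilon>: "\<epsilon> > 0" for \<epsilon>
    proof -
      obtain N where N: "\<And>n m. N \<le> n \<Longrightarrow> N \<le> m \<Longrightarrow> enn2real (dis \<alpha> \<beta> (\<sigma> n) (\<sigma> m)) < \<epsilon>" using cauchy0[OF \<epsilon>] by blast
      have "dist_M \<alpha> (\<sigma> n) (\<sigma> m) \<le> ennreal \<epsilon> \<and> dist_K \<beta> (\<sigma> n) (\<sigma> m) \<le> ennreal \<epsilon>" if "n \<ge> N" "m \<ge> N" for n m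
      proof -
        have "dis \<alpha> \<beta> (\<sigma> n) (\<sigma> m) = ennreal (enn2real (dis \<alpha> \<beta> (\<sigma> n) (\<sigma> m)))"
          using dis_finite[OF \<alpha>\<beta> \<sigma> \<sigma>, of n m] by simp
        also have "\<dots> \<le> ennreal \<epsilon>" using N[OF that] by (intro ennreal_leI) simp
        finally have "dist_M \<alpha> (\<sigma> n) (\<sigma> m) + dist_K \<beta> (\<sigma> n) (\<sigma> m) \<le> ennreal \<epsilon>" by (simp add: dis_def)
        then show ?thesis
          by (meson add_increasing add_increasing2 order_refl order_trans zero_le)
      qed
      then show ?thesis by blast
    qed
    have char: "\<sigma> n \<in> char_funs" for n using M_space_char_fun[OF \<sigma>] .
    have "\<exists>F. \<forall>n. borel_prob (F n) \<and> fourier (F n) = \<sigma> n"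
      using char_fun_cases[OF char] by (intro choice) blast
    then obtain F where F: "\<And>n. borel_prob (F n)" "\<And>n. fourier (F n) = \<sigma> n" by blast
    have tight: "uniformly_tight F"
    proof (rule uniformly_tightI_eventually[OF F(1)])
      fix \<epsilon> :: real assume \<epsilon>: "\<epsilon> > 0"
      then have "tail_const DIM('a) \<alpha> * \<epsilon> / 2 > 0" using tail_const_pos[of "DIM('a)" \<alpha>] by simp
      then obtain N where N: "\<And>n m. n \<ge> N \<Longrightarrow> m \<ge> N \<Longrightarrow> dist_M \<alpha> (\<sigma> n) (\<sigma> m) \<le> ennreal (tail_const DIM('a) \<alpha> * \<epsilon> / 2)"
        using cauchy by blast
      obtain R where R: "R \<ge> 1" and tail: "\<And>F. borel_prob F \<Longrightarrow> dist_M \<alpha> (fourier F) (\<sigma> N) \<le> ennreal (tail_const DIM('a) \<alpha> * \<epsilon> / 2) \<Longrightarrow> tail_moment \<alpha> R F \<le> ennreal \<epsilon>"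
        using tail_moment_uniformly_small[OF \<sigma> \<alpha> \<epsilon>] by metis
      have "measure (F n) {v. R < norm v} \<le> \<epsilon>" if "n \<ge> N" for n
        using R \<epsilon> \<alpha> N[OF that, of N]
        by (intro borel_prob.measure_tail_le_tail_moment[OF F(1), where \<alpha>=\<alpha>] tail F(1)) (auto simp: F(2))
      then show "\<exists>R N. \<forall>n\<ge>N. measure (F n) {v. R < norm v} \<le> \<epsilon>" by blast
    qed
    have "convergent (\<lambda>n. \<sigma> n \<xi>)" for \<xi>
    proof (cases "\<xi> = 0")
      case True
      then show ?thesis using char_fun_props(1)[OF char] by (simp add: convergent_const)
    next
      case nz: False
      have "Cauchy (\<lambda>n. \<sigma> n \<xi>)"
      proof (rule CauchyI)
        fix e :: real assume e: "e > 0"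
        define \<epsilon> where "\<epsilon> = e / (2 * norm \<xi> powr \<beta>)"
        have \<epsilon>: "\<epsilon> > 0" using e nz by (simp add: \<epsilon>_def)
        obtain N where N: "\<And>n m. n \<ge> N \<Longrightarrow> m \<ge> N \<Longrightarrow> dist_K \<beta> (\<sigma> n) (\<sigma> m) \<le> ennreal \<epsilon>" using cauchy[OF \<epsilon>] by blast
        have "norm (\<sigma> m \<xi> - \<sigma> n \<xi>) < e" if "m \<ge> N" "n \<ge> N" for m n
        proof -
          have "dist_K \<beta> (\<sigma> m) (\<sigma> n) < \<infinity>" using N[OF that] by (simp add: le_less_trans)
          then have "norm (\<sigma> m \<xi> - \<sigma> n \<xi>) \<le> enn2real (dist_K \<beta> (\<sigma> m) (\<sigma> n)) * norm \<xi> powr \<beta>"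
            by (rule cmod_diff_le_dist_K[OF _ nz])
          also have "\<dots> \<le> \<epsilon> * norm \<xi> powr \<beta>"
            using N[OF that] \<epsilon> by (intro mult_right_mono enn2real_leI) auto
          also have "\<dots> < e" using nz e by (simp add: \<epsilon>_def)
          finally show ?thesis .
        qed
        then show "\<exists>M. \<forall>m\<ge>M. \<forall>n\<ge>M. norm (\<sigma> m \<xi> - \<sigma> n \<xi>) < e" by blast
      qed
      then show ?thesis by (simp add: Cauchy_convergent_iff)
    qed
    then obtain \<phi> where \<phi>: "\<And>\<xi>. (\<lambda>n. \<sigma> n \<xi>) \<longlonglongrightarrow> \<phi> \<xi>" unfolding convergent_def by metis
    have \<phi>_char: "\<phi> \<in> char_funs" by (rule char_fun_limit[OF F(1) tight]) (simp add: F(2) \<phi>)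
    have [measurable]: "\<phi> \<in> borel_measurable borel" "\<sigma> n \<in> borel_measurable borel" for n
      using char_fun_props(3)[OF \<phi>_char] char_fun_props(3)[OF char] by auto
    have lim: "\<exists>N. \<forall>n\<ge>N. dist_M \<alpha> (\<sigma> n) \<phi> \<le> ennreal \<epsilon> \<and> dist_K \<beta> (\<sigma> n) \<phi> \<le> ennreal \<epsilon>" if \<epsilon>: "\<epsilon> > 0" for \<epsilon>
    proof -
      obtain N where N: "\<And>n m. n \<ge> N \<Longrightarrow> m \<ge> N \<Longrightarrow> dist_M \<alpha> (\<sigma> n) (\<sigma> m) \<le> ennreal \<epsilon>"
        "\<And>n m. n \<ge> N \<Longrightarrow> m \<ge> N \<Longrightarrow> dist_K \<beta> (\<sigma> n) (\<sigma> m) \<le> ennreal \<epsilon>"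
        using cauchy[OF \<epsilon>] by blast
      have "dist_M \<alpha> (\<sigma> n) \<phi> \<le> ennreal \<epsilon>" if n: "n \<ge> N" for n
      proof -
        let ?w = "\<lambda>\<xi>::'a. norm \<xi> powr (real DIM('a) + \<alpha>)"
        have "dist_M \<alpha> (\<sigma> n) \<phi> = (\<integral>\<^sup>+\<xi>. liminf (\<lambda>m. ennreal (cmod (\<sigma> n \<xi> - \<sigma> m \<xi>) / ?w \<xi>)) \<partial>lborel)"
          unfolding dist_M_def
        proof (intro nn_integral_cong)
          fix \<xi> :: 'a
          have "(\<lambda>m. ennreal (cmod (\<sigma> n \<xi> - \<sigma> m \<xi>) * (1 / ?w \<xi>))) \<longlonglongrightarrow> ennreal (cmod (\<sigma> n \<xi> - \<phi> \<xi>) * (1 / ?w \<xi>))"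
            by (intro tendsto_ennrealI tendsto_intros \<phi>)
          then show "ennreal (cmod (\<sigma> n \<xi> - \<phi> \<xi>) / ?w \<xi>) = liminf (\<lambda>m. ennreal (cmod (\<sigma> n \<xi> - \<sigma> m \<xi>) / ?w \<xi>))"
            unfolding times_divide_eq_right mult_1_right by (intro lim_imp_Liminf[symmetric]) auto
        qed
        also have "\<dots> \<le> liminf (\<lambda>m. dist_M \<alpha> (\<sigma> n) (\<sigma> m))"
          unfolding dist_M_def by (rule nn_integral_liminf) measurable
        also have "\<dots> \<le> liminf (\<lambda>m. ennreal \<epsilon>)"
          using N(1)[OF n] by (intro Liminf_mono) (auto simp: eventually_sequentially)
        also have "\<dots> = ennreal \<epsilon>" by (simp add: Liminf_const)
        finally show ?thesis .
      qed
      moreover have "dist_K \<beta> (\<sigma> n) \<phi> \<le> ennreal \<epsilon>" if n: "n \<ge> N" for n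
      proof (rule dist_K_leI)
        fix \<xi> :: 'a assume nz: "\<xi> \<noteq> 0"
        show "cmod (\<sigma> n \<xi> - \<phi> \<xi>) \<le> \<epsilon> * norm \<xi> powr \<beta>"
        proof (rule LIMSEQ_le_const2)
          show "(\<lambda>m. cmod (\<sigma> n \<xi> - \<sigma> m \<xi>)) \<longlonglongrightarrow> cmod (\<sigma> n \<xi> - \<phi> \<xi>)" by (intro tendsto_intros \<phi>)
          have "cmod (\<sigma> n \<xi> - \<sigma> m \<xi>) \<le> \<epsilon> * norm \<xi> powr \<beta>" if m: "m \<ge> N" for m
          proof -
            have "dist_K \<beta> (\<sigma> n) (\<sigma> m) < \<infinity>" using N(2)[OF n m] by (simp add: le_less_trans)
            then have "cmod (\<sigma> n \<xi> - \<sigma> m \<xi>) \<le> enn2real (dist_K \<beta> (\<sigma> n) (\<sigma> m)) * norm \<xi> powr \<beta>"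
              by (rule cmod_diff_le_dist_K[OF _ nz])
            also have "\<dots> \<le> \<epsilon> * norm \<xi> powr \<beta>"
              using N(2)[OF n m] \<epsilon> by (intro mult_right_mono enn2real_leI) auto
            finally show ?thesis .
          qed
          then show "\<exists>M. \<forall>m\<ge>M. cmod (\<sigma> n \<xi> - \<sigma> m \<xi>) \<le> \<epsilon> * norm \<xi> powr \<beta>" by blast
        qed
      qed
      ultimately show ?thesis by blast
    qed
    have \<phi>_M: "\<phi> \<in> M_space \<alpha>"
    proof -
      obtain N where "dist_M \<alpha> (\<sigma> N) \<phi> \<le> ennreal 1" using lim[of 1] by auto
      then have "dist_M \<alpha> \<phi> (\<sigma> N) + dist_M \<alpha> (\<sigma> N) (\<lambda>_. 1) < \<infinity>"
        using \<sigma>[of N] by (auto simp: dist_M_commute[of \<alpha> \<phi>] M_space_def less_top[symmetric] top_unique)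
      then have "dist_M \<alpha> \<phi> (\<lambda>_. 1) < \<infinity>"
        using dist_M_triangle[of \<phi> "\<sigma> N" "\<lambda>_. 1" \<alpha>] by (auto intro: le_less_trans)
      then show ?thesis using \<phi>_char by (simp add: M_space_def)
    qed
    have "\<exists>N. \<forall>n\<ge>N. \<sigma> n \<in> M_space \<alpha> \<and> enn2real (dis \<alpha> \<beta> (\<sigma> n) \<phi>) < \<epsilon>" if \<epsilon>: "\<epsilon> > 0" for \<epsilon>
    proof -
      have "\<epsilon> / 3 > 0" using \<epsilon> by simp
      then obtain N where N: "\<And>n. n \<ge> N \<Longrightarrow> dist_M \<alpha> (\<sigma> n) \<phi> \<le> ennreal (\<epsilon> / 3) \<and> dist_K \<beta> (\<sigma> n) \<phi> \<le> ennreal (\<epsilon> / 3)"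
        using lim by blast
      have "enn2real (dis \<alpha> \<beta> (\<sigma> n) \<phi>) < \<epsilon>" if "n \<ge> N" for n
      proof -
        have "dis \<alpha> \<beta> (\<sigma> n) \<phi> \<le> ennreal (\<epsilon> / 3) + ennreal (\<epsilon> / 3)"
          unfolding dis_def using N[OF that] by (intro add_mono) auto
        also have "\<dots> = ennreal (\<epsilon> / 3 + \<epsilon> / 3)" using \<epsilon> by (subst ennreal_plus) auto
        finally have "enn2real (dis \<alpha> \<beta> (\<sigma> n) \<phi>) \<le> \<epsilon> / 3 + \<epsilon> / 3" using \<epsilon> by (intro enn2real_leI) auto
        then show ?thesis using \<epsilon> by simp
      qed
      then show ?thesis using \<sigma> by blast
    qed
    then have "limitin M.mtopology \<sigma> \<phi> sequentially"
      unfolding M.limit_metric_sequentially using \<phi>_M by blast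
    then show "\<exists>x. limitin M.mtopology \<sigma> x sequentially" by blast
  qed
qed

section \<open>Convergence of integrals of order \<open>\<alpha>\<close>\<close>

lemma M_space_fourier_inv:
  assumes "\<phi> \<in> M_space \<alpha>" "0 < \<alpha>"
  shows "fourier_inv \<phi> \<in> P_space \<alpha>" "fourier (fourier_inv \<phi>) = \<phi>"
proof -
  obtain F where F: "F \<in> P_space \<alpha>" "\<phi> = fourier F" using M_space_subset_fourier_P_space[of \<alpha>] assms by blast
  then have "fourier_inv \<phi> = F" using fourier_inv_fourier[OF P_space_imp_borel_prob[OF F(1)]] by simp
  then show "fourier_inv \<phi> \<in> P_space \<alpha>" "fourier (fourier_inv \<phi>) = \<phi>" using F by auto
qed

lemma bracket_powr_le:
  assumes "0 < \<alpha>" "\<alpha> < 2"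
  shows "bracket v powr \<alpha> \<le> 4 * (if norm v \<le> 1 then 1 else norm v powr \<alpha>)"
proof -
  have b: "bracket v = sqrt (1 + (norm v)\<^sup>2)" by (simp add: bracket_def powr_half_sqrt)
  have two: "2 powr \<alpha> \<le> (4 :: real)" using powr_mono[of \<alpha> 2 "2::real"] assms by simp
  show ?thesis
  proof (cases "norm v \<le> 1")
    case True
    have "bracket v \<le> sqrt (2\<^sup>2)" unfolding b using True power_le_one[of "norm v" 2] by (intro real_sqrt_le_mono) auto
    then have "bracket v powr \<alpha> \<le> 2 powr \<alpha>" using assms by (intro powr_mono2) (auto simp: b)
    then show ?thesis using True two by simp
  next
    case False
    have "1 \<le> (norm v)\<^sup>2" using False by (simp add: one_le_power)
    then have "bracket v \<le> sqrt ((2 * norm v)\<^sup>2)" unfolding b by (intro real_sqrt_le_mono) (simp add: power_mult_distrib)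
    also have "sqrt ((2 * norm v)\<^sup>2) = 2 * norm v" by (simp only: real_sqrt_abs) simp
    finally have "bracket v powr \<alpha> \<le> (2 * norm v) powr \<alpha>"
      by (intro powr_mono2) (use assms in \<open>auto simp: bracket_def\<close>)
    also have "\<dots> = 2 powr \<alpha> * norm v powr \<alpha>" by (simp add: powr_mult)
    also have "\<dots> \<le> 4 * norm v powr \<alpha>" using two by (intro mult_right_mono) auto
    finally show ?thesis using False by simp
  qed
qed

lemma weak_convergence_complex:
  fixes f :: "'a::euclidean_space \<Rightarrow> complex"
  assumes F: "\<And>n. borel_prob (F n)" and G: "borel_prob G" and tight: "uniformly_tight F"
    and conv: "\<And>\<xi>. (\<lambda>n. fourier (F n) \<xi>) \<longlonglongrightarrow> fourier G \<xi>"
    and f: "continuous_on UNIV f" "\<And>v. cmod (f v) \<le> M"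
  shows "(\<lambda>n. \<integral>v. f v \<partial>F n) \<longlonglongrightarrow> (\<integral>v. f v \<partial>G)"
proof -
  have fm: "f \<in> borel_measurable borel" using f(1) by (rule borel_measurable_continuous_onI)
  have int: "integrable H f" if "borel_prob H" for H
  proof -
    interpret borel_prob H by fact
    show ?thesis using f(2) fm by (intro integrable_const_bound[of _ M]) auto
  qed
  have "(\<lambda>n. \<integral>v. Re (f v) \<partial>F n) \<longlonglongrightarrow> (\<integral>v. Re (f v) \<partial>G)"
    by (rule weak_convergence_if_fourier_tendsto[OF F G tight conv, where M=M])
       (auto intro!: continuous_intros f(1) order_trans[OF abs_Re_le_cmod f(2)])
  moreover have "(\<lambda>n. \<integral>v. Im (f v) \<partial>F n) \<longlonglongrightarrow> (\<integral>v. Im (f v) \<partial>G)"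
    by (rule weak_convergence_if_fourier_tendsto[OF F G tight conv, where M=M])
       (auto intro!: continuous_intros f(1) order_trans[OF abs_Im_le_cmod f(2)])
  ultimately show ?thesis
    by (simp add: tendsto_complex_iff integral_Re[OF int[OF F]] integral_Re[OF int[OF G]]
        integral_Im[OF int[OF F]] integral_Im[OF int[OF G]])
qed

lemma truncation_error_le_tail:
  fixes \<psi> :: "'a::euclidean_space \<Rightarrow> complex" and g :: "'a \<Rightarrow> real"
  assumes F: "borel_prob F" and int: "integrable F (\<lambda>v. norm v powr \<alpha>)" and \<alpha>: "0 < \<alpha>" "\<alpha> < 2"
    and \<psi>: "continuous_on UNIV \<psi>" "\<And>v. cmod (\<psi> v) \<le> C * bracket v powr \<alpha>" "C \<ge> 0"
    and g: "continuous_on UNIV g" "\<And>v. 0 \<le> g v \<and> g v \<le> 1" "\<And>v. norm v \<le> R \<Longrightarrow> g v = 1"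
    and R: "R \<ge> 1" "tail_moment \<alpha> R F \<le> ennreal e" "e \<ge> 0"
  shows "cmod ((\<integral>v. \<psi> v \<partial>F) - (\<integral>v. of_real (g v) * \<psi> v \<partial>F)) \<le> 4 * C * e"
proof -
  interpret borel_prob F by fact
  have [measurable]: "\<psi> \<in> borel_measurable borel" using \<psi>(1) by (rule borel_measurable_continuous_onI)
  have [measurable]: "g \<in> borel_measurable borel" using g(1) by (rule borel_measurable_continuous_onI)
  have \<psi>_le: "cmod (\<psi> v) \<le> 4 * C * (if norm v \<le> 1 then 1 else norm v powr \<alpha>)" for v
    using order_trans[OF \<psi>(2)[of v] mult_left_mono[OF bracket_powr_le[OF \<alpha>, of v] \<psi>(3)]] by (simp add: ac_simps)
  have dom: "integrable F (\<lambda>v. 4 * C * (1 + norm v powr \<alpha>))" using int by simp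
  have dom_le: "cmod (\<psi> v) \<le> norm (4 * C * (1 + norm v powr \<alpha>))" for v
  proof -
    have "4 * C * (if norm v \<le> 1 then 1 else norm v powr \<alpha>) \<le> 4 * C * (1 + norm v powr \<alpha>)"
      using \<psi>(3) by (intro mult_left_mono) auto
    then show ?thesis using \<psi>_le[of v] by simp
  qed
  have i1: "integrable F \<psi>"
    by (rule Bochner_Integration.integrable_bound[OF dom], simp, rule AE_I2, rule dom_le)
  have i2: "integrable F (\<lambda>v. of_real (g v) * \<psi> v)"
  proof (rule Bochner_Integration.integrable_bound[OF i1])
    show "AE v in F. cmod (of_real (g v) * \<psi> v) \<le> cmod (\<psi> v)"
      using g(2) by (intro AE_I2) (simp add: norm_mult mult_left_le_one_le)
  qed measurable
  note it = integrable_tail[OF int R(2,3)]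
  note tail = integral_tail_le[OF int R(2,3)]
  have "cmod ((\<integral>v. \<psi> v \<partial>F) - (\<integral>v. of_real (g v) * \<psi> v \<partial>F)) = cmod (\<integral>v. \<psi> v - of_real (g v) * \<psi> v \<partial>F)"
    using i1 i2 by simp
  also have "\<dots> \<le> (\<integral>v. cmod (\<psi> v - of_real (g v) * \<psi> v) \<partial>F)" by (rule integral_norm_bound)
  also have "\<dots> \<le> (\<integral>v. 4 * C * (norm v powr \<alpha> * indicator {v. R < norm v} v) \<partial>F)"
  proof (rule integral_mono)
    fix v
    have eq: "\<psi> v - of_real (g v) * \<psi> v = of_real (1 - g v) * \<psi> v" by (simp add: algebra_simps)
    show "cmod (\<psi> v - of_real (g v) * \<psi> v) \<le> 4 * C * (norm v powr \<alpha> * indicator {v. R < norm v} v)"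
    proof (cases "R < norm v")
      case True
      have "cmod (\<psi> v - of_real (g v) * \<psi> v) \<le> cmod (\<psi> v)"
        unfolding eq norm_mult norm_of_real using g(2)[of v] by (intro mult_left_le_one_le) auto
      then show ?thesis using \<psi>_le[of v] True R(1) by simp
    next
      case False
      then show ?thesis using g(3)[of v] by simp
    qed
  qed (use i1 i2 it in auto)
  also have "\<dots> = 4 * C * (\<integral>v. norm v powr \<alpha> * indicator {v. R < norm v} v \<partial>F)" by simp
  also have "\<dots> \<le> 4 * C * e" using tail \<psi>(3) by (intro mult_left_mono) auto
  finally show ?thesis .
qed

text \<open>
  Convergence in \<open>dis\<close> gives pointwise convergence of the characteristic functions and uniformly small tails
  of order \<open>\<alpha>\<close>. The truncation of \<open>\<psi>\<close> by a cutoff \<open>g\<close> is bounded and continuous, so weak convergence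
  applies to it, and the truncation error is uniformly small.
\<close>
theorem dis_tendsto_imp_moment_convergence:
  fixes \<phi>s :: "nat \<Rightarrow> 'a::euclidean_space \<Rightarrow> complex" and \<psi> :: "'a \<Rightarrow> complex"
  assumes \<alpha>: "0 < \<alpha>" "\<alpha> < 2" and \<phi>s: "\<And>n. \<phi>s n \<in> M_space \<alpha>" and \<phi>: "\<phi> \<in> M_space \<alpha>"
    and lim: "(\<lambda>n. dis \<alpha> \<beta> (\<phi>s n) \<phi>) \<longlonglongrightarrow> 0"
    and \<psi>: "continuous_on UNIV \<psi>" "\<And>v. cmod (\<psi> v) \<le> C * bracket v powr \<alpha>"
  shows "(\<lambda>n. \<integral>v. \<psi> v \<partial>fourier_inv (\<phi>s n)) \<longlonglongrightarrow> (\<integral>v. \<psi> v \<partial>fourier_inv \<phi>)"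
proof -
  define F where "F n = fourier_inv (\<phi>s n)" for n
  define G where "G = fourier_inv \<phi>"
  have F: "F n \<in> P_space \<alpha>" "borel_prob (F n)" "fourier (F n) = \<phi>s n" for n
    using M_space_fourier_inv[OF \<phi>s \<alpha>(1)] P_space_imp_borel_prob unfolding F_def by blast+
  have G: "G \<in> P_space \<alpha>" "borel_prob G" "fourier G = \<phi>"
    using M_space_fourier_inv[OF \<phi> \<alpha>(1)] P_space_imp_borel_prob unfolding G_def by blast+
  have ev: "eventually (\<lambda>n. dist_M \<alpha> (\<phi>s n) \<phi> \<le> ennreal \<delta> \<and> dist_K \<beta> (\<phi>s n) \<phi> \<le> ennreal \<delta>) sequentially" if "\<delta> > 0" for \<delta>
  proof -
    have "eventually (\<lambda>n. dis \<alpha> \<beta> (\<phi>s n) \<phi> < ennreal \<delta>) sequentially"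
      using order_tendstoD(2)[OF lim, of "ennreal \<delta>"] that by simp
    then show ?thesis
    proof eventually_elim
      case (elim n)
      have "dist_M \<alpha> (\<phi>s n) \<phi> \<le> dis \<alpha> \<beta> (\<phi>s n) \<phi>" "dist_K \<beta> (\<phi>s n) \<phi> \<le> dis \<alpha> \<beta> (\<phi>s n) \<phi>"
        by (simp_all add: dis_def add_increasing add_increasing2)
      then show ?case using elim by auto
    qed
  qed
  have tails: "\<exists>R\<ge>1. tail_moment \<alpha> R G \<le> ennreal e \<and> eventually (\<lambda>n. tail_moment \<alpha> R (F n) \<le> ennreal e) sequentially" if e: "e > 0" for e
  proof -
    have pos: "tail_const DIM('a) \<alpha> * e / 2 > 0" using tail_const_pos[of "DIM('a)" \<alpha>] e by simp
    obtain R where R: "R \<ge> 1" and tail: "\<And>F. borel_prob F \<Longrightarrow> dist_M \<alpha> (fourier F) \<phi> \<le> ennreal (tail_const DIM('a) \<alpha> * e / 2) \<Longrightarrow> tail_moment \<alpha> R F \<le> ennreal e"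
      using tail_moment_uniformly_small[OF \<phi> \<alpha>(1) e] by metis
    have "tail_moment \<alpha> R G \<le> ennreal e" by (rule tail[OF G(2)]) (simp add: G(3) dist_M_def)
    moreover have "eventually (\<lambda>n. tail_moment \<alpha> R (F n) \<le> ennreal e) sequentially"
      using ev[OF pos] by eventually_elim (rule tail[OF F(2)], simp add: F(3))
    ultimately show ?thesis using R by blast
  qed
  have tight: "uniformly_tight F"
  proof (rule uniformly_tightI_eventually[OF F(2)])
    fix \<epsilon> :: real assume \<epsilon>: "\<epsilon> > 0"
    obtain R where R: "R \<ge> 1" and evR: "eventually (\<lambda>n. tail_moment \<alpha> R (F n) \<le> ennreal \<epsilon>) sequentially" using tails[OF \<epsilon>] by blast
    from evR have "eventually (\<lambda>n. measure (F n) {v. R < norm v} \<le> \<epsilon>) sequentially"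
    proof eventually_elim
      case (elim n)
      show ?case
        using \<alpha> \<epsilon> by (intro borel_prob.measure_tail_le_tail_moment[OF F(2) R _ elim]) auto
    qed
    then show "\<exists>R N. \<forall>n\<ge>N. measure (F n) {v. R < norm v} \<le> \<epsilon>" unfolding eventually_sequentially by blast
  qed
  have conv: "(\<lambda>n. fourier (F n) \<xi>) \<longlonglongrightarrow> fourier G \<xi>" for \<xi>
  proof (cases "\<xi> = 0")
    case True
    then show ?thesis by (simp add: borel_prob.fourier_0 F(2) G(2))
  next
    case nz: False
    have "(\<lambda>n. \<phi>s n \<xi>) \<longlonglongrightarrow> \<phi> \<xi>"
      unfolding tendsto_iff
    proof (intro allI impI)
      fix e :: real assume e: "e > 0"
      define \<delta> where "\<delta> = e / (2 * norm \<xi> powr \<beta>)"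
      have \<delta>: "\<delta> > 0" using e nz by (simp add: \<delta>_def)
      from ev[OF \<delta>] show "eventually (\<lambda>n. dist (\<phi>s n \<xi>) (\<phi> \<xi>) < e) sequentially"
      proof eventually_elim
        case (elim n)
        have "dist_K \<beta> (\<phi>s n) \<phi> < \<infinity>" using conjunct2[OF elim] by (rule le_less_trans) simp
        then have "cmod (\<phi>s n \<xi> - \<phi> \<xi>) \<le> enn2real (dist_K \<beta> (\<phi>s n) \<phi>) * norm \<xi> powr \<beta>"
          by (rule cmod_diff_le_dist_K[OF _ nz])
        also have "\<dots> \<le> \<delta> * norm \<xi> powr \<beta>"
          using elim \<delta> by (intro mult_right_mono enn2real_leI) auto
        also have "\<dots> < e" using nz e by (simp add: \<delta>_def)
        finally show ?case by (simp add: dist_norm)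
      qed
    qed
    then show ?thesis by (simp add: F(3) G(3))
  qed
  have C: "C \<ge> 0"
  proof -
    have "0 \<le> C * bracket (0::'a) powr \<alpha>" using order_trans[OF norm_ge_zero \<psi>(2)] .
    then show ?thesis by (simp add: bracket_def)
  qed
  have "(\<lambda>n. \<integral>v. \<psi> v \<partial>F n) \<longlonglongrightarrow> (\<integral>v. \<psi> v \<partial>G)"
    unfolding tendsto_iff
  proof (intro allI impI)
    fix \<epsilon> :: real assume \<epsilon>: "\<epsilon> > 0"
    \<comment> \<open>the truncation error is \<open>4 C\<close> times the tail, and \<open>C + 1\<close> avoids a division by zero\<close>
    define e where "e = \<epsilon> / (12 * (C + 1))"
    have e: "e > 0" using \<epsilon> C by (simp add: e_def)
    have Ce: "4 * C * e \<le> \<epsilon> / 3" using \<epsilon> C by (simp add: e_def field_simps)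
    obtain R where R: "R \<ge> 1" "tail_moment \<alpha> R G \<le> ennreal e"
      and evR: "eventually (\<lambda>n. tail_moment \<alpha> R (F n) \<le> ennreal e) sequentially" using tails[OF e] by blast
    define g where "g v = max 0 (min 1 (R + 1 - norm v))" for v :: 'a
    have g: "continuous_on UNIV g" "\<And>v. 0 \<le> g v \<and> g v \<le> 1" "\<And>v. norm v \<le> R \<Longrightarrow> g v = 1"
      unfolding g_def by (auto intro!: continuous_intros)
    have bound: "cmod (of_real (g v) * \<psi> v) \<le> 4 * C * (R + 1) powr \<alpha>" for v
    proof (cases "norm v \<le> R + 1")
      case True
      have "cmod (of_real (g v) * \<psi> v) \<le> cmod (\<psi> v)"
        unfolding norm_mult norm_of_real using g(2)[of v] by (intro mult_left_le_one_le) auto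
      also have "\<dots> \<le> C * (4 * (if norm v \<le> 1 then 1 else norm v powr \<alpha>))"
        using order_trans[OF \<psi>(2)[of v] mult_left_mono[OF bracket_powr_le[OF \<alpha>, of v] C]] .
      also have "\<dots> \<le> C * (4 * (R + 1) powr \<alpha>)"
      proof (intro mult_left_mono C)
        have "1 \<le> (R + 1) powr \<alpha>" using R \<alpha> by (intro ge_one_powr_ge_zero) auto
        moreover have "norm v powr \<alpha> \<le> (R + 1) powr \<alpha>" using True \<alpha> by (intro powr_mono2) auto
        ultimately show "(if norm v \<le> 1 then 1 else norm v powr \<alpha>) \<le> (R + 1) powr \<alpha>" by simp
      qed simp
      finally show ?thesis by simp
    next
      case False
      then have "g v = 0" by (simp add: g_def)
      then show ?thesis using C by simp
    qed
    have "(\<lambda>n. \<integral>v. of_real (g v) * \<psi> v \<partial>F n) \<longlonglongrightarrow> (\<integral>v. of_real (g v) * \<psi> v \<partial>G)"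
      by (rule weak_convergence_complex[OF F(2) G(2) tight conv _ bound]) (intro continuous_intros g(1) \<psi>(1))
    then have "eventually (\<lambda>n. dist (\<integral>v. of_real (g v) * \<psi> v \<partial>F n) (\<integral>v. of_real (g v) * \<psi> v \<partial>G) < \<epsilon> / 3) sequentially"
      using \<epsilon> by (intro tendstoD) auto
    then show "eventually (\<lambda>n. dist (\<integral>v. \<psi> v \<partial>F n) (\<integral>v. \<psi> v \<partial>G) < \<epsilon>) sequentially"
      using evR
    proof eventually_elim
      case (elim n)
      have 1: "dist (\<integral>v. \<psi> v \<partial>F n) (\<integral>v. of_real (g v) * \<psi> v \<partial>F n) \<le> \<epsilon> / 3"
        unfolding dist_norm
        using truncation_error_le_tail[OF F(2) P_space_integrable_powr[OF F(1)] \<alpha> \<psi> C g R(1) elim(2) less_imp_le[OF e]] Ce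
        by (rule order_trans)
      have 2: "dist (\<integral>v. \<psi> v \<partial>G) (\<integral>v. of_real (g v) * \<psi> v \<partial>G) \<le> \<epsilon> / 3"
        unfolding dist_norm
        using truncation_error_le_tail[OF G(2) P_space_integrable_powr[OF G(1)] \<alpha> \<psi> C g R(1) R(2) less_imp_le[OF e]] Ce
        by (rule order_trans)
      from elim(1) 1 2 dist_triangle[of "\<integral>v. \<psi> v \<partial>F n" "\<integral>v. \<psi> v \<partial>G" "\<integral>v. of_real (g v) * \<psi> v \<partial>F n"]
        dist_triangle2[of "\<integral>v. of_real (g v) * \<psi> v \<partial>F n" "\<integral>v. \<psi> v \<partial>G" "\<integral>v. of_real (g v) * \<psi> v \<partial>G"]
      show ?case by linarith
    qed
  qed
  then show ?thesis by (simp add: F_def G_def)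
qed

section \<open>Structure of the spaces of characteristic functions\<close>

theorem fourier_P_space_psubset_K_space:
  assumes \<alpha>: "0 < \<alpha>" "\<alpha> < 2"
  shows "fourier ` (P_space \<alpha> :: 'a::euclidean_space measure set) \<subset> K_space \<alpha>"
proof -
  obtain F :: "'a measure" where F: "borel_prob F" "\<not> integrable F (\<lambda>v. norm v powr \<alpha>)" "fourier F \<in> K_space \<alpha>"
    using infinite_moment_with_K_space_fourier[OF \<alpha>] by metis
  have "fourier F \<notin> fourier ` P_space \<alpha>"
  proof
    assume "fourier F \<in> fourier ` P_space \<alpha>"
    then obtain G where G: "G \<in> P_space \<alpha>" "fourier F = fourier G" by blast
    then have "F = G" using fourier_inj[OF F(1) P_space_imp_borel_prob] by blast
    with G F(2) show False using P_space_integrable_powr by blast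
  qed
  with F(3) fourier_P_space_subset_K_space[OF \<alpha>] show ?thesis by blast
qed

theorem theorem1p1:
  shows
  "(\<forall>\<alpha> \<beta>. 0 < \<beta> \<and> \<beta> \<le> \<alpha> \<and> \<alpha> < 2 \<longrightarrow>
      (\<forall>\<phi>\<in>(M_space \<alpha> :: ('a::euclidean_space \<Rightarrow> complex) set). \<forall>\<psi>\<in>M_space \<alpha>. dis \<alpha> \<beta> \<phi> \<psi> < \<infinity>) \<and>
      Metric_space (M_space \<alpha> :: ('a \<Rightarrow> complex) set) (\<lambda>\<phi> \<psi>. enn2real (dis \<alpha> \<beta> \<phi> \<psi>)) \<and>
      Metric_space.mcomplete (M_space \<alpha> :: ('a \<Rightarrow> complex) set) (\<lambda>\<phi> \<psi>. enn2real (dis \<alpha> \<beta> \<phi> \<psi>)))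
   \<and>
   (\<forall>\<alpha> \<beta> \<beta>'. 0 < \<alpha> \<and> \<alpha> < 2 \<and> \<beta> \<in> {0<..\<alpha>} \<and> \<beta>' \<in> {0<..\<alpha>} \<longrightarrow>
      (\<forall>\<phi>\<^sub>0\<in>(M_space \<alpha> :: ('a \<Rightarrow> complex) set). \<forall>\<epsilon>::real. \<epsilon> > 0 \<longrightarrow>
        (\<exists>\<delta>::real. \<delta> > 0 \<and>
          (\<forall>\<phi>\<in>M_space \<alpha>. dis \<alpha> \<beta> \<phi> \<phi>\<^sub>0 < ennreal \<delta> \<longrightarrow> dis \<alpha> \<beta>' \<phi> \<phi>\<^sub>0 < ennreal \<epsilon>))))
   \<and>
   (\<forall>\<alpha> \<beta>. 0 < \<alpha> \<and> \<alpha> < 2 \<and> \<alpha> < \<beta> \<longrightarrow>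
      (K_space \<beta> :: ('a \<Rightarrow> complex) set) \<subseteq> M_space \<alpha>)
   \<and>
   (\<forall>\<alpha>. 0 < \<alpha> \<and> \<alpha> < 2 \<longrightarrow>
      (M_space \<alpha> :: ('a \<Rightarrow> complex) set) \<subseteq> fourier ` P_space \<alpha> \<and>
      fourier ` (P_space \<alpha> :: 'a measure set) \<subset> K_space \<alpha>)
   \<and>
   (\<forall>\<alpha>. 0 < \<alpha> \<and> \<alpha> < 2 \<and> \<alpha> \<noteq> 1 \<longrightarrow>
      (M_space \<alpha> :: ('a \<Rightarrow> complex) set) = fourier ` P_space \<alpha>)
   \<and>
   (\<forall>\<alpha> \<beta> (\<phi>s :: nat \<Rightarrow> 'a \<Rightarrow> complex) \<phi>.
      0 < \<beta> \<and> \<beta> \<le> \<alpha> \<and> \<alpha> < 2 \<and> (\<forall>n. \<phi>s n \<in> M_space \<alpha>) \<and> \<phi> \<in> M_space \<alpha> \<longrightarrow>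
      (\<forall>n. fourier_inv (\<phi>s n) \<in> P_space \<alpha>) \<and> fourier_inv \<phi> \<in> P_space \<alpha> \<and>
      ((\<lambda>n. dis \<alpha> \<beta> (\<phi>s n) \<phi>) \<longlonglongrightarrow> 0 \<longrightarrow>
        (\<forall>\<psi> :: 'a \<Rightarrow> complex. continuous_on UNIV \<psi> \<and>
            (\<exists>C::real. \<forall>v. cmod (\<psi> v) \<le> C * bracket v powr \<alpha>) \<longrightarrow>
          (\<lambda>n. \<integral>v. \<psi> v \<partial>fourier_inv (\<phi>s n)) \<longlonglongrightarrow> (\<integral>v. \<psi> v \<partial>fourier_inv \<phi>))))"
proof (intro conjI allI impI ballI; (elim conjE)?)
  fix \<alpha> \<beta> :: real and \<phi> \<psi> :: "'a \<Rightarrow> complex"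
  assume "0 < \<beta>" "\<beta> \<le> \<alpha>" "\<alpha> < 2" "\<phi> \<in> M_space \<alpha>" "\<psi> \<in> M_space \<alpha>"
  then show "dis \<alpha> \<beta> \<phi> \<psi> < \<infinity>" by (rule dis_finite)
next
  fix \<alpha> \<beta> :: real
  assume "0 < \<beta>" "\<beta> \<le> \<alpha>" "\<alpha> < 2"
  then show "Metric_space (M_space \<alpha> :: ('a \<Rightarrow> complex) set) (\<lambda>\<phi> \<psi>. enn2real (dis \<alpha> \<beta> \<phi> \<psi>))"
    by (rule Metric_space_M_space)
next
  fix \<alpha> \<beta> :: real
  assume "0 < \<beta>" "\<beta> \<le> \<alpha>" "\<alpha> < 2"
  then show "Metric_space.mcomplete (M_space \<alpha> :: ('a \<Rightarrow> complex) set) (\<lambda>\<phi> \<psi>. enn2real (dis \<alpha> \<beta> \<phi> \<psi>))"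
    by (rule mcomplete_M_space)
next
  fix \<alpha> \<beta> \<beta>' \<epsilon> :: real and \<phi>\<^sub>0 :: "'a \<Rightarrow> complex"
  assume "0 < \<alpha>" "\<alpha> < 2" "\<beta> \<in> {0<..\<alpha>}" "\<beta>' \<in> {0<..\<alpha>}" "\<phi>\<^sub>0 \<in> M_space \<alpha>" "\<epsilon> > 0"
  then show "\<exists>\<delta>>0. \<forall>\<phi>\<in>M_space \<alpha>. dis \<alpha> \<beta> \<phi> \<phi>\<^sub>0 < ennreal \<delta> \<longrightarrow> dis \<alpha> \<beta>' \<phi> \<phi>\<^sub>0 < ennreal \<epsilon>"
    by (intro dis_equivalent) auto
next
  fix \<alpha> \<beta> :: real
  assume "0 < \<alpha>" "\<alpha> < 2" "\<alpha> < \<beta>"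
  then show "(K_space \<beta> :: ('a \<Rightarrow> complex) set) \<subseteq> M_space \<alpha>" by (intro K_space_subset_M_space)
next
  fix \<alpha> :: real
  assume "0 < \<alpha>" "\<alpha> < 2"
  then show "(M_space \<alpha> :: ('a \<Rightarrow> complex) set) \<subseteq> fourier ` P_space \<alpha>"
    by (intro M_space_subset_fourier_P_space)
next
  fix \<alpha> :: real
  assume "0 < \<alpha>" "\<alpha> < 2"
  then show "fourier ` (P_space \<alpha> :: 'a measure set) \<subset> K_space \<alpha>" by (rule fourier_P_space_psubset_K_space)
next
  fix \<alpha> :: real
  assume "0 < \<alpha>" "\<alpha> < 2" "\<alpha> \<noteq> 1"
  then show "(M_space \<alpha> :: ('a \<Rightarrow> complex) set) = fourier ` P_space \<alpha>"
    by (intro equalityI M_space_subset_fourier_P_space fourier_P_space_subset_M_space)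
next
  fix \<alpha> \<beta> :: real and \<phi>s :: "nat \<Rightarrow> 'a \<Rightarrow> complex" and \<phi> n
  assume "0 < \<beta>" "\<beta> \<le> \<alpha>" "\<alpha> < 2" "\<forall>n. \<phi>s n \<in> M_space \<alpha>" "\<phi> \<in> M_space \<alpha>"
  then show "fourier_inv (\<phi>s n) \<in> P_space \<alpha>" by (intro M_space_fourier_inv) auto
next
  fix \<alpha> \<beta> :: real and \<phi>s :: "nat \<Rightarrow> 'a \<Rightarrow> complex" and \<phi>
  assume "0 < \<beta>" "\<beta> \<le> \<alpha>" "\<alpha> < 2" "\<forall>n. \<phi>s n \<in> M_space \<alpha>" "\<phi> \<in> M_space \<alpha>"
  then show "fourier_inv \<phi> \<in> P_space \<alpha>" by (intro M_space_fourier_inv) auto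
next
  fix \<alpha> \<beta> :: real and \<phi>s :: "nat \<Rightarrow> 'a \<Rightarrow> complex" and \<phi> and \<psi> :: "'a \<Rightarrow> complex"
  assume "0 < \<beta>" "\<beta> \<le> \<alpha>" "\<alpha> < 2" "\<forall>n. \<phi>s n \<in> M_space \<alpha>" "\<phi> \<in> M_space \<alpha>"
    "(\<lambda>n. dis \<alpha> \<beta> (\<phi>s n) \<phi>) \<longlonglongrightarrow> 0"
    "continuous_on UNIV \<psi>" "\<exists>C. \<forall>v. cmod (\<psi> v) \<le> C * bracket v powr \<alpha>"
  then show "(\<lambda>n. \<integral>v. \<psi> v \<partial>fourier_inv (\<phi>s n)) \<longlonglongrightarrow> (\<integral>v. \<psi> v \<partial>fourier_inv \<phi>)"
    by (elim exE) (intro dis_tendsto_imp_moment_convergence[where \<alpha>=\<alpha> and \<beta>=\<beta>], auto)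
qed

end
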